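(* Let $\mathfrak{S}=(M\xleftarrow{\pi}L\xrightarrow{\iota}N)$ be a linked space, let $p\in M$ and $q\in N$ be points, and let $\Pi_1=\Pi_1(\mathfrak{S};\{p,q\})$ be the homotopy category of the full sub-$\infty$-category of $\mathbf{EX}(\mathfrak{S})$ generated by $p$ and $q$. Suppose that $q\in L_p$ (i.e. $q\in\iota(L_p)$, where $L_p=\pi^{-1}(p)$) and that $L_p$ is connected. Then $\Pi_1$ is a category with objects $p$ and $q$, satisfying $\mathrm{End}(p)\cong\pi_1(M)$, $\mathrm{End}(q)\cong\pi_1(N)$, and $\mathrm{Hom}(p,q)\cong\pi_1(N)/\pi_1(L_p)$.
   Context: A linked space is a span $M\xleftarrow{\pi}L\xrightarrow{\iota}N$ of topological spaces with $\pi$ a fibration and $\iota$ a cofibration; spaces are identified with their singular simplicial sets. $\pi_1(M)$ is based at $p$, and $\pi_1(N)$ and $\pi_1(L_p)$ are based at $q$; $\pi_1(N)/\pi_1(L_p)$ is the set of cosets of the image of the homomorphism $\pi_1(L_p)\to\pi_1(N)$ induced by $\iota$. For a span $(M\xleftarrow{\pi}L\xhookrightarrow{\iota}N)$ of simplicial sets with $\iota$ a monomorphism, $\mathbf{EX}$ is the simplicial set with $\mathbf{EX}_0=M_0\amalg N_0$ and, for $k\ge1$, $\mathbf{EX}_k=M_k\amalg \mathbf{P}^\Delta_{k-1}\amalg N_k$, where $\mathbf{P}^\Delta_{k-1}$ is the set of pairs $(\gamma,j)$ with $\gamma\in N_k$, $j\in\{1,\dots,k\}$ and $\gamma|_{0,\dots,j-1}\in\iota(L_{j-1})$.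 $M$ and $N$ are simplicial subsets, and for $\alpha\colon[m]\to[k]$: if $\alpha(i)<j$ for all $i$ then $\alpha^*(\gamma,j)=\pi(\iota^{-1}(\alpha^*\gamma))\in M_m$; if $\alpha(0)\ge j$ then $\alpha^*(\gamma,j)=\alpha^*\gamma\in N_m$; otherwise $\alpha^*(\gamma,j)=(\alpha^*\gamma,j')$ with $j'=\min\{i:\alpha(i)\ge j\}$. For linked spaces it is an $\infty$-category (quasi-category). *)

theory Defs
  imports "HOL-Homology.Homology"
begin

section \<open>Linked spaces\<close>

abbreviation unit_interval :: "real topology" where
  "unit_interval \<equiv> top_of_set {0..1}"

definition lifts_homotopies :: "'z topology \<Rightarrow> 'e topology \<Rightarrow> 'b topology \<Rightarrow> ('e \<Rightarrow> 'b) \<Rightarrow> bool" where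
  "lifts_homotopies Z E B \<pi> \<longleftrightarrow>
     (\<forall>f h. continuous_map Z E f \<and> continuous_map (prod_topology Z unit_interval) B h \<and>
            (\<forall>z\<in>topspace Z. h (z, 0) = \<pi> (f z)) \<longrightarrow>
        (\<exists>k. continuous_map (prod_topology Z unit_interval) E k \<and>
             (\<forall>z\<in>topspace Z. k (z, 0) = f z) \<and>
             (\<forall>z\<in>topspace Z. \<forall>t\<in>{0..1}. \<pi> (k (z, t)) = h (z, t))))"

text \<open>Serre fibrations; these are the maps whose singular simplicial map is a Kan fibration, and every
  Hurewicz fibration is one.\<close>

definition fibration :: "'e topology \<Rightarrow> 'b topology \<Rightarrow> ('e \<Rightarrow> 'b) \<Rightarrow> bool" where
  "fibration E B \<pi> \<longleftrightarrow>
     continuous_map E B \<pi> \<and>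
     (\<forall>n::nat. lifts_homotopies (product_topology (\<lambda>_. unit_interval) {..<n}) E B \<pi>)"

definition extends_homotopies :: "'z topology \<Rightarrow> 'l topology \<Rightarrow> 'n topology \<Rightarrow> ('l \<Rightarrow> 'n) \<Rightarrow> bool" where
  "extends_homotopies Z L N \<iota> \<longleftrightarrow>
     (\<forall>f h. continuous_map N Z f \<and> continuous_map (prod_topology L unit_interval) Z h \<and>
            (\<forall>x\<in>topspace L. h (x, 0) = f (\<iota> x)) \<longrightarrow>
        (\<exists>k. continuous_map (prod_topology N unit_interval) Z k \<and>
             (\<forall>y\<in>topspace N. k (y, 0) = f y) \<and>
             (\<forall>x\<in>topspace L. \<forall>t\<in>{0..1}. k (\<iota> x, t) = h (x, t))))"

text \<open>Hurewicz cofibrations.  The homotopy extension property asks for all target spaces, which HOL cannot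
  quantify over since they live on arbitrary types.  We let the target range over all spaces on a
  type that is large enough to carry the mapping cylinder of \<open>\<iota>\<close>; lemma \<open>cofibration_extends_homotopies\<close>
  below derives the property for targets on every type.\<close>

definition cofibration :: "'l topology \<Rightarrow> 'n topology \<Rightarrow> ('l \<Rightarrow> 'n) \<Rightarrow> bool" where
  "cofibration L N \<iota> \<longleftrightarrow>
     continuous_map L N \<iota> \<and>
     (\<forall>Z :: ('l \<times> real + 'n) topology. extends_homotopies Z L N \<iota>)"

definition linked_space ::
    "'m topology \<Rightarrow> 'l topology \<Rightarrow> 'n topology \<Rightarrow> ('l \<Rightarrow> 'm) \<Rightarrow> ('l \<Rightarrow> 'n) \<Rightarrow> bool" where
  "linked_space M L N \<pi> \<iota> \<longleftrightarrow> fibration L M \<pi> \<and> cofibration L N \<iota>"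

definition fibre :: "'l topology \<Rightarrow> ('l \<Rightarrow> 'm) \<Rightarrow> 'm \<Rightarrow> 'l topology" where
  "fibre L \<pi> p = subtopology L {x \<in> topspace L. \<pi> x = p}"

text \<open>The mapping cylinder, with \<open>(x, 0)\<close> represented by \<open>\<iota> x\<close>.\<close>

definition cyl_map :: "('l \<Rightarrow> 'n) \<Rightarrow> 'l \<times> real \<Rightarrow> 'l \<times> real + 'n" where
  "cyl_map \<iota> z = (if snd z = 0 then Inr (\<iota> (fst z)) else Inl z)"

definition mapping_cylinder :: "'l topology \<Rightarrow> 'n topology \<Rightarrow> ('l \<Rightarrow> 'n) \<Rightarrow> ('l \<times> real + 'n) topology" where
  "mapping_cylinder L N \<iota> = topology (\<lambda>U.
     U \<subseteq> cyl_map \<iota> ` (topspace L \<times> {0..1}) \<union> Inr ` topspace N \<and>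
     openin (prod_topology L unit_interval) {z \<in> topspace L \<times> {0..1}. cyl_map \<iota> z \<in> U} \<and>
     openin N {y \<in> topspace N. Inr y \<in> U})"

lemma openin_mapping_cylinder:
  "openin (mapping_cylinder L N \<iota>) U \<longleftrightarrow>
     U \<subseteq> cyl_map \<iota> ` (topspace L \<times> {0..1}) \<union> Inr ` topspace N \<and>
     openin (prod_topology L unit_interval) {z \<in> topspace L \<times> {0..1}. cyl_map \<iota> z \<in> U} \<and>
     openin N {y \<in> topspace N. Inr y \<in> U}"
proof -
  let ?P = "\<lambda>U. U \<subseteq> cyl_map \<iota> ` (topspace L \<times> {0..1}) \<union> Inr ` topspace N \<and>
     openin (prod_topology L unit_interval) {z \<in> topspace L \<times> {0..1}. cyl_map \<iota> z \<in> U} \<and>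
     openin N {y \<in> topspace N. Inr y \<in> U}"
  have "istopology ?P"
    unfolding istopology_def
  proof (intro conjI allI impI)
    fix S T assume S: "?P S" and T: "?P T"
    show "S \<inter> T \<subseteq> cyl_map \<iota> ` (topspace L \<times> {0..1}) \<union> Inr ` topspace N"
      using S by blast
    have "{z \<in> topspace L \<times> {0..1}. cyl_map \<iota> z \<in> S \<inter> T}
        = {z \<in> topspace L \<times> {0..1}. cyl_map \<iota> z \<in> S} \<inter> {z \<in> topspace L \<times> {0..1}. cyl_map \<iota> z \<in> T}"
      by blast
    then show "openin (prod_topology L unit_interval) {z \<in> topspace L \<times> {0..1}. cyl_map \<iota> z \<in> S \<inter> T}"
      using S T by (metis (no_types, lifting) openin_Int)
    have "{y \<in> topspace N. Inr y \<in> S \<inter> T} = {y \<in> topspace N. Inr y \<in> S} \<inter> {y \<in> topspace N. Inr y \<in> T}"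
      by blast
    then show "openin N {y \<in> topspace N. Inr y \<in> S \<inter> T}"
      using S T by (metis (no_types, lifting) openin_Int)
  next
    fix K assume K: "\<forall>S\<in>K. ?P S"
    show "\<Union>K \<subseteq> cyl_map \<iota> ` (topspace L \<times> {0..1}) \<union> Inr ` topspace N"
      using K by blast
    have "{z \<in> topspace L \<times> {0..1}. cyl_map \<iota> z \<in> \<Union>K}
        = (\<Union>S\<in>K. {z \<in> topspace L \<times> {0..1}. cyl_map \<iota> z \<in> S})"
      by blast
    moreover have "openin (prod_topology L unit_interval) \<dots>"
      using K by (intro openin_Union) blast
    ultimately show "openin (prod_topology L unit_interval) {z \<in> topspace L \<times> {0..1}. cyl_map \<iota> z \<in> \<Union>K}"
      by simp
    have "{y \<in> topspace N. Inr y \<in> \<Union>K} = (\<Union>S\<in>K. {y \<in> topspace N. Inr y \<in> S})"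
      by blast
    moreover have "openin N \<dots>"
      using K by (intro openin_Union) blast
    ultimately show "openin N {y \<in> topspace N. Inr y \<in> \<Union>K}"
      by simp
  qed
  then show ?thesis
    unfolding mapping_cylinder_def by (simp add: topology_inverse')
qed

lemma topspace_mapping_cylinder:
  assumes "\<iota> \<in> topspace L \<rightarrow> topspace N"
  shows "topspace (mapping_cylinder L N \<iota>) = cyl_map \<iota> ` (topspace L \<times> {0..1}) \<union> Inr ` topspace N"
    (is "_ = ?C")
proof -
  have "openin (mapping_cylinder L N \<iota>) ?C"
  proof -
    have "{z \<in> topspace L \<times> {0..1}. cyl_map \<iota> z \<in> ?C} = topspace (prod_topology L unit_interval)"
      by auto
    moreover have "{y \<in> topspace N. Inr y \<in> ?C} = topspace N"
      by auto
    ultimately show ?thesis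
      by (simp add: openin_mapping_cylinder del: topspace_prod_topology)
  qed
  moreover have "U \<subseteq> ?C" if "openin (mapping_cylinder L N \<iota>) U" for U
    using that by (simp add: openin_mapping_cylinder)
  ultimately show ?thesis
    unfolding topspace_def by blast
qed

lemma
  assumes "\<iota> \<in> topspace L \<rightarrow> topspace N"
  shows continuous_map_cyl_map:
      "continuous_map (prod_topology L unit_interval) (mapping_cylinder L N \<iota>) (cyl_map \<iota>)"
    and continuous_map_cyl_Inr: "continuous_map N (mapping_cylinder L N \<iota>) Inr"
  using assms
  by (auto simp: continuous_map_def topspace_mapping_cylinder openin_mapping_cylinder)

lemma cofibration_inj_on:
  assumes "cofibration L N \<iota>"
  shows "inj_on \<iota> (topspace L)"
proof -
  let ?Z = "mapping_cylinder L N \<iota>"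
  have \<iota>: "\<iota> \<in> topspace L \<rightarrow> topspace N" and ext: "extends_homotopies ?Z L N \<iota>"
    using assms by (auto simp: cofibration_def continuous_map_def)
  obtain k where "\<forall>x\<in>topspace L. \<forall>t\<in>{0..1}. k (\<iota> x, t) = cyl_map \<iota> (x, t)"
    using ext[unfolded extends_homotopies_def, rule_format, of Inr "cyl_map \<iota>"]
      continuous_map_cyl_map[OF \<iota>] continuous_map_cyl_Inr[OF \<iota>]
    by (force simp: cyl_map_def)
  then have "k (\<iota> x, 1) = Inl (x, 1)" if "x \<in> topspace L" for x
    using that by (simp add: cyl_map_def)
  then show ?thesis
    by (metis (mono_tags, lifting) Inl_inject inj_onI prod.inject)
qed

lemma cofibration_extends_homotopies:
  fixes Z :: "'z topology"
  assumes "cofibration L N \<iota>"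
  shows "extends_homotopies Z L N \<iota>"
  unfolding extends_homotopies_def
proof (intro allI impI, elim conjE)
  fix f h
  assume f: "continuous_map N Z f" and h: "continuous_map (prod_topology L unit_interval) Z h"
    and fh: "\<forall>x\<in>topspace L. h (x, 0) = f (\<iota> x)"
  let ?Y = "mapping_cylinder L N \<iota>"
  have \<iota>: "\<iota> \<in> topspace L \<rightarrow> topspace N" and ext: "extends_homotopies ?Y L N \<iota>"
    using assms by (auto simp: cofibration_def continuous_map_def)
  obtain k where k: "continuous_map (prod_topology N unit_interval) ?Y k"
    "\<forall>y\<in>topspace N. k (y, 0) = Inr y"
    "\<forall>x\<in>topspace L. \<forall>t\<in>{0..1}. k (\<iota> x, t) = cyl_map \<iota> (x, t)"
    using ext[unfolded extends_homotopies_def, rule_format, of Inr "cyl_map \<iota>"]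
      continuous_map_cyl_map[OF \<iota>] continuous_map_cyl_Inr[OF \<iota>]
    by (force simp: cyl_map_def)
  define r where "r = case_sum h f"
  have r1: "r (cyl_map \<iota> z) = h z" if "z \<in> topspace L \<times> {0..1}" for z
    using that fh by (cases z) (auto simp: r_def cyl_map_def)
  have r: "continuous_map ?Y Z r"
    unfolding continuous_map_def
  proof (intro conjI allI impI)
    show "r \<in> topspace ?Y \<rightarrow> topspace Z"
      using f h r1 by (auto simp: topspace_mapping_cylinder[OF \<iota>] continuous_map_def r_def Pi_iff)
    fix U assume U: "openin Z U"
    have "{z \<in> topspace L \<times> {0..1}. cyl_map \<iota> z \<in> {x \<in> topspace ?Y. r x \<in> U}}
        = {z \<in> topspace (prod_topology L unit_interval). h z \<in> U}"
    proof -
      have "cyl_map \<iota> z \<in> topspace ?Y" if "z \<in> topspace L \<times> {0..1}" for z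
        using that by (auto simp: topspace_mapping_cylinder[OF \<iota>])
      then show ?thesis
        using r1 by auto
    qed
    moreover have "{y \<in> topspace N. Inr y \<in> {x \<in> topspace ?Y. r x \<in> U}} = {y \<in> topspace N. f y \<in> U}"
      by (auto simp: topspace_mapping_cylinder[OF \<iota>] r_def)
    ultimately show "openin ?Y {x \<in> topspace ?Y. r x \<in> U}"
      using openin_continuous_map_preimage[OF f U] openin_continuous_map_preimage[OF h U]
      by (simp add: openin_mapping_cylinder del: topspace_prod_topology)
         (auto simp: topspace_mapping_cylinder[OF \<iota>])
  qed
  show "\<exists>k. continuous_map (prod_topology N unit_interval) Z k \<and>
             (\<forall>y\<in>topspace N. k (y, 0) = f y) \<and>
             (\<forall>x\<in>topspace L. \<forall>t\<in>{0..1}. k (\<iota> x, t) = h (x, t))"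
    using k r1 continuous_map_compose[OF k(1) r]
    by (intro exI[of _ "r \<circ> k"]) (auto simp: r_def)
qed


section \<open>The fundamental group\<close>

definition loops :: "'a topology \<Rightarrow> 'a \<Rightarrow> (real \<Rightarrow> 'a) set" where
  "loops X x = {f. pathin X f \<and> f 0 = x \<and> f 1 = x}"

definition loop_homotopic :: "'a topology \<Rightarrow> 'a \<Rightarrow> (real \<Rightarrow> 'a) \<Rightarrow> (real \<Rightarrow> 'a) \<Rightarrow> bool" where
  "loop_homotopic X x = homotopic_with (\<lambda>h. h 0 = x \<and> h 1 = x) unit_interval X"

definition loop_class :: "'a topology \<Rightarrow> 'a \<Rightarrow> (real \<Rightarrow> 'a) \<Rightarrow> (real \<Rightarrow> 'a) set" where
  "loop_class X x f = {g \<in> loops X x. loop_homotopic X x f g}"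

text \<open>In a product \<open>f\<close> is traversed first.  Exit paths starting in \<open>L\<^sub>p\<close> are precomposed with loops of
  \<open>L\<^sub>p\<close>, so that in this order the cosets of \<open>\<pi>\<^sub>1(L\<^sub>p)\<close> parametrising them are right cosets \<open>H g\<close>.\<close>

definition concat_path :: "(real \<Rightarrow> 'a) \<Rightarrow> (real \<Rightarrow> 'a) \<Rightarrow> real \<Rightarrow> 'a" where
  "concat_path f g = (\<lambda>t. if t \<le> 1/2 then f (2 * t) else g (2 * t - 1))"

definition fundamental_group :: "'a topology \<Rightarrow> 'a \<Rightarrow> (real \<Rightarrow> 'a) set monoid" where
  "fundamental_group X x =
     \<lparr>carrier = loop_class X x ` loops X x,
      mult = (\<lambda>A B. \<Union>f\<in>A. \<Union>g\<in>B. loop_class X x (concat_path f g)),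
      one = loop_class X x (\<lambda>_. x)\<rparr>"

definition fundamental_group_map ::
    "'b topology \<Rightarrow> 'b \<Rightarrow> ('a \<Rightarrow> 'b) \<Rightarrow> (real \<Rightarrow> 'a) set \<Rightarrow> (real \<Rightarrow> 'b) set" where
  "fundamental_group_map Y y h A = (\<Union>f\<in>A. loop_class Y y (h \<circ> f))"


section \<open>Simplicial sets\<close>

text \<open>\<open>act S k m \<alpha>\<close> is the operator \<open>\<alpha>\<^sup>* : S\<^sub>k \<rightarrow> S\<^sub>m\<close> of an order preserving map
  \<open>\<alpha> : [m] \<rightarrow> [k]\<close>.  Such an \<open>\<alpha>\<close> is represented by a total function of which only the values on
  \<open>{..m}\<close> matter.\<close>

record 'a sset =
  simplices :: "nat \<Rightarrow> 'a set"
  act :: "nat \<Rightarrow> nat \<Rightarrow> (nat \<Rightarrow> nat) \<Rightarrow> 'a \<Rightarrow> 'a"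

definition ordmap :: "nat \<Rightarrow> nat \<Rightarrow> (nat \<Rightarrow> nat) \<Rightarrow> bool" where
  "ordmap m k \<alpha> \<longleftrightarrow> mono_on {..m} \<alpha> \<and> \<alpha> ` {..m} \<subseteq> {..k}"

definition simplicial_set :: "'a sset \<Rightarrow> bool" where
  "simplicial_set S \<longleftrightarrow>
     (\<forall>m k \<alpha> x. ordmap m k \<alpha> \<and> x \<in> simplices S k \<longrightarrow> act S k m \<alpha> x \<in> simplices S m) \<and>
     (\<forall>m k \<alpha> \<beta> x. ordmap m k \<alpha> \<and> x \<in> simplices S k \<and> (\<forall>i\<le>m. \<alpha> i = \<beta> i) \<longrightarrow> act S k m \<alpha> x = act S k m \<beta> x) \<and>
     (\<forall>k x. x \<in> simplices S k \<longrightarrow> act S k k id x = x) \<and>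
     (\<forall>l m k \<alpha> \<beta> x. ordmap m k \<alpha> \<and> ordmap l m \<beta> \<and> x \<in> simplices S k \<longrightarrow>
        act S k l (\<alpha> \<circ> \<beta>) x = act S m l \<beta> (act S k m \<alpha> x))"

definition simplicial_map :: "'a sset \<Rightarrow> 'b sset \<Rightarrow> (nat \<Rightarrow> 'a \<Rightarrow> 'b) \<Rightarrow> bool" where
  "simplicial_map S T f \<longleftrightarrow>
     (\<forall>k. f k \<in> simplices S k \<rightarrow> simplices T k) \<and>
     (\<forall>m k \<alpha> x. ordmap m k \<alpha> \<and> x \<in> simplices S k \<longrightarrow> f m (act S k m \<alpha> x) = act T k m \<alpha> (f k x))"

definition vertex :: "'a sset \<Rightarrow> nat \<Rightarrow> nat \<Rightarrow> 'a \<Rightarrow> 'a" where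
  "vertex S k i x = act S k 0 (\<lambda>_. i) x"

definition full_sub :: "'a sset \<Rightarrow> 'a set \<Rightarrow> 'a sset" where
  "full_sub S V = \<lparr>simplices = (\<lambda>k. {x \<in> simplices S k. \<forall>i\<le>k. vertex S k i x \<in> V}), act = act S\<rparr>"

definition affine_of :: "nat \<Rightarrow> (nat \<Rightarrow> nat) \<Rightarrow> (nat \<Rightarrow> real) \<Rightarrow> nat \<Rightarrow> real" where
  "affine_of m \<alpha> = oriented_simplex m (\<lambda>j i. if i = \<alpha> j then 1 else 0)"

definition Sing :: "'a topology \<Rightarrow> ((nat \<Rightarrow> real) \<Rightarrow> 'a) sset" where
  "Sing X = \<lparr>simplices = (\<lambda>k. singular_simplex_set k X), act = (\<lambda>k m \<alpha> \<sigma>. simplex_map m \<sigma> (affine_of m \<alpha>))\<rparr>"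

definition point_simplex :: "'a \<Rightarrow> (nat \<Rightarrow> real) \<Rightarrow> 'a" where
  "point_simplex x = (\<lambda>_\<in>standard_simplex 0. x)"

lemma affine_of_apply:
  "x \<in> standard_simplex m \<Longrightarrow> affine_of m \<alpha> x = (\<lambda>i. \<Sum>j\<le>m. (if i = \<alpha> j then 1 else 0) * x j)"
  by (simp add: affine_of_def oriented_simplex_def)

lemma affine_of_in:
  assumes "ordmap m k \<alpha>" and x: "x \<in> standard_simplex m"
  shows "affine_of m \<alpha> x \<in> standard_simplex k"
proof -
  have \<alpha>: "\<alpha> j \<le> k" if "j \<le> m" for j
    using assms that by (auto simp: ordmap_def)
  have x0: "0 \<le> x j" for j
    using x by (auto simp: standard_simplex_def)
  have x1: "(\<Sum>j\<le>m. x j) = 1"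
    using x by (auto simp: standard_simplex_def)
  have "(\<Sum>j\<le>m. (if i = \<alpha> j then 1 else 0) * x j) \<le> (\<Sum>j\<le>m. x j)" for i
    using x0 by (intro sum_mono) auto
  moreover have "0 \<le> (\<Sum>j\<le>m. (if i = \<alpha> j then 1 else 0) * x j)" for i
    using x0 by (intro sum_nonneg) auto
  moreover have "(\<Sum>j\<le>m. (if i = \<alpha> j then 1 else 0) * x j) = 0" if "i > k" for i
    using \<alpha> that by (intro sum.neutral) force
  moreover have "(\<Sum>i\<le>k. \<Sum>j\<le>m. (if i = \<alpha> j then 1 else 0) * x j) = 1"
  proof -
    have "(\<Sum>i\<le>k. \<Sum>j\<le>m. (if i = \<alpha> j then 1 else 0) * x j)
        = (\<Sum>j\<le>m. \<Sum>i\<le>k. if i = \<alpha> j then x j else 0)"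
      by (subst sum.swap) (auto intro!: sum.cong)
    also have "\<dots> = (\<Sum>j\<le>m. x j)"
      using \<alpha> by (intro sum.cong) auto
    finally show ?thesis
      using x1 by simp
  qed
  ultimately show ?thesis
    using x1 unfolding affine_of_apply[OF x] standard_simplex_def by auto
qed

lemma affine_of_id:
  assumes x: "x \<in> standard_simplex m"
  shows "affine_of m id x = x"
proof
  fix i
  have "(\<Sum>j\<le>m. (if i = j then 1 else 0) * x j) = (\<Sum>j\<le>m. if i = j then x j else 0)"
    by (intro sum.cong) auto
  then show "affine_of m id x i = x i"
    using x by (auto simp: affine_of_apply standard_simplex_def)
qed

lemma affine_of_comp:
  assumes \<beta>: "ordmap l m \<beta>" and x: "x \<in> standard_simplex l"
  shows "affine_of m \<alpha> (affine_of l \<beta> x) = affine_of l (\<alpha> \<circ> \<beta>) x"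
proof
  fix i
  have "affine_of m \<alpha> (affine_of l \<beta> x) i
      = (\<Sum>j\<le>m. \<Sum>t\<le>l. (if i = \<alpha> j then 1 else 0) * ((if j = \<beta> t then 1 else 0) * x t))"
    using affine_of_in[OF assms] x by (simp add: affine_of_apply sum_distrib_left)
  also have "\<dots> = (\<Sum>t\<le>l. \<Sum>j\<le>m. if j = \<beta> t then (if i = \<alpha> (\<beta> t) then 1 else 0) * x t else 0)"
    by (subst sum.swap) (auto intro!: sum.cong)
  also have "\<dots> = (\<Sum>t\<le>l. (if i = \<alpha> (\<beta> t) then 1 else 0) * x t)"
    using \<beta> by (intro sum.cong) (auto simp: ordmap_def)
  finally show "affine_of m \<alpha> (affine_of l \<beta> x) i = affine_of l (\<alpha> \<circ> \<beta>) x i"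
    using x by (simp add: affine_of_apply)
qed

lemma continuous_map_affine_of:
  assumes "ordmap m k \<alpha>"
  shows "continuous_map (subtopology (powertop_real UNIV) (standard_simplex m))
           (subtopology (powertop_real UNIV) (standard_simplex k)) (affine_of m \<alpha>)"
proof -
  have "simplicial_simplex m (standard_simplex k) (affine_of m \<alpha>)"
    using affine_of_in[OF assms] unfolding affine_of_def
    by (subst simplicial_simplex_oriented_simplex) (auto simp: oriented_simplex_def)
  then show ?thesis
    by (simp add: simplicial_simplex_def singular_simplex_def)
qed

lemma simplicial_set_Sing: "simplicial_set (Sing X)"
  unfolding simplicial_set_def
proof (intro conjI allI impI; (elim conjE)?)
  fix m k \<alpha> \<sigma>
  assume \<alpha>: "ordmap m k \<alpha>" and \<sigma>: "\<sigma> \<in> simplices (Sing X) k"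
  show "act (Sing X) k m \<alpha> \<sigma> \<in> simplices (Sing X) m"
  proof -
    have "continuous_map (subtopology (powertop_real UNIV) (standard_simplex m)) X (\<sigma> \<circ> affine_of m \<alpha>)"
      using \<sigma> by (intro continuous_map_compose[OF continuous_map_affine_of[OF \<alpha>]])
        (simp add: Sing_def singular_simplex_def)
    then show ?thesis
      by (auto simp: Sing_def singular_simplex_def simplex_map_def elim: continuous_map_eq)
  qed
next
  fix m k :: nat and \<alpha> \<beta> \<sigma>
  assume "\<forall>i\<le>m. \<alpha> i = (\<beta> i :: nat)"
  then have "affine_of m \<alpha> = affine_of m \<beta>"
    by (auto simp: affine_of_def oriented_simplex_def intro!: restrict_ext sum.cong)
  then show "act (Sing X) k m \<alpha> \<sigma> = act (Sing X) k m \<beta> \<sigma>"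
    by (simp add: Sing_def)
next
  fix k \<sigma>
  assume "\<sigma> \<in> simplices (Sing X) k"
  then show "act (Sing X) k k id \<sigma> = \<sigma>"
    by (auto simp: Sing_def singular_simplex_def simplex_map_def affine_of_id extensional_def)
next
  fix l m k \<alpha> \<beta> \<sigma>
  assume \<alpha>: "ordmap m k \<alpha>" and \<beta>: "ordmap l m \<beta>"
  show "act (Sing X) k l (\<alpha> \<circ> \<beta>) \<sigma> = act (Sing X) m l \<beta> (act (Sing X) k m \<alpha> \<sigma>)"
    using affine_of_in[OF \<beta>] affine_of_comp[OF \<beta>]
    by (auto simp: Sing_def simplex_map_def)
qed

lemma simplicial_map_Sing:
  assumes "continuous_map X Y f"
  shows "simplicial_map (Sing X) (Sing Y) (\<lambda>k. simplex_map k f)"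
  unfolding simplicial_map_def
proof (intro conjI allI impI; (elim conjE)?)
  show "simplex_map k f \<in> simplices (Sing X) k \<rightarrow> simplices (Sing Y) k" for k
    using singular_simplex_simplex_map[OF _ assms] by (auto simp: Sing_def)
  show "simplex_map m f (act (Sing X) k m \<alpha> \<sigma>) = act (Sing Y) k m \<alpha> (simplex_map k f \<sigma>)"
    if "ordmap m k \<alpha>" for m k \<alpha> \<sigma>
    using affine_of_in[OF that] by (auto simp: Sing_def simplex_map_def)
qed

lemma simplicial_set_full_sub:
  assumes S: "simplicial_set S"
  shows "simplicial_set (full_sub S V)"
proof -
  have "vertex S m i (act S k m \<alpha> x) = vertex S k (\<alpha> i) x"
    if "ordmap m k \<alpha>" "x \<in> simplices S k" "i \<le> m" for m k \<alpha> x i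
  proof -
    have "ordmap 0 m (\<lambda>_. i)"
      using that by (auto simp: ordmap_def mono_on_def)
    then have "act S k 0 (\<alpha> \<circ> (\<lambda>_. i)) x = act S m 0 (\<lambda>_. i) (act S k m \<alpha> x)"
      using S that unfolding simplicial_set_def by blast
    then show ?thesis
      by (simp add: vertex_def comp_def)
  qed
  moreover have "\<alpha> i \<le> k" if "ordmap m k \<alpha>" "i \<le> m" for m k \<alpha> i
    using that by (auto simp: ordmap_def)
  ultimately have *: "act S k m \<alpha> x \<in> simplices (full_sub S V) m"
    if "ordmap m k \<alpha>" "x \<in> simplices (full_sub S V) k" for m k \<alpha> x
    using S that by (simp add: simplicial_set_def full_sub_def)
  have sub: "x \<in> simplices S k" if "x \<in> simplices (full_sub S V) k" for x k
    using that by (simp add: full_sub_def)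
  have act: "act (full_sub S V) = act S"
    by (simp add: full_sub_def)
  have 1: "\<forall>m k \<alpha> \<beta> x. ordmap m k \<alpha> \<and> x \<in> simplices S k \<and> (\<forall>i\<le>m. \<alpha> i = \<beta> i) \<longrightarrow>
      act S k m \<alpha> x = act S k m \<beta> x"
    and 2: "\<forall>k x. x \<in> simplices S k \<longrightarrow> act S k k id x = x"
    and 3: "\<forall>l m k \<alpha> \<beta> x. ordmap m k \<alpha> \<and> ordmap l m \<beta> \<and> x \<in> simplices S k \<longrightarrow>
      act S k l (\<alpha> \<circ> \<beta>) x = act S m l \<beta> (act S k m \<alpha> x)"
    using S unfolding simplicial_set_def by - (elim conjE, assumption)+
  show ?thesis
    unfolding simplicial_set_def act
  proof (intro conjI)
    show "\<forall>m k \<alpha> x. ordmap m k \<alpha> \<and> x \<in> simplices (full_sub S V) k \<longrightarrow>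
        act S k m \<alpha> x \<in> simplices (full_sub S V) m"
      using * by blast
  qed (use 1 2 3 sub in meson)+
qed


section \<open>The exit path simplicial set\<close>

text \<open>\<open>Exit \<gamma> j\<close> is the pair \<open>(\<gamma>, j)\<close> of \<open>\<^bold>P\<^sup>\<Delta>\<close>.  The operator of \<open>id\<close>, viewed as the
  inclusion \<open>[j-1] \<rightarrow> [k]\<close>, restricts \<open>\<gamma>\<close> to the vertices \<open>0, \<dots>, j-1\<close>.\<close>

datatype ('m, 'n) ex = InM 'm | Exit 'n nat | InN 'n

definition exit_simplices ::
    "'m sset \<Rightarrow> 'l sset \<Rightarrow> 'n sset \<Rightarrow> (nat \<Rightarrow> 'l \<Rightarrow> 'n) \<Rightarrow> nat \<Rightarrow> ('m, 'n) ex set" where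
  "exit_simplices M L N \<iota> k =
     InM ` simplices M k \<union>
     {Exit \<gamma> j | \<gamma> j. \<gamma> \<in> simplices N k \<and> j \<in> {1..k} \<and> act N k (j - 1) id \<gamma> \<in> \<iota> (j - 1) ` simplices L (j - 1)} \<union>
     InN ` simplices N k"

fun exit_act ::
    "'m sset \<Rightarrow> 'l sset \<Rightarrow> 'n sset \<Rightarrow> (nat \<Rightarrow> 'l \<Rightarrow> 'm) \<Rightarrow> (nat \<Rightarrow> 'l \<Rightarrow> 'n) \<Rightarrow>
     nat \<Rightarrow> nat \<Rightarrow> (nat \<Rightarrow> nat) \<Rightarrow> ('m, 'n) ex \<Rightarrow> ('m, 'n) ex" where
  "exit_act M L N \<pi> \<iota> k m \<alpha> (InM x) = InM (act M k m \<alpha> x)"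
| "exit_act M L N \<pi> \<iota> k m \<alpha> (InN y) = InN (act N k m \<alpha> y)"
| "exit_act M L N \<pi> \<iota> k m \<alpha> (Exit \<gamma> j) =
     (if \<forall>i\<le>m. \<alpha> i < j then InM (\<pi> m (inv_into (simplices L m) (\<iota> m) (act N k m \<alpha> \<gamma>)))
      else if \<alpha> 0 \<ge> j then InN (act N k m \<alpha> \<gamma>)
      else Exit (act N k m \<alpha> \<gamma>) (Min {i. i \<le> m \<and> \<alpha> i \<ge> j}))"

definition exit_sset ::
    "'m sset \<Rightarrow> 'l sset \<Rightarrow> 'n sset \<Rightarrow> (nat \<Rightarrow> 'l \<Rightarrow> 'm) \<Rightarrow> (nat \<Rightarrow> 'l \<Rightarrow> 'n) \<Rightarrow> ('m, 'n) ex sset" where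
  "exit_sset M L N \<pi> \<iota> = \<lparr>simplices = exit_simplices M L N \<iota>, act = exit_act M L N \<pi> \<iota>\<rparr>"

definition exit_paths ::
    "'m topology \<Rightarrow> 'l topology \<Rightarrow> 'n topology \<Rightarrow> ('l \<Rightarrow> 'm) \<Rightarrow> ('l \<Rightarrow> 'n) \<Rightarrow>
     ((nat \<Rightarrow> real) \<Rightarrow> 'm, (nat \<Rightarrow> real) \<Rightarrow> 'n) ex sset" where
  "exit_paths M L N \<pi> \<iota> =
     exit_sset (Sing M) (Sing L) (Sing N) (\<lambda>k. simplex_map k \<pi>) (\<lambda>k. simplex_map k \<iota>)"

lemma exit_act_back:
  assumes L: "simplicial_set L" and N: "simplicial_set N"
    and \<iota>: "simplicial_map L N \<iota>"
    and \<alpha>: "ordmap m k \<alpha>" "\<forall>i\<le>m. \<alpha> i < j"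
    and \<gamma>: "\<gamma> \<in> simplices N k" "j \<in> {1..k}" "y \<in> simplices L (j - 1)" "act N k (j - 1) id \<gamma> = \<iota> (j - 1) y"
  shows "act L (j - 1) m \<alpha> y \<in> simplices L m"
    and "act N k m \<alpha> \<gamma> = \<iota> m (act L (j - 1) m \<alpha> y)"
proof -
  have *: "ordmap m (j - 1) \<alpha>" "ordmap (j - 1) k id"
    using \<alpha> \<gamma>(2) by (auto simp: ordmap_def mono_on_def)
  show "act L (j - 1) m \<alpha> y \<in> simplices L m"
    using L * \<gamma> by (simp add: simplicial_set_def)
  have "act N k m (id \<circ> \<alpha>) \<gamma> = act N (j - 1) m \<alpha> (act N k (j - 1) id \<gamma>)"
    using N * \<gamma>(1) unfolding simplicial_set_def by blast
  also have "\<dots> = \<iota> m (act L (j - 1) m \<alpha> y)"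
    using \<iota> * \<gamma> by (simp add: simplicial_map_def)
  finally show "act N k m \<alpha> \<gamma> = \<iota> m (act L (j - 1) m \<alpha> y)"
    by simp
qed

lemma Min_ordmap:
  assumes \<alpha>: "ordmap m k \<alpha>" and "\<not> (\<forall>i\<le>m. \<alpha> i < j)" and "\<alpha> 0 < j"
  defines "j' \<equiv> Min {i. i \<le> m \<and> \<alpha> i \<ge> j}"
  shows "j' \<in> {1..m}" and "\<And>i. i \<le> m \<Longrightarrow> \<alpha> i \<ge> j \<longleftrightarrow> i \<ge> j'"
proof -
  let ?A = "{i. i \<le> m \<and> \<alpha> i \<ge> j}"
  have fin: "finite ?A" and ne: "?A \<noteq> {}"
    using assms(2) by (auto simp: not_less)
  have j': "j' \<in> ?A"
    unfolding j'_def using fin ne by (rule Min_in)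
  then show "j' \<in> {1..m}"
    using assms(3) by (cases j') auto
  show "\<alpha> i \<ge> j \<longleftrightarrow> i \<ge> j'" if "i \<le> m" for i
  proof
    show "i \<ge> j'" if "\<alpha> i \<ge> j"
      unfolding j'_def using fin that \<open>i \<le> m\<close> by simp
    show "\<alpha> i \<ge> j" if "i \<ge> j'"
    proof -
      have "\<alpha> j' \<le> \<alpha> i"
        using \<alpha> j' that \<open>i \<le> m\<close> by (auto simp: ordmap_def mono_on_def)
      then show ?thesis
        using j' by simp
    qed
  qed
qed

lemma simplicial_set_exit_sset:
  assumes M: "simplicial_set M" and L: "simplicial_set L" and N: "simplicial_set N"
    and \<pi>: "simplicial_map L M \<pi>" and \<iota>: "simplicial_map L N \<iota>"
    and inj: "\<And>k. inj_on (\<iota> k) (simplices L k)"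
  shows "simplicial_set (exit_sset M L N \<pi> \<iota>)"
  unfolding simplicial_set_def
proof (intro conjI allI impI; (elim conjE)?)
  let ?E = "exit_sset M L N \<pi> \<iota>"
  note exit_sset_def [simp]
  note pull = exit_act_back[OF L N \<iota>]
  have act_N: "act N k m \<alpha> \<gamma> \<in> simplices N m" if "ordmap m k \<alpha>" "\<gamma> \<in> simplices N k" for k m \<alpha> \<gamma>
    using N that by (simp add: simplicial_set_def)
  have comp_N: "act N k l (\<alpha> \<circ> \<beta>) \<gamma> = act N m l \<beta> (act N k m \<alpha> \<gamma>)"
    if "ordmap m k \<alpha>" "ordmap l m \<beta>" "\<gamma> \<in> simplices N k" for k l m \<alpha> \<beta> \<gamma>
    using N that unfolding simplicial_set_def by blast
  {
    fix m k \<alpha> x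
    assume \<alpha>: "ordmap m k \<alpha>" and x: "x \<in> simplices ?E k"
    show "act ?E k m \<alpha> x \<in> simplices ?E m"
    proof (cases x)
      case (InM a)
      then show ?thesis
        using x M \<alpha> by (auto simp: exit_simplices_def simplicial_set_def)
    next
      case (InN b)
      then show ?thesis
        using x act_N \<alpha> by (auto simp: exit_simplices_def)
    next
      case (Exit \<gamma> j)
      then obtain y where \<gamma>: "\<gamma> \<in> simplices N k" "j \<in> {1..k}" "y \<in> simplices L (j - 1)"
          "act N k (j - 1) id \<gamma> = \<iota> (j - 1) y"
        using x by (auto simp: exit_simplices_def)
      consider (M) "\<forall>i\<le>m. \<alpha> i < j" | (N) "\<alpha> 0 \<ge> j"
        | (P) "\<not> (\<forall>i\<le>m. \<alpha> i < j)" "\<alpha> 0 < j"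
        by (meson not_less)
      then show ?thesis
      proof cases
        case M
        have "\<pi> m (act L (j - 1) m \<alpha> y) \<in> simplices M m"
          using pull(1)[OF \<alpha> M \<gamma>] \<pi> by (auto simp: simplicial_map_def)
        then show ?thesis
          using pull[OF \<alpha> M \<gamma>] M inj Exit by (simp add: exit_simplices_def)
      next
        case N
        then have "\<not> (\<forall>i\<le>m. \<alpha> i < j)"
          by (metis le0 not_less)
        then show ?thesis
          using N Exit act_N[OF \<alpha> \<gamma>(1)] by (simp add: exit_simplices_def)
      next
        case P
        define j' where "j' = Min {i. i \<le> m \<and> \<alpha> i \<ge> j}"
        note j' = Min_ordmap[OF \<alpha> P, folded j'_def]
        have "{..j' - 1} \<subseteq> {..m}"
          using j'(1) by auto
        then have ord: "ordmap (j' - 1) m id" "ordmap (j' - 1) k \<alpha>"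
          using \<alpha> unfolding ordmap_def by (auto simp: mono_on_def image_subset_iff)
        have "\<forall>i\<le>j' - 1. \<alpha> i < j"
          using j' by (auto simp: not_le[symmetric])
        then have "act N k (j' - 1) \<alpha> \<gamma> \<in> \<iota> (j' - 1) ` simplices L (j' - 1)"
          using pull[OF ord(2) _ \<gamma>] by blast
        then have "act N m (j' - 1) id (act N k m \<alpha> \<gamma>) \<in> \<iota> (j' - 1) ` simplices L (j' - 1)"
          using comp_N[OF \<alpha> ord(1) \<gamma>(1)] by simp
        moreover have "act ?E k m \<alpha> x = Exit (act N k m \<alpha> \<gamma>) j'"
          using P Exit by (auto simp: j'_def not_less)
        ultimately show ?thesis
          using j'(1) act_N[OF \<alpha> \<gamma>(1)] by (simp add: exit_simplices_def)
      qed
    qed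
  }
  {
    fix m k \<alpha> \<beta> x
    assume \<alpha>: "ordmap m k \<alpha>" and x: "x \<in> simplices ?E k" and eq: "\<forall>i\<le>m. \<alpha> i = \<beta> i"
    have N_eq: "act N k m \<alpha> \<gamma> = act N k m \<beta> \<gamma>" if "\<gamma> \<in> simplices N k" for \<gamma>
      using N \<alpha> eq that unfolding simplicial_set_def by blast
    have M_eq: "act M k m \<alpha> a = act M k m \<beta> a" if "a \<in> simplices M k" for a
      using M \<alpha> eq that unfolding simplicial_set_def by blast
    have "{i. i \<le> m \<and> \<alpha> i \<ge> j} = {i. i \<le> m \<and> \<beta> i \<ge> j}" for j
      using eq by auto
    then show "act ?E k m \<alpha> x = act ?E k m \<beta> x"
      using x eq N_eq M_eq by (cases x) (auto simp: exit_simplices_def)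
  }
  {
    fix k x
    assume x: "x \<in> simplices ?E k"
    have "Min {i. i \<le> k \<and> i \<ge> j} = j" if "j \<le> k" for j
      using that by (intro Min_eqI) auto
    then show "act ?E k k id x = x"
      using x M N by (cases x) (auto simp: exit_simplices_def simplicial_set_def)
  }
  {
    fix l m k \<alpha> \<beta> x
    assume \<alpha>: "ordmap m k \<alpha>" and \<beta>: "ordmap l m \<beta>" and x: "x \<in> simplices ?E k"
    have \<beta>m: "\<beta> i \<le> m" if "i \<le> l" for i
      using \<beta> that by (auto simp: ordmap_def)
    show "act ?E k l (\<alpha> \<circ> \<beta>) x = act ?E m l \<beta> (act ?E k m \<alpha> x)"
    proof (cases x)
      case (InM a)
      then have "a \<in> simplices M k"
        using x by (auto simp: exit_simplices_def)
      then have "act M k l (\<alpha> \<circ> \<beta>) a = act M m l \<beta> (act M k m \<alpha> a)"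
        using M \<alpha> \<beta> unfolding simplicial_set_def by blast
      then show ?thesis
        using InM by simp
    next
      case (InN b)
      then show ?thesis
        using x comp_N[OF \<alpha> \<beta>] by (auto simp: exit_simplices_def)
    next
      case (Exit \<gamma> j)
      then obtain y where \<gamma>: "\<gamma> \<in> simplices N k" "j \<in> {1..k}" "y \<in> simplices L (j - 1)"
          "act N k (j - 1) id \<gamma> = \<iota> (j - 1) y"
        using x by (auto simp: exit_simplices_def)
      note comp = comp_N[OF \<alpha> \<beta> \<gamma>(1)]
      consider (M) "\<forall>i\<le>m. \<alpha> i < j" | (N) "\<alpha> 0 \<ge> j"
        | (P) "\<not> (\<forall>i\<le>m. \<alpha> i < j)" "\<alpha> 0 < j"
        by (meson not_less)
      then show ?thesis
      proof cases
        case M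
        let ?y = "act L (j - 1) m \<alpha> y"
        note y = pull[OF \<alpha> M \<gamma>]
        have "act N m l \<beta> (\<iota> m ?y) = \<iota> l (act L m l \<beta> ?y)"
          using \<iota> \<beta> y(1) by (simp add: simplicial_map_def)
        moreover have "act L m l \<beta> ?y \<in> simplices L l"
          using L \<beta> y(1) by (simp add: simplicial_set_def)
        moreover have "\<pi> l (act L m l \<beta> ?y) = act M m l \<beta> (\<pi> m ?y)"
          using \<pi> \<beta> y(1) by (simp add: simplicial_map_def)
        ultimately show ?thesis
          using M \<beta>m comp y inj Exit by simp
      next
        case N
        have "\<alpha> 0 \<le> \<alpha> (\<beta> 0)"
          using \<alpha> \<beta>m[of 0] by (auto simp: ordmap_def mono_on_def)
        then have "\<alpha> (\<beta> 0) \<ge> j"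
          using N by simp
        then have "\<not> (\<forall>i\<le>m. \<alpha> i < j)" "\<not> (\<forall>i\<le>l. \<alpha> (\<beta> i) < j)"
          using N by (meson le0 not_less)+
        then show ?thesis
          using N \<open>\<alpha> (\<beta> 0) \<ge> j\<close> comp Exit by (auto simp: not_less)
      next
        case P
        define j' where "j' = Min {i. i \<le> m \<and> \<alpha> i \<ge> j}"
        note j' = Min_ordmap[OF \<alpha> P, folded j'_def]
        have iff: "\<alpha> (\<beta> i) \<ge> j \<longleftrightarrow> \<beta> i \<ge> j'" "\<alpha> (\<beta> i) < j \<longleftrightarrow> \<beta> i < j'" if "i \<le> l" for i
          using j'(2)[OF \<beta>m[OF that]] by (auto simp: not_le[symmetric])
        have "act ?E k m \<alpha> x = Exit (act N k m \<alpha> \<gamma>) j'"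
          using P Exit by (auto simp: j'_def not_less)
        moreover have "{i. i \<le> l \<and> \<alpha> (\<beta> i) \<ge> j} = {i. i \<le> l \<and> \<beta> i \<ge> j'}"
          using iff by auto
        ultimately show ?thesis
          using Exit iff comp by auto
      qed
    qed
  }
qed

lemma simplicial_set_exit_paths:
  assumes "linked_space M L N \<pi> \<iota>"
  shows "simplicial_set (exit_paths M L N \<pi> \<iota>)"
proof -
  have \<pi>: "continuous_map L M \<pi>" and \<iota>: "continuous_map L N \<iota>" and inj: "inj_on \<iota> (topspace L)"
    using assms cofibration_inj_on by (auto simp: linked_space_def fibration_def cofibration_def)
  have "inj_on (simplex_map k \<iota>) (simplices (Sing L) k)" for k
  proof (rule inj_onI)
    fix \<sigma> \<tau>
    assume \<sigma>: "\<sigma> \<in> simplices (Sing L) k" and \<tau>: "\<tau> \<in> simplices (Sing L) k"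
      and eq: "simplex_map k \<iota> \<sigma> = simplex_map k \<iota> \<tau>"
    show "\<sigma> = \<tau>"
    proof (rule extensionalityI)
      show "\<sigma> \<in> extensional (standard_simplex k)" "\<tau> \<in> extensional (standard_simplex k)"
        using \<sigma> \<tau> by (auto simp: Sing_def singular_simplex_def)
      fix x assume x: "x \<in> standard_simplex k"
      then have "\<iota> (\<sigma> x) = \<iota> (\<tau> x)"
        using fun_cong[OF eq, of x] by (simp add: simplex_map_def)
      moreover have "\<sigma> x \<in> topspace L" "\<tau> x \<in> topspace L"
        using \<sigma> \<tau> x by (auto simp: Sing_def singular_simplex_def continuous_map_def)
      ultimately show "\<sigma> x = \<tau> x"
        using inj by (simp add: inj_on_def)
    qed
  qed
  then show ?thesis
    unfolding exit_paths_def
    by (intro simplicial_set_exit_sset simplicial_set_Sing simplicial_map_Sing \<pi> \<iota>)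
qed


section \<open>Categories and the homotopy category\<close>

text \<open>\<open>Comp C x y z g f\<close> is \<open>g \<circ> f\<close> for \<open>f : x \<rightarrow> y\<close> and \<open>g : y \<rightarrow> z\<close>.\<close>

record ('o, 'h) cat =
  Obj :: "'o set"
  Hom :: "'o \<Rightarrow> 'o \<Rightarrow> 'h set"
  Comp :: "'o \<Rightarrow> 'o \<Rightarrow> 'o \<Rightarrow> 'h \<Rightarrow> 'h \<Rightarrow> 'h"
  Id :: "'o \<Rightarrow> 'h"

definition is_category :: "('o, 'h) cat \<Rightarrow> bool" where
  "is_category C \<longleftrightarrow>
     (\<forall>x\<in>Obj C. Id C x \<in> Hom C x x) \<and>
     (\<forall>x\<in>Obj C. \<forall>y\<in>Obj C. \<forall>z\<in>Obj C. \<forall>f\<in>Hom C x y. \<forall>g\<in>Hom C y z. Comp C x y z g f \<in> Hom C x z) \<and>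
     (\<forall>x\<in>Obj C. \<forall>y\<in>Obj C. \<forall>f\<in>Hom C x y. Comp C x x y f (Id C x) = f \<and> Comp C x y y (Id C y) f = f) \<and>
     (\<forall>w\<in>Obj C. \<forall>x\<in>Obj C. \<forall>y\<in>Obj C. \<forall>z\<in>Obj C. \<forall>f\<in>Hom C w x. \<forall>g\<in>Hom C x y. \<forall>h\<in>Hom C y z.
        Comp C w y z h (Comp C w x y g f) = Comp C w x z (Comp C x y z h g) f)"

definition End :: "('o, 'h) cat \<Rightarrow> 'o \<Rightarrow> 'h monoid" where
  "End C x = \<lparr>carrier = Hom C x x, mult = Comp C x x x, one = Id C x\<rparr>"

text \<open>The homotopy category of a simplicial set (the value of the left adjoint of the nerve functor), by
  generators and relations: the objects are the vertices, the morphisms are generated by the edges,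
  and the relations are \<open>d\<^sub>0\<sigma> \<circ> d\<^sub>2\<sigma> = d\<^sub>1\<sigma>\<close> for 2-simplices \<open>\<sigma>\<close> and \<open>s\<^sub>0x = id\<close> for vertices \<open>x\<close>.
  A morphism is a class of strings of composable edges, listed in the order in which they are
  traversed.\<close>

definition edge :: "'a sset \<Rightarrow> nat \<Rightarrow> nat \<Rightarrow> 'a \<Rightarrow> 'a" where
  "edge S i j \<sigma> = act S 2 1 (\<lambda>t. if t = 0 then i else j) \<sigma>"

fun edge_string :: "'a sset \<Rightarrow> 'a \<Rightarrow> 'a list \<Rightarrow> 'a \<Rightarrow> bool" where
  "edge_string S x [] y \<longleftrightarrow> x = y \<and> x \<in> simplices S 0"
| "edge_string S x (e # es) y \<longleftrightarrow>
     e \<in> simplices S 1 \<and> vertex S 1 0 e = x \<and> edge_string S (vertex S 1 1 e) es y"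

inductive string_eq :: "'a sset \<Rightarrow> 'a \<Rightarrow> 'a \<Rightarrow> 'a list \<Rightarrow> 'a list \<Rightarrow> bool" for S where
  refl: "edge_string S x u y \<Longrightarrow> string_eq S x y u u"
| sym: "string_eq S x y u v \<Longrightarrow> string_eq S x y v u"
| trans: "string_eq S x y u v \<Longrightarrow> string_eq S x y v w \<Longrightarrow> string_eq S x y u w"
| append: "string_eq S x y u u' \<Longrightarrow> string_eq S y z v v' \<Longrightarrow> string_eq S x z (u @ v) (u' @ v')"
| degenerate: "x \<in> simplices S 0 \<Longrightarrow> string_eq S x x [act S 0 1 (\<lambda>_. 0) x] []"
| triangle: "\<sigma> \<in> simplices S 2 \<Longrightarrow>
     string_eq S (vertex S 2 0 \<sigma>) (vertex S 2 2 \<sigma>) [edge S 0 1 \<sigma>, edge S 1 2 \<sigma>] [edge S 0 2 \<sigma>]"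

definition string_class :: "'a sset \<Rightarrow> 'a \<Rightarrow> 'a \<Rightarrow> 'a list \<Rightarrow> 'a list set" where
  "string_class S x y u = {v. string_eq S x y u v}"

definition homotopy_category :: "'a sset \<Rightarrow> ('a, 'a list set) cat" where
  "homotopy_category S =
     \<lparr>Obj = simplices S 0,
      Hom = (\<lambda>x y. string_class S x y ` {u. edge_string S x u y}),
      Comp = (\<lambda>x y z B A. \<Union>u\<in>A. \<Union>v\<in>B. string_class S x z (u @ v)),
      Id = (\<lambda>x. string_class S x x [])\<rparr>"

definition Pi1 ::
    "'m topology \<Rightarrow> 'l topology \<Rightarrow> 'n topology \<Rightarrow> ('l \<Rightarrow> 'm) \<Rightarrow> ('l \<Rightarrow> 'n) \<Rightarrow>
     ((nat \<Rightarrow> real) \<Rightarrow> 'm, (nat \<Rightarrow> real) \<Rightarrow> 'n) ex set \<Rightarrow>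
     (((nat \<Rightarrow> real) \<Rightarrow> 'm, (nat \<Rightarrow> real) \<Rightarrow> 'n) ex, ((nat \<Rightarrow> real) \<Rightarrow> 'm, (nat \<Rightarrow> real) \<Rightarrow> 'n) ex list set) cat" where
  "Pi1 M L N \<pi> \<iota> V = homotopy_category (full_sub (exit_paths M L N \<pi> \<iota>) V)"

end

theory Submission
  imports Defs
begin

text \<open>Every string of edges reduces to a single edge: consecutive loops are composed by 2-simplices, a loop of
  \<open>M\<close> in front of an exit path is absorbed after lifting it to \<open>L\<close> along \<open>\<pi>\<close>, and the start of an exit path
  is moved within the connected fibre to the point over \<open>q\<close>.  Hence a morphism from \<open>p\<close> to \<open>q\<close> is
  represented by a loop of \<open>N\<close> at \<open>q\<close>, and precomposing this loop with a loop of the fibre does not change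
  the morphism.

  That there are no further relations is seen by letting edges act as relations on
  \<open>\<pi>\<^sub>1(M) \<squnion> \<pi>\<^sub>1(N)\<close>: loops act by right multiplication, and an exit path \<open>g\<close> relates a class \<open>A\<close> to
  all classes \<open>[\<iota> f \<cdot> g]\<close> such that \<open>f\<close> is a path in \<open>L\<close> with \<open>[\<pi> f] = A\<close>.  This respects
  2-simplices by path algebra alone.  An exit path \<open>g\<close> that is a loop at \<open>q\<close> relates the unit to the classes
  \<open>[\<iota> f \<cdot> g]\<close> for loops \<open>f\<close> with \<open>\<pi> f\<close> null-homotopic; lifting the null-homotopy pushes \<open>f\<close> into the fibre,
  so that these classes form the coset \<open>\<pi>\<^sub>1(L\<^sub>p) [g]\<close>.\<close>

section \<open>Homotopy of paths relative to the endpoints\<close>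

text \<open>Generators and relations give no direct access to inequality of morphisms:
  distinguishing two strings needs a quantity that every relation preserves. A loop of
  \<open>M\<close> can be moved past an exit path only after lifting it to \<open>L\<close>, and a
  lift is not unique: two paths of \<open>L\<close> with the same ends and homotopic images in
  \<open>M\<close> differ by a loop of the fibre. A function on classes would depend on choices, so
  the invariant takes all lifts at once; the ambiguity then is not an error but exactly the coset to
  be detected. A lift can be given a prescribed end, but its start is then some point of the fibre.
  Exit paths with arbitrary start in the fibre are therefore carried along, and the start is
  corrected to the point over \<open>q\<close> at the end. In \<open>Comp\<close> the later morphism
  stands on the left, whereas a product of loops traverses its left factor first. The class map from
  the fundamental group to \<open>End\<close> thus reverses products, and the isomorphism is
  obtained after composing with inversion.\<close>

definition path_homotopic :: "'a topology \<Rightarrow> (real \<Rightarrow> 'a) \<Rightarrow> (real \<Rightarrow> 'a) \<Rightarrow> bool" where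
  "path_homotopic X f g \<longleftrightarrow> homotopic_with (\<lambda>h. h 0 = f 0 \<and> h 1 = f 1) unit_interval X f g"

lemma path_homotopicD:
  assumes "path_homotopic X f g"
  shows "pathin X f" "pathin X g" "g 0 = f 0" "g 1 = f 1"
  using homotopic_with_imp_continuous_maps[OF assms[unfolded path_homotopic_def]]
    homotopic_with_imp_property[OF assms[unfolded path_homotopic_def]]
  by (auto simp: pathin_def)

lemma path_homotopic_alt:
  "path_homotopic X f g \<longleftrightarrow>
     (\<exists>K. continuous_map (prod_topology unit_interval unit_interval) X K \<and>
          (\<forall>t\<in>{0..1}. K (0, t) = f t) \<and> (\<forall>t\<in>{0..1}. K (1, t) = g t) \<and>
          (\<forall>s\<in>{0..1}. K (s, 0) = f 0 \<and> K (s, 1) = f 1))"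
  unfolding path_homotopic_def by (subst homotopic_with) auto

lemma path_homotopic_refl: "pathin X f \<Longrightarrow> path_homotopic X f f"
  by (simp add: path_homotopic_def pathin_def)

lemma path_homotopic_eq:
  "pathin X f \<Longrightarrow> (\<And>t. t \<in> {0..1} \<Longrightarrow> g t = f t) \<Longrightarrow> path_homotopic X f g"
  unfolding path_homotopic_def pathin_def by (rule homotopic_with_equal) auto

lemma path_homotopic_sym: "path_homotopic X f g \<Longrightarrow> path_homotopic X g f"
  using path_homotopicD(3,4)[of X f g] homotopic_with_symD by (fastforce simp: path_homotopic_def)

lemma path_homotopic_trans [trans]:
  "path_homotopic X f g \<Longrightarrow> path_homotopic X g h \<Longrightarrow> path_homotopic X f h"
  using path_homotopicD(3,4)[of X f g] homotopic_with_trans by (fastforce simp: path_homotopic_def)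

lemma path_homotopic_compose:
  assumes "path_homotopic X f g" "continuous_map X Y h"
  shows "path_homotopic Y (h \<circ> f) (h \<circ> g)"
proof -
  have "homotopic_with (\<lambda>k. k 0 = h (f 0) \<and> k 1 = h (f 1)) unit_interval Y (h \<circ> f) (h \<circ> g)"
    using assms(1) unfolding path_homotopic_def
    by (rule homotopic_with_compose_continuous_map_left[OF _ assms(2)]) auto
  then show ?thesis
    by (simp add: path_homotopic_def)
qed

text \<open>The straight-line homotopy from \<open>a\<close> to \<open>b\<close> stays in
  \<open>K\<close> and fixes the common ends; \<open>F\<close> carries it to \<open>X\<close>.
  Intervals, triangles and squares are the convex sets to which this is applied.\<close>

lemma path_homotopic_in_convex:
  fixes K :: "'a::real_normed_vector set"
  assumes F: "continuous_map (top_of_set K) X F" and K: "convex K"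
    and a: "path a" "path_image a \<subseteq> K" and b: "path b" "path_image b \<subseteq> K"
    and "a 0 = b 0" "a 1 = b 1"
  shows "path_homotopic X (F \<circ> a) (F \<circ> b)"
proof -
  have "closed_segment (a t) (b t) \<subseteq> K" if "t \<in> {0..1}" for t
    using that a b K by (intro closed_segment_subset) (auto simp: path_image_def)
  then have "homotopic_paths K a b"
    using assms by (intro homotopic_paths_linear) (auto simp: pathstart_def pathfinish_def)
  then have "path_homotopic (top_of_set K) a b"
    by (simp add: homotopic_paths_def path_homotopic_def pathstart_def pathfinish_def)
  then show ?thesis
    using F by (rule path_homotopic_compose)
qed

text \<open>Paths are total functions of which only the values on the unit interval matter, hence
  pointwise agreement there instead of equality with \<open>F \<circ> a\<close> and
  \<open>F \<circ> b\<close>.\<close>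

lemma path_homotopic_in_convex_eq:
  fixes K :: "'a::real_normed_vector set"
  assumes F: "continuous_map (top_of_set K) X F" and K: "convex K"
    and a: "path a" "path_image a \<subseteq> K" and b: "path b" "path_image b \<subseteq> K"
    and ab: "a 0 = b 0" "a 1 = b 1"
    and f: "\<And>t. t \<in> {0..1} \<Longrightarrow> f t = F (a t)" and g: "\<And>t. t \<in> {0..1} \<Longrightarrow> g t = F (b t)"
  shows "path_homotopic X f g"
proof -
  have *: "path_homotopic X (F \<circ> a) (F \<circ> b)"
    using assms by (intro path_homotopic_in_convex) auto
  have "path_homotopic X (F \<circ> a) f" "path_homotopic X (F \<circ> b) g"
    using path_homotopicD(1,2)[OF *] f g by (auto intro!: path_homotopic_eq)
  with * show ?thesis
    by (meson path_homotopic_sym path_homotopic_trans)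
qed

lemma concat_path_0 [simp]: "concat_path f g 0 = f 0"
  and concat_path_1 [simp]: "concat_path f g 1 = g 1"
  by (simp_all add: concat_path_def)

lemma comp_concat_path: "h \<circ> concat_path f g = concat_path (h \<circ> f) (h \<circ> g)"
  by (auto simp: concat_path_def)

lemma unit_square: "prod_topology unit_interval unit_interval = top_of_set ({0..1} \<times> {0..1})"
  by (simp add: prod_topology_subtopology_eu)

text \<open>The two homotopies run side by side in the path parameter and are glued along 1/2, where
  both rest at the common point \<open>f 1 = g 0\<close>.\<close>

lemma path_homotopic_concat:
  assumes "path_homotopic X f f'" "path_homotopic X g g'" and fg: "f 1 = g 0"
  shows "path_homotopic X (concat_path f g) (concat_path f' g')"
proof -
  let ?I2 = "prod_topology unit_interval unit_interval"
  obtain K where K: "continuous_map ?I2 X K" "\<forall>t\<in>{0..1}. K (0, t) = f t" "\<forall>t\<in>{0..1}. K (1, t) = f' t"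
      "\<forall>s\<in>{0..1}. K (s, 0) = f 0 \<and> K (s, 1) = f 1"
    using assms(1) unfolding path_homotopic_alt by blast
  obtain J where J: "continuous_map ?I2 X J" "\<forall>t\<in>{0..1}. J (0, t) = g t" "\<forall>t\<in>{0..1}. J (1, t) = g' t"
      "\<forall>s\<in>{0..1}. J (s, 0) = g 0 \<and> J (s, 1) = g 1"
    using assms(2) unfolding path_homotopic_alt by blast
  define G where "G = (\<lambda>z. if snd z \<le> 1/2 then (K \<circ> (\<lambda>z. (fst z, 2 * snd z))) z
                           else (J \<circ> (\<lambda>z. (fst z, 2 * snd z - 1))) z)"
  have "continuous_map ?I2 X G"
    unfolding G_def
  proof (rule continuous_map_cases_le)
    show "continuous_map ?I2 euclideanreal snd"
      by (intro continuous_map_into_fulltopology[OF continuous_map_snd])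
    show "continuous_map (subtopology ?I2 {x \<in> topspace ?I2. snd x \<le> 1/2}) X (K \<circ> (\<lambda>z. (fst z, 2 * snd z)))"
    proof (rule continuous_map_compose[OF _ K(1)])
      show "continuous_map (subtopology ?I2 {x \<in> topspace ?I2. snd x \<le> 1/2}) ?I2 (\<lambda>z. (fst z, 2 * snd z))"
        unfolding unit_square subtopology_subtopology by (auto intro!: continuous_intros)
    qed
    show "continuous_map (subtopology ?I2 {x \<in> topspace ?I2. 1/2 \<le> snd x}) X (J \<circ> (\<lambda>z. (fst z, 2 * snd z - 1)))"
    proof (rule continuous_map_compose[OF _ J(1)])
      show "continuous_map (subtopology ?I2 {x \<in> topspace ?I2. 1/2 \<le> snd x}) ?I2 (\<lambda>z. (fst z, 2 * snd z - 1))"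
        unfolding unit_square subtopology_subtopology by (auto intro!: continuous_intros)
    qed
  next
    fix z assume z: "z \<in> topspace ?I2" "snd z = 1/2"
    obtain s t where st: "z = (s, t)" "s \<in> {0..1}" "t = 1/2"
      using z by (cases z) auto
    then show "(K \<circ> (\<lambda>z. (fst z, 2 * snd z))) z = (J \<circ> (\<lambda>z. (fst z, 2 * snd z - 1))) z"
      using K(4) J(4) fg by simp
  qed auto
  then show ?thesis
    unfolding path_homotopic_alt
    by (rule_tac exI[of _ G]) (use K J in \<open>auto simp: G_def concat_path_def\<close>)
qed

lemma pathin_concat:
  "pathin X f \<Longrightarrow> pathin X g \<Longrightarrow> f 1 = g 0 \<Longrightarrow> pathin X (concat_path f g)"
  using path_homotopic_concat[of X f f g g] path_homotopicD(1) path_homotopic_refl by blast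

text \<open>The interval case: two parametrisations of one path with the same ends are joined
  linearly. The group laws for paths follow by suitable choices of \<open>a\<close> and
  \<open>b\<close>.\<close>

lemma path_homotopic_reparam:
  assumes "pathin X F" "continuous_on {0..1} a" "a ` {0..1} \<subseteq> {0..1}"
    "continuous_on {0..1} b" "b ` {0..1} \<subseteq> {0..1}"
    "a 0 = b 0" "a 1 = b 1"
    and "\<And>t. t \<in> {0..1} \<Longrightarrow> f t = F (a t)" and "\<And>t. t \<in> {0..1} \<Longrightarrow> g t = F (b t)"
  shows "path_homotopic X f g"
  using assms unfolding pathin_def
  by (intro path_homotopic_in_convex_eq[of "{0..1}" X F a b]) (auto simp: path_def path_image_def)

lemma path_homotopic_concat_const_left:
  assumes "pathin X f"
  shows "path_homotopic X (concat_path (\<lambda>_. f 0) f) f"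
  \<comment> \<open>The parameter rests at 0 for the first half and then runs through the interval;
    it is compared with the identity.\<close>
  by (rule path_homotopic_reparam[OF assms, of "\<lambda>t. max 0 (2 * t - 1)" id])
     (auto simp: concat_path_def intro!: continuous_intros arg_cong[of _ _ f])

definition reverse_path :: "(real \<Rightarrow> 'a) \<Rightarrow> real \<Rightarrow> 'a" where
  "reverse_path f = (\<lambda>t. f (1 - t))"

lemma reverse_path_simps [simp]:
  "reverse_path f 0 = f 1" "reverse_path f 1 = f 0" "reverse_path (reverse_path f) = f"
  by (simp_all add: reverse_path_def)

lemma comp_reverse_path: "h \<circ> reverse_path f = reverse_path (h \<circ> f)"
  by (auto simp: reverse_path_def)

lemma pathin_reverse:
  assumes "pathin X f"
  shows "pathin X (reverse_path f)"
proof -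
  have "pathin X (f \<circ> (\<lambda>t. 1 - t))"
    using assms unfolding pathin_def by (intro continuous_map_compose[of _ unit_interval]) (auto intro!: continuous_intros)
  then show ?thesis by (simp add: reverse_path_def comp_def)
qed

lemma path_homotopic_concat_reverse:
  assumes "pathin X f"
  shows "path_homotopic X (concat_path f (reverse_path f)) (\<lambda>_. f 0)"
  \<comment> \<open>The tent function runs to 1 and back, so it has the same ends as the constant
    parameter 0.\<close>
  by (rule path_homotopic_reparam[OF assms, of "\<lambda>t. min (2 * t) (2 - 2 * t)" "\<lambda>_. 0"])
     (auto simp: concat_path_def reverse_path_def intro!: continuous_intros arg_cong[of _ _ f])

lemma path_homotopic_reverse_concat:
  "pathin X f \<Longrightarrow> path_homotopic X (concat_path (reverse_path f) f) (\<lambda>_. f 1)"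
  using path_homotopic_concat_reverse[of X "reverse_path f"] pathin_reverse[of X f] by simp

lemma path_homotopic_assoc:
  assumes "pathin X f" "pathin X g" "pathin X h" "f 1 = g 0" "g 1 = h 0"
  shows "path_homotopic X (concat_path (concat_path f g) h) (concat_path f (concat_path g h))"
proof (rule path_homotopic_reparam[where a = id])
  show "pathin X (concat_path (concat_path f g) h)"
    using assms by (simp add: pathin_concat)
  \<comment> \<open>The piecewise linear map taking [0,1/2], [1/2,3/4], [3/4,1] onto [0,1/4],
    [1/4,1/2], [1/2,1]. Written with \<open>min\<close> and \<open>max\<close>, it is continuous
    without any gluing argument.\<close>
  let ?b = "\<lambda>t::real. max (min (t/2) (1/4)) (max (min (t - 1/4) (1/2)) (2*t - 1))"
  show "continuous_on {0..1} ?b"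
    by (intro continuous_intros) auto
  show "concat_path f (concat_path g h) t = concat_path (concat_path f g) h (?b t)" if t: "t \<in> {0..1}" for t
  proof -
    consider "t \<le> 1/2" | "1/2 < t" "t \<le> 3/4" | "3/4 < t"
      by linarith
    then show ?thesis
    proof cases
      case 1
      then have "?b t = t/2"
        using t by auto
      then show ?thesis
        using 1 by (simp add: concat_path_def)
    next
      case 2
      then have "?b t = t - 1/4"
        by auto
      then show ?thesis
        using 2 by (simp add: concat_path_def algebra_simps)
    next
      case 3
      then have "?b t = 2 * t - 1"
        using t by auto
      then show ?thesis
        using 3 by (simp add: concat_path_def)
    qed
  qed
qed (auto simp: min_def max_def)

section \<open>The fundamental group\<close>

lemma loop_homotopic_iff:
  "f \<in> loops X x \<Longrightarrow> loop_homotopic X x f g \<longleftrightarrow> path_homotopic X f g"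
  by (simp add: loops_def loop_homotopic_def path_homotopic_def)

lemma loops_path_homotopic:
  "f \<in> loops X x \<Longrightarrow> path_homotopic X f g \<Longrightarrow> g \<in> loops X x"
  using path_homotopicD[of X f g] by (auto simp: loops_def)

lemma loop_class_eq:
  assumes "f \<in> loops X x"
  shows "loop_class X x f = {g. path_homotopic X f g}"
  using assms loops_path_homotopic[of f X x] by (auto simp: loop_class_def loop_homotopic_iff)

lemma loop_class_eq_iff:
  assumes "f \<in> loops X x" "g \<in> loops X x"
  shows "loop_class X x f = loop_class X x g \<longleftrightarrow> path_homotopic X f g"
proof
  have "g \<in> loop_class X x g"
    using assms by (auto simp: loop_class_eq loops_def path_homotopic_refl)
  then show "path_homotopic X f g" if "loop_class X x f = loop_class X x g"
    using that assms by (auto simp: loop_class_eq)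
  show "loop_class X x f = loop_class X x g" if "path_homotopic X f g"
    unfolding loop_class_eq[OF assms(1)] loop_class_eq[OF assms(2)]
    by (auto dest: path_homotopic_trans[OF that] path_homotopic_trans[OF path_homotopic_sym[OF that]])
qed

lemma loop_class_cong:
  "f \<in> loops X x \<Longrightarrow> path_homotopic X f g \<Longrightarrow> loop_class X x f = loop_class X x g"
  by (simp add: loop_class_eq_iff loops_path_homotopic)

lemma loops_concat: "f \<in> loops X x \<Longrightarrow> g \<in> loops X x \<Longrightarrow> concat_path f g \<in> loops X x"
  by (auto simp: loops_def pathin_concat)

lemma loops_reverse: "f \<in> loops X x \<Longrightarrow> reverse_path f \<in> loops X x"
  by (auto simp: loops_def pathin_reverse)

lemma loops_const: "x \<in> topspace X \<Longrightarrow> (\<lambda>_. x) \<in> loops X x"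
  by (auto simp: loops_def)

lemma loops_comp: "f \<in> loops X x \<Longrightarrow> continuous_map X Y h \<Longrightarrow> h \<circ> f \<in> loops Y (h x)"
  by (auto simp: loops_def pathin_compose)

lemma carrier_fundamental_group: "carrier (fundamental_group X x) = loop_class X x ` loops X x"
  by (simp add: fundamental_group_def)

lemma loop_class_in_carrier: "f \<in> loops X x \<Longrightarrow> loop_class X x f \<in> carrier (fundamental_group X x)"
  by (simp add: carrier_fundamental_group)

lemma one_fundamental_group: "\<one>\<^bsub>fundamental_group X x\<^esub> = loop_class X x (\<lambda>_. x)"
  by (simp add: fundamental_group_def)

text \<open>The union defining the product ranges over representatives that all give one class, and
  it is not empty because \<open>f\<close> and \<open>g\<close> represent their own classes.\<close>

lemma mult_fundamental_group:
  assumes "f \<in> loops X x" "g \<in> loops X x"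
  shows "loop_class X x f \<otimes>\<^bsub>fundamental_group X x\<^esub> loop_class X x g = loop_class X x (concat_path f g)"
proof -
  have "loop_class X x (concat_path f' g') = loop_class X x (concat_path f g)"
    if "f' \<in> loop_class X x f" "g' \<in> loop_class X x g" for f' g'
  proof -
    have "path_homotopic X (concat_path f g) (concat_path f' g')"
      using that assms by (intro path_homotopic_concat) (auto simp: loop_class_eq loops_def)
    then show ?thesis
      using assms by (simp add: loop_class_cong[symmetric] loops_concat)
  qed
  moreover have "f \<in> loop_class X x f" "g \<in> loop_class X x g"
    using assms by (auto simp: loop_class_eq loops_def path_homotopic_refl)
  ultimately have "(\<Union>f'\<in>loop_class X x f. \<Union>g'\<in>loop_class X x g. loop_class X x (concat_path f' g'))
      = loop_class X x (concat_path f g)"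
    by blast
  then show ?thesis
    by (simp add: fundamental_group_def)
qed

lemma group_fundamental_group:
  assumes "x \<in> topspace X"
  shows "group (fundamental_group X x)"
proof (rule groupI)
  let ?G = "fundamental_group X x"
  fix A assume "A \<in> carrier ?G"
  then obtain f where f: "f \<in> loops X x" "A = loop_class X x f"
    by (auto simp: carrier_fundamental_group)
  then have f': "pathin X f" "f 0 = x" "f 1 = x"
    by (auto simp: loops_def)
  show "\<one>\<^bsub>?G\<^esub> \<otimes>\<^bsub>?G\<^esub> A = A"
    using f f' assms path_homotopic_concat_const_left[OF f'(1)]
    by (simp add: one_fundamental_group mult_fundamental_group loops_const loop_class_eq_iff loops_concat)
  have "loop_class X x (reverse_path f) \<otimes>\<^bsub>?G\<^esub> A = \<one>\<^bsub>?G\<^esub>"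
    using f f' assms path_homotopic_reverse_concat[OF f'(1)]
    by (simp add: one_fundamental_group mult_fundamental_group loops_const loop_class_eq_iff loops_concat loops_reverse)
  then show "\<exists>B\<in>carrier ?G. B \<otimes>\<^bsub>?G\<^esub> A = \<one>\<^bsub>?G\<^esub>"
    by (rule bexI) (use f in \<open>simp add: loops_reverse loop_class_in_carrier\<close>)
  fix B assume "B \<in> carrier ?G"
  then obtain g where g: "g \<in> loops X x" "B = loop_class X x g"
    by (auto simp: carrier_fundamental_group)
  then show "A \<otimes>\<^bsub>?G\<^esub> B \<in> carrier ?G"
    using f by (simp add: mult_fundamental_group loops_concat loop_class_in_carrier)
  fix C assume "C \<in> carrier ?G"
  then obtain h where h: "h \<in> loops X x" "C = loop_class X x h"
    by (auto simp: carrier_fundamental_group)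
  have "path_homotopic X (concat_path (concat_path f g) h) (concat_path f (concat_path g h))"
    using f g h by (intro path_homotopic_assoc) (auto simp: loops_def)
  then show "(A \<otimes>\<^bsub>?G\<^esub> B) \<otimes>\<^bsub>?G\<^esub> C = A \<otimes>\<^bsub>?G\<^esub> (B \<otimes>\<^bsub>?G\<^esub> C)"
    using f g h by (simp add: mult_fundamental_group loops_concat loop_class_eq_iff)
qed (use assms in \<open>simp add: one_fundamental_group loops_const loop_class_in_carrier\<close>)

lemma fundamental_group_map_loop_class:
  assumes h: "continuous_map X Y h" and f: "f \<in> loops X x"
  shows "fundamental_group_map Y (h x) h (loop_class X x f) = loop_class Y (h x) (h \<circ> f)"
proof -
  have "loop_class Y (h x) (h \<circ> g) = loop_class Y (h x) (h \<circ> f)" if "g \<in> loop_class X x f" for g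
  proof -
    have "path_homotopic Y (h \<circ> f) (h \<circ> g)"
      using that f h by (intro path_homotopic_compose) (auto simp: loop_class_eq)
    then show ?thesis
      using loop_class_cong[OF loops_comp[OF f h]] by simp
  qed
  moreover have "f \<in> loop_class X x f"
    using f by (auto simp: loop_class_eq loops_def path_homotopic_refl)
  ultimately show ?thesis
    unfolding fundamental_group_map_def by blast
qed

section \<open>Edges of singular simplices\<close>

text \<open>Barycentric coordinates on the standard 1-simplex. They identify singular 1-simplices
  with paths through \<open>edge_path\<close> and \<open>path_edge\<close>; since simplices are
  extensional, a path is recovered from its simplex on the unit interval only.\<close>

definition edge_point :: "real \<Rightarrow> nat \<Rightarrow> real" where
  "edge_point t = (\<lambda>i. if i = 0 then 1 - t else if i = 1 then t else 0)"

definition edge_path :: "((nat \<Rightarrow> real) \<Rightarrow> 'a) \<Rightarrow> real \<Rightarrow> 'a" where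
  "edge_path e t = e (edge_point t)"

definition path_edge :: "(real \<Rightarrow> 'a) \<Rightarrow> (nat \<Rightarrow> real) \<Rightarrow> 'a" where
  "path_edge f = (\<lambda>x\<in>standard_simplex 1. f (x 1))"

lemma edge_point_1 [simp]: "edge_point t (Suc 0) = t"
  by (simp add: edge_point_def)

lemma edge_point_in_simplex: "t \<in> {0..1} \<Longrightarrow> edge_point t \<in> standard_simplex (Suc 0)"
  by (auto simp: standard_simplex_def edge_point_def)

lemma standard_simplex_1D:
  assumes "x \<in> standard_simplex (Suc 0)"
  shows "x (Suc 0) \<in> {0..1}" "edge_point (x (Suc 0)) = x"
proof -
  have "x 0 + x (Suc 0) = 1" "\<And>i. i > Suc 0 \<Longrightarrow> x i = 0"
    using assms by (auto simp: standard_simplex_def)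
  then show "edge_point (x (Suc 0)) = x"
    by (auto simp: edge_point_def fun_eq_iff)
qed (use assms in \<open>simp add: standard_simplex_def\<close>)

lemma edge_path_path_edge: "t \<in> {0..1} \<Longrightarrow> edge_path (path_edge f) t = f t"
  using edge_point_in_simplex[of t] by (simp add: edge_path_def path_edge_def)

lemma path_edge_eqI: "(\<And>t. t \<in> {0..1} \<Longrightarrow> f t = g t) \<Longrightarrow> path_edge f = path_edge g"
  unfolding path_edge_def using standard_simplex_1D(1) by (intro restrict_ext) force

text \<open>All coordinates beyond \<open>k\<close> vanish on the simplex, so continuity has to be
  checked for finitely many coordinates.\<close>

lemma continuous_map_into_simplex:
  assumes "\<And>i. i \<le> k \<Longrightarrow> continuous_map T euclideanreal (\<lambda>z. h z i)"
    and "\<And>z. z \<in> topspace T \<Longrightarrow> h z \<in> standard_simplex k"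
  shows "continuous_map T (subtopology (powertop_real UNIV) (standard_simplex k)) h"
proof -
  have "continuous_map T euclideanreal (\<lambda>z. h z i)" for i
  proof (cases "i \<le> k")
    case False
    then have "h z i = 0" if "z \<in> topspace T" for z
      using assms(2)[OF that] by (auto simp: standard_simplex_def)
    then show ?thesis
      by (rule_tac continuous_map_eq[of T euclideanreal "\<lambda>_. 0"]) auto
  qed (use assms in auto)
  then show ?thesis
    using assms(2) by (auto simp: continuous_map_in_subtopology continuous_map_componentwise_UNIV)
qed

lemma pathin_edge_path:
  assumes "e \<in> simplices (Sing X) (Suc 0)"
  shows "pathin X (edge_path e)"
proof -
  have "continuous_map unit_interval (subtopology (powertop_real UNIV) (standard_simplex (Suc 0))) edge_point"
  proof (rule continuous_map_into_simplex)
    show "continuous_map unit_interval euclideanreal (\<lambda>t. edge_point t i)" for i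
      unfolding edge_point_def by (cases "i = 0"; cases "i = 1") (auto intro!: continuous_intros)
  qed (simp add: edge_point_in_simplex)
  then have "continuous_map unit_interval X (e \<circ> edge_point)"
    using assms by (intro continuous_map_compose) (auto simp: Sing_def singular_simplex_def)
  then show ?thesis
    unfolding pathin_def by (rule continuous_map_eq) (simp add: edge_path_def)
qed

lemma path_edge_simplex:
  assumes "pathin X f"
  shows "path_edge f \<in> simplices (Sing X) (Suc 0)"
proof -
  let ?D = "subtopology (powertop_real UNIV) (standard_simplex (Suc 0))"
  have "continuous_map ?D unit_interval (\<lambda>x. x (Suc 0))"
    using standard_simplex_1D(1)
    by (auto simp: continuous_map_in_subtopology intro!: continuous_map_from_subtopology continuous_map_product_projection)
  then have "continuous_map ?D X (f \<circ> (\<lambda>x. x (Suc 0)))"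
    using assms unfolding pathin_def by (rule continuous_map_compose)
  then have "continuous_map ?D X (path_edge f)"
    by (rule continuous_map_eq) (auto simp: path_edge_def)
  then show ?thesis
    by (simp add: Sing_def singular_simplex_def path_edge_def)
qed

lemma path_edge_edge_path:
  assumes "e \<in> simplices (Sing X) (Suc 0)"
  shows "path_edge (edge_path e) = e"
proof (rule extensionalityI)
  show "path_edge (edge_path e) \<in> extensional (standard_simplex (Suc 0))" "e \<in> extensional (standard_simplex (Suc 0))"
    using assms by (auto simp: path_edge_def Sing_def singular_simplex_def)
  fix x assume "x \<in> standard_simplex (Suc 0)"
  then show "path_edge (edge_path e) x = e x"
    by (simp add: path_edge_def edge_path_def standard_simplex_1D)
qed

lemma act_Sing_apply:
  "x \<in> standard_simplex m \<Longrightarrow> act (Sing X) k m \<alpha> \<sigma> x = \<sigma> (affine_of m \<alpha> x)"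
  by (simp add: Sing_def simplex_map_def)

lemma affine_of_edge_point:
  assumes "t \<in> {0..1}"
  shows "affine_of (Suc 0) \<alpha> (edge_point t) =
           (\<lambda>i. (if i = \<alpha> 0 then 1 - t else 0) + (if i = \<alpha> (Suc 0) then t else 0))"
  using edge_point_in_simplex[OF assms] by (auto simp: affine_of_apply edge_point_def)

lemma vertex_Sing:
  assumes "e \<in> simplices (Sing X) (Suc 0)"
  shows "vertex (Sing X) (Suc 0) 0 e = point_simplex (edge_path e 0)"
    and "vertex (Sing X) (Suc 0) (Suc 0) e = point_simplex (edge_path e 1)"
proof -
  have "affine_of 0 (\<lambda>_. i) x = edge_point (if i = 0 then 0 else 1)"
    if "x \<in> standard_simplex 0" "i = 0 \<or> i = 1" for x :: "nat \<Rightarrow> real" and i :: nat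
    using that by (auto simp: affine_of_apply edge_point_def standard_simplex_0)
  then show "vertex (Sing X) (Suc 0) 0 e = point_simplex (edge_path e 0)"
    "vertex (Sing X) (Suc 0) (Suc 0) e = point_simplex (edge_path e 1)"
    by (auto simp: vertex_def Sing_def simplex_map_def point_simplex_def edge_path_def)
qed

lemma degenerate_Sing: "act (Sing X) 0 (Suc 0) (\<lambda>_. 0) (point_simplex x) = path_edge (\<lambda>_. x)"
proof -
  have "affine_of (Suc 0) (\<lambda>_. 0) z \<in> standard_simplex 0" if "z \<in> standard_simplex (Suc 0)" for z
    using that by (intro affine_of_in) (auto simp: ordmap_def mono_on_def)
  then show ?thesis
    by (auto simp: Sing_def simplex_map_def point_simplex_def path_edge_def)
qed

lemma point_simplex_in_Sing: "point_simplex x \<in> simplices (Sing X) 0 \<longleftrightarrow> x \<in> topspace X"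
proof
  let ?D = "subtopology (powertop_real UNIV) (standard_simplex 0)"
  obtain z :: "nat \<Rightarrow> real" where z: "z \<in> standard_simplex 0"
    by (auto simp: standard_simplex_0)
  assume "point_simplex x \<in> simplices (Sing X) 0"
  then have "continuous_map ?D X (point_simplex x)"
    by (simp add: Sing_def singular_simplex_def)
  then have "point_simplex x z \<in> topspace X"
    using z by (auto simp: continuous_map_def Pi_iff)
  then show "x \<in> topspace X"
    using z by (simp add: point_simplex_def)
next
  let ?D = "subtopology (powertop_real UNIV) (standard_simplex 0)"
  assume "x \<in> topspace X"
  then have "continuous_map ?D X (\<lambda>_. x)"
    by simp
  then have "continuous_map ?D X (point_simplex x)"
    by (rule continuous_map_eq) (simp add: point_simplex_def)
  then show "point_simplex x \<in> simplices (Sing X) 0"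
    by (simp add: Sing_def singular_simplex_def point_simplex_def)
qed

lemma point_simplex_inj [simp]: "point_simplex x = point_simplex y \<longleftrightarrow> x = y"
proof
  obtain z :: "nat \<Rightarrow> real" where "z \<in> standard_simplex 0"
    by (auto simp: standard_simplex_0)
  then show "x = y" if "point_simplex x = point_simplex y"
    using fun_cong[OF that, of z] by (simp add: point_simplex_def)
qed simp

text \<open>Barycentric coordinates for the plane triangle with corners (0,0), (1,0), (0,1), which
  are the vertices 0, 1, 2 in this order.\<close>

definition triangle_point :: "real \<times> real \<Rightarrow> nat \<Rightarrow> real" where
  "triangle_point z = (\<lambda>i. if i = 0 then 1 - fst z - snd z else if i = 1 then fst z else if i = 2 then snd z else 0)"

lemma edge_path_edge_Sing:
  assumes "t \<in> {0..1}"
  shows "edge_path (edge (Sing X) 0 (Suc 0) \<sigma>) t = \<sigma> (triangle_point (t, 0))"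
    and "edge_path (edge (Sing X) (Suc 0) 2 \<sigma>) t = \<sigma> (triangle_point (1 - t, t))"
    and "edge_path (edge (Sing X) 0 2 \<sigma>) t = \<sigma> (triangle_point (0, t))"
  using edge_point_in_simplex[OF assms] assms
  by (auto simp: edge_path_def edge_def act_Sing_apply affine_of_edge_point triangle_point_def intro!: arg_cong[of _ _ \<sigma>])

lemma edge_in_Sing:
  "\<sigma> \<in> simplices (Sing X) 2 \<Longrightarrow> i \<le> j \<Longrightarrow> j \<le> 2 \<Longrightarrow> edge (Sing X) i j \<sigma> \<in> simplices (Sing X) (Suc 0)"
  unfolding edge_def One_nat_def
  by (rule simplicial_set_Sing[of X, unfolded simplicial_set_def, THEN conjunct1, rule_format])
     (auto simp: ordmap_def mono_on_def)

text \<open>The boundary path through vertex 1 and the edge 02 have the same ends in a convex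
  triangle. This is how a triangle relation is turned into an equation between homotopy
  classes.\<close>

lemma path_homotopic_triangle:
  assumes "\<sigma> \<in> simplices (Sing X) 2"
  shows "path_homotopic X (concat_path (edge_path (edge (Sing X) 0 (Suc 0) \<sigma>)) (edge_path (edge (Sing X) (Suc 0) 2 \<sigma>)))
           (edge_path (edge (Sing X) 0 2 \<sigma>))"
proof -
  let ?T = "{z :: real \<times> real. 0 \<le> fst z \<and> 0 \<le> snd z \<and> fst z + snd z \<le> 1}"
  \<comment> \<open>\<open>?a\<close> runs along the edge 01 in the first half and along 12 in the
    second; \<open>?b\<close> runs along 02.\<close>
  let ?a = "\<lambda>t. (min (2 * t) (2 - 2 * t), max 0 (2 * t - 1))" and ?b = "\<lambda>t. (0, t)"
  have "continuous_map (top_of_set ?T) (subtopology (powertop_real UNIV) (standard_simplex 2)) triangle_point"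
  proof (rule continuous_map_into_simplex)
    show "continuous_map (top_of_set ?T) euclideanreal (\<lambda>z. triangle_point z i)" for i
      unfolding triangle_point_def
      by (cases "i = 0"; cases "i = 1"; cases "i = 2") (auto intro!: continuous_intros)
    show "triangle_point z \<in> standard_simplex 2" if "z \<in> topspace (top_of_set ?T)" for z
      using that by (auto simp: triangle_point_def standard_simplex_def numeral_2_eq_2)
  qed
  then have F: "continuous_map (top_of_set ?T) X (\<sigma> \<circ> triangle_point)"
    using assms by (intro continuous_map_compose) (auto simp: Sing_def singular_simplex_def)
  have "convex {z :: real \<times> real. 0 \<le> fst z}" "convex {z :: real \<times> real. 0 \<le> snd z}"
      "convex {z :: real \<times> real. fst z + snd z \<le> 1}"
    by (auto simp: convex_def) (smt (verit, ccfv_SIG) distrib_left mult_left_le)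
  then have "convex ({z :: real \<times> real. 0 \<le> fst z} \<inter> {z. 0 \<le> snd z} \<inter> {z. fst z + snd z \<le> 1})"
    by (intro convex_Int)
  then have T: "convex ?T"
    by (simp add: Collect_conj_eq Int_assoc)
  show ?thesis
  proof (rule path_homotopic_in_convex_eq[OF F T, of ?a ?b])
    show "path ?a" "path ?b"
      unfolding path_def by (intro continuous_intros; simp)+
    show "concat_path (edge_path (edge (Sing X) 0 (Suc 0) \<sigma>)) (edge_path (edge (Sing X) (Suc 0) 2 \<sigma>)) t
        = (\<sigma> \<circ> triangle_point) (?a t)" if "t \<in> {0..1}" for t
    proof (cases "t \<le> 1/2")
      case True
      then have "?a t = (2 * t, 0)"
        by auto
      then show ?thesis
        using True that by (simp add: concat_path_def edge_path_edge_Sing)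
    next
      case False
      then have "?a t = (1 - (2 * t - 1), 2 * t - 1)"
        by auto
      then show ?thesis
        using False that by (simp add: concat_path_def edge_path_edge_Sing del: diff_diff_eq2)
    qed
  qed (auto simp: path_image_def edge_path_edge_Sing)
qed

lemma edge_eqI:
  assumes "\<sigma> \<in> simplices (Sing X) 2" "i \<le> j" "j \<le> 2"
    and "\<And>t. t \<in> {0..1} \<Longrightarrow> edge_path (edge (Sing X) i j \<sigma>) t = f t"
  shows "edge (Sing X) i j \<sigma> = path_edge f"
  using path_edge_eqI[of "edge_path (edge (Sing X) i j \<sigma>)" f] assms(4)
    path_edge_edge_path[OF edge_in_Sing[OF assms(1-3)]] by simp

lemma triangle_point_simplex:
  assumes "0 \<le> u" "0 \<le> v" "u + v \<le> 1"
  shows "triangle_point (u, v) \<in> standard_simplex 2"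
  using assms by (auto simp: triangle_point_def standard_simplex_def numeral_2_eq_2)

text \<open>A way to write down 2-simplices: the plane map \<open>h\<close> bends the triangle into
  a region where a continuous \<open>K\<close> is already known. Continuity of \<open>h\<close> on
  the whole plane lets it be composed with the coordinate projections before restricting.\<close>

lemma triangle_of_continuous:
  fixes h :: "real \<times> real \<Rightarrow> 'b::topological_space"
  assumes h: "continuous_on UNIV h" and K: "continuous_map (top_of_set S) X K"
    and hS: "\<And>u v. 0 \<le> u \<Longrightarrow> 0 \<le> v \<Longrightarrow> u + v \<le> 1 \<Longrightarrow> h (u, v) \<in> S"
  obtains \<sigma> where "\<sigma> \<in> simplices (Sing X) 2"
    "\<And>u v. 0 \<le> u \<Longrightarrow> 0 \<le> v \<Longrightarrow> u + v \<le> 1 \<Longrightarrow> \<sigma> (triangle_point (u, v)) = K (h (u, v))"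
proof
  let ?D = "subtopology (powertop_real UNIV) (standard_simplex 2)"
  let ?\<sigma> = "\<lambda>x\<in>standard_simplex 2. K (h (x 1, x 2))"
  have "continuous_map ?D (prod_topology euclideanreal euclideanreal) (\<lambda>x. (x 1, x 2))"
    unfolding continuous_map_pairwise o_def fst_conv snd_conv
    by (intro conjI continuous_map_from_subtopology continuous_map_product_projection UNIV_I)
  then have pr: "continuous_map ?D euclidean (\<lambda>x. (x 1, x 2))"
    by (simp only: prod_topology_euclidean)
  have "continuous_map ?D euclidean (h \<circ> (\<lambda>x. (x 1, x 2)))"
    by (rule continuous_map_compose[OF pr]) (use h in simp)
  moreover have "x 1 \<ge> 0" "x 2 \<ge> 0" "x 1 + x 2 \<le> 1" if "x \<in> standard_simplex 2" for x
  proof -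
    have "x 0 + x 1 + x 2 = 1" "x 0 \<ge> 0" "x 1 \<ge> 0" "x 2 \<ge> 0"
      using that by (auto simp: standard_simplex_def numeral_2_eq_2)
    then show "x 1 \<ge> 0" "x 2 \<ge> 0" "x 1 + x 2 \<le> 1"
      by linarith+
  qed
  ultimately have "continuous_map ?D (top_of_set S) (h \<circ> (\<lambda>x. (x 1, x 2)))"
    using hS by (auto simp: continuous_map_in_subtopology)
  then have "continuous_map ?D X (K \<circ> (h \<circ> (\<lambda>x. (x 1, x 2))))"
    using K by (rule continuous_map_compose)
  then have "continuous_map ?D X ?\<sigma>"
    by (rule continuous_map_eq) auto
  then show "?\<sigma> \<in> simplices (Sing X) 2"
    by (simp add: Sing_def singular_simplex_def)
  show "?\<sigma> (triangle_point (u, v)) = K (h (u, v))" if "0 \<le> u" "0 \<le> v" "u + v \<le> 1" for u v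
    using triangle_point_simplex[OF that] by (simp add: triangle_point_def)
qed

text \<open>The triangle is collapsed affinely onto its edge 02. Vertex 1 goes to the parameter 1/2,
  where \<open>concat_path f g\<close> passes from \<open>f\<close> to \<open>g\<close>, so the
  other two edges become \<open>f\<close> and \<open>g\<close>.\<close>

lemma triangle_concat:
  assumes "pathin X f" "pathin X g" "f 1 = g 0"
  obtains \<sigma> where "\<sigma> \<in> simplices (Sing X) 2" "edge (Sing X) 0 (Suc 0) \<sigma> = path_edge f"
    "edge (Sing X) (Suc 0) 2 \<sigma> = path_edge g" "edge (Sing X) 0 2 \<sigma> = path_edge (concat_path f g)"
proof -
  have "continuous_map (top_of_set {0..1}) X (concat_path f g)"
    using pathin_concat[OF assms] by (simp add: pathin_def)
  moreover have "continuous_on UNIV (\<lambda>z :: real \<times> real. fst z / 2 + snd z)"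
    by (intro continuous_intros) auto
  ultimately obtain \<sigma> where \<sigma>: "\<sigma> \<in> simplices (Sing X) 2"
      "\<And>u v. 0 \<le> u \<Longrightarrow> 0 \<le> v \<Longrightarrow> u + v \<le> 1 \<Longrightarrow> \<sigma> (triangle_point (u, v)) = concat_path f g (u / 2 + v)"
    using triangle_of_continuous[of "\<lambda>z. fst z / 2 + snd z" "{0..1}" X "concat_path f g"] by auto
  show thesis
  proof (rule that[OF \<sigma>(1)])
    show "edge (Sing X) 0 (Suc 0) \<sigma> = path_edge f"
      by (rule edge_eqI[OF \<sigma>(1)]) (auto simp: edge_path_edge_Sing \<sigma>(2) concat_path_def)
    show "edge (Sing X) (Suc 0) 2 \<sigma> = path_edge g"
    proof (rule edge_eqI[OF \<sigma>(1)])
      fix t :: real assume t: "t \<in> {0..1}"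
      have "concat_path f g ((1 - t) / 2 + t) = g t"
        \<comment> \<open>At t = 0 the parameter is 1/2, which \<open>concat_path\<close> assigns to
          \<open>f\<close>; there the value is \<open>f 1 = g 0\<close>.\<close>
        using t assms(3) by (cases "t = 0") (auto simp: concat_path_def field_simps)
      then show "edge_path (edge (Sing X) (Suc 0) 2 \<sigma>) t = g t"
        using t by (simp add: edge_path_edge_Sing \<sigma>(2))
    qed auto
    show "edge (Sing X) 0 2 \<sigma> = path_edge (concat_path f g)"
      by (rule edge_eqI[OF \<sigma>(1)]) (auto simp: edge_path_edge_Sing \<sigma>(2))
  qed
qed

text \<open>The triangle is mapped to the square on which the homotopy is defined so that the edge \<open>12\<close> first runs along
  the side of \<open>g\<close> and then back along the constant side \<open>t = 1\<close>; hence the constant path appended to \<open>g\<close>.\<close>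

lemma triangle_homotopy:
  assumes "path_homotopic X f g"
  obtains \<sigma> where "\<sigma> \<in> simplices (Sing X) 2" "edge (Sing X) 0 (Suc 0) \<sigma> = path_edge (\<lambda>_. f 0)"
    "edge (Sing X) (Suc 0) 2 \<sigma> = path_edge (concat_path g (\<lambda>_. g 1))" "edge (Sing X) 0 2 \<sigma> = path_edge f"
proof -
  obtain K :: "real \<times> real \<Rightarrow> 'a" where K: "continuous_map (top_of_set ({0..1} \<times> {0..1})) X K"
      "\<And>t. t\<in>{0..1} \<Longrightarrow> K (0, t) = f t" "\<And>t. t\<in>{0..1} \<Longrightarrow> K (1, t) = g t"
      "\<And>s. s\<in>{0..1} \<Longrightarrow> K (s, 0) = f 0" "\<And>s. s\<in>{0..1} \<Longrightarrow> K (s, 1) = f 1"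
    using assms unfolding path_homotopic_alt unit_square by metis
  let ?h = "\<lambda>z :: real \<times> real. (min 1 (2 * fst z), min 1 (snd z + min (fst z) (snd z)))"
  have "continuous_on UNIV ?h"
    by (intro continuous_intros)
  then obtain \<sigma> where \<sigma>: "\<sigma> \<in> simplices (Sing X) 2"
      "\<And>u v. 0 \<le> u \<Longrightarrow> 0 \<le> v \<Longrightarrow> u + v \<le> 1 \<Longrightarrow> \<sigma> (triangle_point (u, v)) = K (?h (u, v))"
    by (rule triangle_of_continuous[OF _ K(1)]) auto
  show thesis
  proof (rule that[OF \<sigma>(1)])
    show "edge (Sing X) 0 (Suc 0) \<sigma> = path_edge (\<lambda>_. f 0)"
      by (rule edge_eqI[OF \<sigma>(1)]) (auto simp: edge_path_edge_Sing \<sigma>(2) K)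
    show "edge (Sing X) (Suc 0) 2 \<sigma> = path_edge (concat_path g (\<lambda>_. g 1))"
    proof (rule edge_eqI[OF \<sigma>(1)])
      fix t :: real assume t: "t \<in> {0..1}"
      have "K (?h (1 - t, t)) = concat_path g (\<lambda>_. g 1) t"
      proof (cases "t \<le> 1/2")
        case True
        then have "?h (1 - t, t) = (1, 2 * t)"
          by simp
        then show ?thesis
          using True t K(3)[of "2 * t"] by (simp add: concat_path_def)
      next
        case False
        then have "?h (1 - t, t) = (2 - 2 * t, 1)"
          by (auto simp: min_def)
        then show ?thesis
          using False t K(5)[of "2 - 2 * t"] path_homotopicD(4)[OF assms] by (simp add: concat_path_def)
      qed
      then show "edge_path (edge (Sing X) (Suc 0) 2 \<sigma>) t = concat_path g (\<lambda>_. g 1) t"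
        using t by (simp add: edge_path_edge_Sing \<sigma>(2))
    qed auto
    show "edge (Sing X) 0 2 \<sigma> = path_edge f"
      by (rule edge_eqI[OF \<sigma>(1)]) (auto simp: edge_path_edge_Sing \<sigma>(2) K)
  qed
qed

section \<open>Homotopy categories\<close>

lemma act_simplex: "simplicial_set S \<Longrightarrow> ordmap m k \<alpha> \<Longrightarrow> x \<in> simplices S k \<Longrightarrow> act S k m \<alpha> x \<in> simplices S m"
  by (simp add: simplicial_set_def)

lemma act_act:
  "simplicial_set S \<Longrightarrow> ordmap m k \<alpha> \<Longrightarrow> ordmap l m \<beta> \<Longrightarrow> x \<in> simplices S k \<Longrightarrow>
     act S m l \<beta> (act S k m \<alpha> x) = act S k l (\<alpha> \<circ> \<beta>) x"
  unfolding simplicial_set_def by metis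

lemma act_cong:
  assumes "simplicial_set S" "ordmap m k \<alpha>" "x \<in> simplices S k" "\<And>i. i \<le> m \<Longrightarrow> \<alpha> i = \<beta> i"
  shows "act S k m \<alpha> x = act S k m \<beta> x"
  using assms unfolding simplicial_set_def by meson

lemma act_vertex:
  assumes "simplicial_set S" "x \<in> simplices S 0"
  shows "act S 0 0 (\<lambda>_. 0) x = x"
proof -
  have "act S 0 0 (\<lambda>_. 0) x = act S 0 0 id x"
    using assms by (intro act_cong) (auto simp: ordmap_def mono_on_def)
  also have "\<dots> = x"
    using assms unfolding simplicial_set_def by meson
  finally show ?thesis .
qed

lemma edge_simplex:
  assumes "simplicial_set S" "\<sigma> \<in> simplices S 2" "i \<le> j" "j \<le> 2"
  shows "edge S i j \<sigma> \<in> simplices S (Suc 0)"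
  unfolding edge_def One_nat_def
  using assms by (intro act_simplex) (auto simp: ordmap_def mono_on_def)

lemma vertex_simplex:
  assumes "simplicial_set S" "\<sigma> \<in> simplices S k" "i \<le> k"
  shows "vertex S k i \<sigma> \<in> simplices S 0"
  unfolding vertex_def
  using assms by (intro act_simplex) (auto simp: ordmap_def mono_on_def)

lemma vertex_edge:
  assumes "simplicial_set S" "\<sigma> \<in> simplices S 2" "i \<le> j" "j \<le> 2"
  shows "vertex S (Suc 0) 0 (edge S i j \<sigma>) = vertex S 2 i \<sigma>"
    and "vertex S (Suc 0) (Suc 0) (edge S i j \<sigma>) = vertex S 2 j \<sigma>"
  unfolding edge_def vertex_def One_nat_def
  using assms by (subst act_act; auto simp: ordmap_def mono_on_def comp_def)+

lemma edge_string_start: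
  assumes "simplicial_set S"
  shows "edge_string S x u y \<Longrightarrow> x \<in> simplices S 0"
  using vertex_simplex[OF assms] by (cases u) auto

lemma edge_string_append:
  "edge_string S x (u @ v) z \<longleftrightarrow> (\<exists>y. edge_string S x u y \<and> edge_string S y v z)"
  if "simplicial_set S"
  using edge_string_start[OF that] by (induction u arbitrary: x) auto

lemma string_eq_edge_string:
  assumes S: "simplicial_set S"
  shows "string_eq S x y u v \<Longrightarrow> edge_string S x u y \<and> edge_string S x v y"
proof (induction rule: string_eq.induct)
  case (append x y u u' z v v')
  then show ?case
    using edge_string_append[OF S] by blast
next
  case (degenerate x)
  have "act S 0 (Suc 0) (\<lambda>_. 0) x \<in> simplices S (Suc 0)"
    using degenerate S by (intro act_simplex) (auto simp: ordmap_def mono_on_def)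
  moreover have "vertex S (Suc 0) i (act S 0 (Suc 0) (\<lambda>_. 0) x) = x" if "i \<le> 1" for i
    using degenerate S that act_vertex[OF S degenerate] unfolding vertex_def
    by (subst act_act) (auto simp: ordmap_def mono_on_def comp_def)
  ultimately show ?case
    using degenerate by simp
next
  case (triangle \<sigma>)
  then show ?case
    using S by (simp add: edge_simplex vertex_edge vertex_simplex)
qed auto

lemma string_class_cong:
  assumes "string_eq S x y u v"
  shows "string_class S x y u = string_class S x y v"
  unfolding string_class_def
  by (auto dest: string_eq.trans[OF assms] string_eq.trans[OF string_eq.sym[OF assms]])

lemma string_class_eq_iff:
  assumes "edge_string S x u y" "edge_string S x v y"
  shows "string_class S x y u = string_class S x y v \<longleftrightarrow> string_eq S x y u v"
proof
  have "v \<in> string_class S x y v"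
    using assms(2) by (simp add: string_class_def string_eq.refl)
  then show "string_eq S x y u v" if "string_class S x y u = string_class S x y v"
    using that unfolding string_class_def by (metis mem_Collect_eq)
qed (rule string_class_cong)

text \<open>As for products of loop classes, compatibility of \<open>string_eq\<close> with
  concatenation makes all terms of the union equal.\<close>

lemma Comp_homotopy_category:
  assumes "edge_string S x u y" "edge_string S y v z"
  shows "Comp (homotopy_category S) x y z (string_class S y z v) (string_class S x y u) = string_class S x z (u @ v)"
proof -
  have "string_class S x z (u' @ v') = string_class S x z (u @ v)"
    if "u' \<in> string_class S x y u" "v' \<in> string_class S y z v" for u' v'
    using that by (intro string_class_cong string_eq.sym[OF string_eq.append]) (auto simp: string_class_def)
  moreover have "u \<in> string_class S x y u" "v \<in> string_class S y z v"
    using assms by (auto simp: string_class_def intro: string_eq.refl)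
  ultimately have "(\<Union>u'\<in>string_class S x y u. \<Union>v'\<in>string_class S y z v. string_class S x z (u' @ v'))
      = string_class S x z (u @ v)"
    by blast
  then show ?thesis
    by (simp add: homotopy_category_def)
qed

lemma is_category_homotopy_category:
  assumes S: "simplicial_set S"
  shows "is_category (homotopy_category S)"
proof -
  let ?C = "homotopy_category S"
  have Hom: "\<exists>u. edge_string S x u y \<and> f = string_class S x y u" if "f \<in> Hom ?C x y" for f x y
    using that by (auto simp: homotopy_category_def)
  have HomI: "string_class S x y u \<in> Hom ?C x y" if "edge_string S x u y" for u x y
    using that by (simp add: homotopy_category_def)
  have Obj: "Obj ?C = simplices S 0" and Id: "Id ?C = (\<lambda>x. string_class S x x [])"
    by (simp_all add: homotopy_category_def)
  note app = edge_string_append[OF S]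
  show ?thesis
    unfolding is_category_def Obj Id
  proof (intro conjI ballI)
    fix x assume x: "x \<in> simplices S 0"
    show "string_class S x x [] \<in> Hom ?C x x"
      using x by (intro HomI) simp
    fix y f assume y: "y \<in> simplices S 0" and "f \<in> Hom ?C x y"
    then obtain u where u: "edge_string S x u y" "f = string_class S x y u"
      by (auto dest!: Hom)
    show "Comp ?C x x y f (string_class S x x []) = f" "Comp ?C x y y (string_class S y y []) f = f"
      using x y u Comp_homotopy_category[of S x "[]" x u y] Comp_homotopy_category[of S x u y "[]" y] by auto
  next
    fix x y z f g assume "f \<in> Hom ?C x y" "g \<in> Hom ?C y z"
    then show "Comp ?C x y z g f \<in> Hom ?C x z"
    proof -
      obtain u v where "edge_string S x u y" "f = string_class S x y u" "edge_string S y v z" "g = string_class S y z v"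
        using Hom[OF \<open>f \<in> Hom ?C x y\<close>] Hom[OF \<open>g \<in> Hom ?C y z\<close>] by auto
      moreover from this have "edge_string S x (u @ v) z"
        using app by auto
      ultimately show ?thesis
        by (simp add: Comp_homotopy_category HomI)
    qed
  next
    fix w x y z f g h assume "f \<in> Hom ?C w x" "g \<in> Hom ?C x y" "h \<in> Hom ?C y z"
    then obtain u v t where
        "edge_string S w u x" "f = string_class S w x u"
        "edge_string S x v y" "g = string_class S x y v"
        "edge_string S y t z" "h = string_class S y z t"
      by (auto dest!: Hom)
    moreover from this have "edge_string S w (u @ v) y" "edge_string S x (v @ t) z"
      using app by auto
    ultimately show "Comp ?C w y z h (Comp ?C w x y g f) = Comp ?C w x z (Comp ?C x y z h g) f"
      by (simp add: Comp_homotopy_category)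
  qed
qed

text \<open>Functoriality of the homotopy category: each generating relation is sent to a relation
  of the same kind. It transports computations with loops along the inclusions \<open>InM\<close>
  and \<open>InN\<close>.\<close>

lemma string_eq_simplicial_map:
  assumes S: "simplicial_set S" and F: "simplicial_map S T F" and T: "simplicial_set T"
  shows "string_eq S x y u v \<Longrightarrow> string_eq T (F 0 x) (F 0 y) (map (F (Suc 0)) u) (map (F (Suc 0)) v)"
proof (induction rule: string_eq.induct)
  case (refl x u y)
  then have "edge_string T (F 0 x) (map (F (Suc 0)) u) (F 0 y)"
  proof (induction u arbitrary: x)
    case Nil
    then show ?case
      using F by (auto simp: simplicial_map_def)
  next
    case (Cons e u)
    have "ordmap 0 (Suc 0) (\<lambda>_. i)" if "i \<le> 1" for i
      using that by (auto simp: ordmap_def mono_on_def)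
    then have "F 0 (vertex S (Suc 0) i e) = vertex T (Suc 0) i (F (Suc 0) e)" if "i \<le> 1" for i
      using Cons.prems F that by (auto simp: simplicial_map_def vertex_def)
    moreover have "F (Suc 0) e \<in> simplices T (Suc 0)"
      using Cons.prems F by (auto simp: simplicial_map_def)
    ultimately show ?case
      using Cons by (metis One_nat_def edge_string.simps(2) le0 le_refl list.simps(9))
  qed
  then show ?case
    by (rule string_eq.refl)
next
  case (degenerate x)
  have "ordmap (Suc 0) 0 (\<lambda>_. 0)"
    by (auto simp: ordmap_def mono_on_def)
  then have "F (Suc 0) (act S 0 (Suc 0) (\<lambda>_. 0) x) = act T 0 (Suc 0) (\<lambda>_. 0) (F 0 x)"
    using degenerate F by (simp add: simplicial_map_def)
  moreover have "F 0 x \<in> simplices T 0"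
    using degenerate F by (auto simp: simplicial_map_def)
  ultimately show ?case
    using string_eq.degenerate[of "F 0 x" T] by simp
next
  case (triangle \<sigma>)
  have "ordmap 0 2 (\<lambda>_. i)" if "i \<le> 2" for i
    using that by (auto simp: ordmap_def mono_on_def)
  then have "F 0 (vertex S 2 i \<sigma>) = vertex T 2 i (F 2 \<sigma>)" if "i \<le> 2" for i
    using triangle F that by (auto simp: simplicial_map_def vertex_def)
  moreover have "ordmap (Suc 0) 2 (\<lambda>t. if t = 0 then i else j)" if "i \<le> j" "j \<le> 2" for i j
    using that by (auto simp: ordmap_def mono_on_def)
  then have "F (Suc 0) (edge S i j \<sigma>) = edge T i j (F 2 \<sigma>)" if "i \<le> j" "j \<le> 2" for i j
    using triangle F that by (auto simp: simplicial_map_def edge_def)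
  moreover have "F 2 \<sigma> \<in> simplices T 2"
    using triangle F by (auto simp: simplicial_map_def)
  ultimately show ?case
    using string_eq.triangle[of "F 2 \<sigma>" T] by simp
next
  case (sym x y u v)
  from sym.IH show ?case by (rule string_eq.sym)
next
  case (trans x y u v w)
  from trans.IH show ?case by (rule string_eq.trans)
next
  case (append x y u u' z v v')
  then show ?case by (simp add: string_eq.append)
qed

section \<open>Full simplicial subsets and their triangle relations\<close>

lemma act_full_sub [simp]: "act (full_sub S V) = act S"
  and edge_full_sub [simp]: "edge (full_sub S V) = edge S"
  and vertex_full_sub [simp]: "vertex (full_sub S V) = vertex S"
  by (simp_all add: full_sub_def edge_def vertex_def fun_eq_iff)

lemma simplices_full_sub:
  "x \<in> simplices (full_sub S V) k \<longleftrightarrow> x \<in> simplices S k \<and> (\<forall>i\<le>k. vertex S k i x \<in> V)"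
  by (simp add: full_sub_def)

lemma simplices_full_sub_0:
  assumes "simplicial_set S"
  shows "simplices (full_sub S V) 0 = simplices S 0 \<inter> V"
  using act_vertex[OF assms] by (auto simp: simplices_full_sub vertex_def)

lemma simplices_full_sub_1:
  "x \<in> simplices (full_sub S V) (Suc 0) \<longleftrightarrow>
     x \<in> simplices S (Suc 0) \<and> vertex S (Suc 0) 0 x \<in> V \<and> vertex S (Suc 0) (Suc 0) x \<in> V"
  by (auto simp: simplices_full_sub le_Suc_eq)

text \<open>The edges 01 and 12 together contain all three vertices.\<close>

lemma simplices_full_sub_2:
  assumes S: "simplicial_set S" and \<sigma>: "\<sigma> \<in> simplices S 2"
    and "edge S 0 (Suc 0) \<sigma> \<in> simplices (full_sub S V) (Suc 0)"
    and "edge S (Suc 0) 2 \<sigma> \<in> simplices (full_sub S V) (Suc 0)"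
  shows "\<sigma> \<in> simplices (full_sub S V) 2"
proof -
  have "vertex S 2 i \<sigma> \<in> V" if "i = 0 \<or> i = 1 \<or> i = 2" for i
    using that assms vertex_edge[OF S \<sigma>, of 0 1] vertex_edge[OF S \<sigma>, of 1 2] by (auto simp: simplices_full_sub_1)
  moreover have "i = 0 \<or> i = 1 \<or> i = 2" if "i \<le> 2" for i :: nat
    using that by linarith
  ultimately show ?thesis
    using \<sigma> by (simp add: simplices_full_sub)
qed

lemma string_eq_full_sub_triangle:
  assumes S: "simplicial_set S" and \<sigma>: "\<sigma> \<in> simplices S 2"
    and e: "edge S 0 (Suc 0) \<sigma> \<in> simplices (full_sub S V) (Suc 0)"
      "edge S (Suc 0) 2 \<sigma> \<in> simplices (full_sub S V) (Suc 0)"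
  shows "string_eq (full_sub S V) (vertex S (Suc 0) 0 (edge S 0 (Suc 0) \<sigma>)) (vertex S (Suc 0) (Suc 0) (edge S (Suc 0) 2 \<sigma>))
           [edge S 0 (Suc 0) \<sigma>, edge S (Suc 0) 2 \<sigma>] [edge S 0 2 \<sigma>]"
  using string_eq.triangle[OF simplices_full_sub_2[OF assms]]
    vertex_edge(1)[OF S \<sigma>, of 0 "Suc 0"] vertex_edge(2)[OF S \<sigma>, of "Suc 0" 2] by simp

section \<open>Lifting paths and null-homotopies\<close>

text \<open>Homotopy lifting for the 0-cube. The path is reversed first because the end of the lift
  is prescribed: the lift has to arrive where a given exit path starts.\<close>

lemma fibration_lift_path:
  assumes \<pi>: "fibration L M \<pi>" and f: "pathin M f" and l: "l \<in> topspace L" "\<pi> l = f 1"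
  obtains g where "pathin L g" "g 1 = l" "\<And>t. t \<in> {0..1} \<Longrightarrow> \<pi> (g t) = f t"
proof -
  let ?Z = "product_topology (\<lambda>_. unit_interval) {..<0::nat}"
  \<comment> \<open>The single point of the empty product, whose elements are extensional
    functions.\<close>
  let ?z = "(\<lambda>_. undefined) :: nat \<Rightarrow> real"
  have z: "?z \<in> topspace ?Z"
    by simp
  have "lifts_homotopies ?Z L M \<pi>"
    using \<pi> unfolding fibration_def by blast
  moreover have "continuous_map ?Z L (\<lambda>_. l)"
    using l by simp
  moreover have "continuous_map (prod_topology ?Z unit_interval) M (reverse_path f \<circ> snd)"
    using pathin_reverse[OF f] continuous_map_snd unfolding pathin_def by (rule continuous_map_compose[rotated])
  ultimately obtain k where k: "continuous_map (prod_topology ?Z unit_interval) L k" "\<forall>z\<in>topspace ?Z. k (z, 0) = l"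
      "\<forall>z\<in>topspace ?Z. \<forall>t\<in>{0..1}. \<pi> (k (z, t)) = (reverse_path f \<circ> snd) (z, t)"
    unfolding lifts_homotopies_def using l by (smt (verit) comp_apply reverse_path_simps(1) snd_conv)
  have "continuous_map unit_interval (prod_topology ?Z unit_interval) (\<lambda>t. (?z, t))"
    using z by (auto simp: continuous_map_pairwise o_def)
  then have "continuous_map unit_interval L (k \<circ> (\<lambda>t. (?z, t)))"
    using k(1) by (rule continuous_map_compose)
  then have "pathin L (reverse_path (k \<circ> (\<lambda>t. (?z, t))))"
    by (intro pathin_reverse) (simp add: pathin_def)
  then show thesis
  proof (rule that)
    show "reverse_path (k \<circ> (\<lambda>t. (?z, t))) 1 = l"
      using k(2) z by auto
    show "\<pi> (reverse_path (k \<circ> (\<lambda>t. (?z, t))) t) = f t" if "t \<in> {0..1}" for t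
      using k(3)[rule_format, OF z, of "1 - t"] that by (simp add: reverse_path_def)
  qed
qed

text \<open>A lift of the null-homotopy coincides with \<open>f\<close> on one side of the square and maps the other three sides
  into the fibre; \<open>f\<close> is homotopic to the concatenation of these.\<close>

lemma fibre_loop_of_null_homotopic:
  assumes \<pi>: "fibration L M \<pi>" and f: "f \<in> loops L l"
    and null: "path_homotopic M (\<pi> \<circ> f) (\<lambda>_. p)"
  obtains g where "g \<in> loops (fibre L \<pi> p) l" "path_homotopic L f g"
proof -
  obtain K :: "real \<times> real \<Rightarrow> _" where K: "continuous_map (prod_topology unit_interval unit_interval) M K"
      "\<And>t. t\<in>{0..1} \<Longrightarrow> K (0, t) = \<pi> (f t)" "\<And>t. t\<in>{0..1} \<Longrightarrow> K (1, t) = p"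
      "\<And>s. s\<in>{0..1} \<Longrightarrow> K (s, 0) = \<pi> (f 0)" "\<And>s. s\<in>{0..1} \<Longrightarrow> K (s, 1) = \<pi> (f 1)"
    using null unfolding path_homotopic_alt o_apply by metis
  have p: "\<pi> (f 0) = p" "\<pi> (f 1) = p"
    using K(3,4,5)[of 0] K(3,4,5)[of 1] by auto
  \<comment> \<open>The 1-cube, with 0 as its only index. Its coordinate is the path parameter and
    the additional \<open>unit_interval\<close> factor is the homotopy parameter; hence the swap of
    coordinates between \<open>K\<close>, \<open>G\<close> and the lift \<open>k\<close>.\<close>
  let ?Z = "product_topology (\<lambda>_. unit_interval) {..<1::nat}"
  let ?z = "\<lambda>t. \<lambda>i\<in>{..<1::nat}. t :: real"
  have z: "?z t \<in> topspace ?Z" if "t \<in> {0..1}" for t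
    using that by auto
  have proj: "continuous_map ?Z unit_interval (\<lambda>z. z 0)"
    by (rule continuous_map_product_projection) simp
  have "lifts_homotopies ?Z L M \<pi>"
    using \<pi> unfolding fibration_def by blast
  moreover have "continuous_map ?Z L (f \<circ> (\<lambda>z. z 0))"
    using proj by (rule continuous_map_compose) (use f in \<open>simp add: loops_def pathin_def\<close>)
  moreover have "continuous_map (prod_topology ?Z unit_interval) (prod_topology unit_interval unit_interval) (\<lambda>y. (snd y, fst y 0))"
    unfolding continuous_map_pairwise o_def fst_conv snd_conv
    using continuous_map_compose[OF continuous_map_fst proj] by (simp add: continuous_map_snd o_def)
  then have "continuous_map (prod_topology ?Z unit_interval) M (K \<circ> (\<lambda>y. (snd y, fst y 0)))"
    using K(1) by (rule continuous_map_compose)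
  moreover have "\<forall>z\<in>topspace ?Z. (K \<circ> (\<lambda>y. (snd y, fst y 0))) (z, 0) = \<pi> ((f \<circ> (\<lambda>z. z 0)) z)"
    using K(2) by (auto simp: PiE_def Pi_def)
  ultimately obtain k where k: "continuous_map (prod_topology ?Z unit_interval) L k"
      "\<And>z. z\<in>topspace ?Z \<Longrightarrow> k (z, 0) = f (z 0)"
      "\<And>z s. z\<in>topspace ?Z \<Longrightarrow> s\<in>{0..1} \<Longrightarrow> \<pi> (k (z, s)) = K (s, z 0)"
    unfolding lifts_homotopies_def by (smt (verit) comp_apply fst_conv snd_conv)
  define G where "G = k \<circ> (\<lambda>x. (?z (snd x), fst x))"
  have "continuous_map (prod_topology unit_interval unit_interval) (prod_topology ?Z unit_interval) (\<lambda>x. (?z (snd x), fst x))"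
    unfolding continuous_map_pairwise o_def fst_conv snd_conv
    by (auto simp: continuous_map_componentwise intro: continuous_on_fst continuous_on_snd)
  then have G: "continuous_map (top_of_set ({0..1} \<times> {0..1})) L G"
    unfolding G_def unit_square[symmetric] using k(1) by (rule continuous_map_compose)
  have G0: "G (0, t) = f t" if "t \<in> {0..1}" for t
    using k(2)[OF z[OF that]] by (simp add: G_def)
  have GK: "\<pi> (G (s, t)) = K (s, t)" if "s \<in> {0..1}" "t \<in> {0..1}" for s t
    using k(3)[OF z[OF that(2)] that(1)] by (simp add: G_def)
  have path: "pathin (fibre L \<pi> p) (G \<circ> a)"
    if a: "continuous_on {0..1} a" "\<And>t. t \<in> {0..1} \<Longrightarrow> a t \<in> {0..1} \<times> {0..1} \<and> (fst (a t) = 1 \<or> snd (a t) = 0 \<or> snd (a t) = 1)" for a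
  proof -
    have "pathin L (G \<circ> a)"
      unfolding pathin_def by (rule continuous_map_compose[OF _ G]) (use a in auto)
    moreover from this have "G (a t) \<in> topspace L" if "t \<in> {0..1}" for t
      using that by (auto simp: pathin_def continuous_map_def)
    moreover have "\<pi> (G (a t)) = p" if t: "t \<in> {0..1}" for t
    proof -
      obtain u v where uv: "a t = (u, v)"
        by (cases "a t")
      then have "u \<in> {0..1}" "v \<in> {0..1}" "u = 1 \<or> v = 0 \<or> v = 1"
        using a(2)[OF t] by auto
      then show ?thesis
        using GK[of u v] K(3)[of v] K(4,5)[of u] p by (auto simp: uv)
    qed
    ultimately show ?thesis
      by (auto simp: fibre_def pathin_subtopology)
  qed
  let ?left = "\<lambda>t::real. (t, 0::real)" and ?top = "\<lambda>t::real. (1::real, t)" and ?right = "\<lambda>t::real. (1 - t, 1::real)"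
  let ?a = "?left +++ (?top +++ ?right)"
  have P: "path ?left" "path ?top" "path ?right"
    unfolding path_def by (intro continuous_intros)+
  have J: "h \<circ> (u +++ v) = concat_path (h \<circ> u) (h \<circ> v)" for h :: "_ \<Rightarrow> 'l" and u v :: "real \<Rightarrow> real \<times> real"
    by (auto simp: joinpaths_def concat_path_def)
  let ?g = "G \<circ> ?a"
  have "pathin (fibre L \<pi> p) ?g"
    unfolding J by (intro pathin_concat path) (auto intro!: continuous_intros simp: concat_path_def)
  moreover have "?g 0 = l" "?g 1 = l"
    using f G0[of 0] G0[of 1] by (auto simp: joinpaths_def loops_def)
  moreover have "path_homotopic L f ?g"
  proof (rule path_homotopic_in_convex_eq[OF G])
    show "convex ({0..1} \<times> {0..1} :: (real \<times> real) set)"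
      by (intro convex_Times) auto
    show "path (\<lambda>t. (0, t))"
      unfolding path_def by (intro continuous_intros)
    show "path ?a"
      by (intro path_join_imp P) (auto simp: pathstart_def pathfinish_def joinpaths_def)
    show "path_image ?a \<subseteq> {0..1} \<times> {0..1}"
      by (intro subset_path_image_join) (auto simp: path_image_def)
  qed (auto simp: path_image_def G0 joinpaths_def)
  ultimately show thesis
    using that[of ?g] unfolding loops_def by blast
qed

section \<open>Strings of loops\<close>

lemma loops_edge_iff:
  "e \<in> simplices (full_sub (Sing X) {point_simplex x}) (Suc 0) \<longleftrightarrow>
     e \<in> simplices (Sing X) (Suc 0) \<and> edge_path e \<in> loops X x"
  by (auto simp: simplices_full_sub_1 vertex_Sing loops_def pathin_edge_path)

lemma path_edge_loop:
  assumes "f \<in> loops X x"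
  shows "path_edge f \<in> simplices (full_sub (Sing X) {point_simplex x}) (Suc 0)"
  using assms by (auto simp: simplices_full_sub_1 vertex_Sing loops_def path_edge_simplex edge_path_path_edge)

lemma path_homotopic_edge_path: "pathin X f \<Longrightarrow> path_homotopic X f (edge_path (path_edge f))"
  by (rule path_homotopic_eq) (simp_all add: edge_path_path_edge)

lemma string_eq_loop_const:
  assumes "x \<in> topspace X"
  shows "string_eq (full_sub (Sing X) {point_simplex x}) (point_simplex x) (point_simplex x) [path_edge (\<lambda>_. x)] []"
  using string_eq.degenerate[of "point_simplex x" "full_sub (Sing X) {point_simplex x}"] assms
  by (simp add: simplices_full_sub_0 simplicial_set_Sing point_simplex_in_Sing degenerate_Sing)

lemma string_eq_loop_concat:
  assumes "f \<in> loops X x" "g \<in> loops X x"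
  shows "string_eq (full_sub (Sing X) {point_simplex x}) (point_simplex x) (point_simplex x)
           [path_edge f, path_edge g] [path_edge (concat_path f g)]"
proof -
  have fg: "pathin X f" "pathin X g" "f 1 = g 0" "f 0 = x" "g 1 = x"
    using assms by (auto simp: loops_def)
  obtain \<sigma> where \<sigma>: "\<sigma> \<in> simplices (Sing X) 2" "edge (Sing X) 0 (Suc 0) \<sigma> = path_edge f"
      "edge (Sing X) (Suc 0) 2 \<sigma> = path_edge g" "edge (Sing X) 0 2 \<sigma> = path_edge (concat_path f g)"
    using triangle_concat[OF fg(1-3)] .
  show ?thesis
    using string_eq_full_sub_triangle[OF simplicial_set_Sing \<sigma>(1), of "{point_simplex x}"] fg
      assms[THEN path_edge_loop]
    by (simp add: \<sigma> vertex_Sing path_edge_simplex edge_path_path_edge)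
qed

text \<open>The triangle built from the homotopy has a constant path as edge 01 and \<open>g\<close>
  followed by a constant path as edge 12. Both constants are then removed by the degeneracy
  relation, the second one after undoing the concatenation.\<close>

lemma string_eq_loop_homotopic:
  assumes f: "f \<in> loops X x" and fg: "path_homotopic X f g"
  shows "string_eq (full_sub (Sing X) {point_simplex x}) (point_simplex x) (point_simplex x) [path_edge f] [path_edge g]"
    (is "string_eq ?S ?x ?x _ _")
proof -
  have g: "g \<in> loops X x"
    using loops_path_homotopic[OF f fg] .
  have x: "x \<in> topspace X" "f 0 = x" "g 1 = x"
    using f g path_start_in_topspace by (force simp: loops_def)+
  let ?c = "\<lambda>_::real. x"
  have c: "?c \<in> loops X x"
    using loops_const[OF x(1)] .
  have gc: "concat_path g ?c \<in> loops X x"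
    using loops_concat[OF g c] .
  obtain \<sigma> where \<sigma>: "\<sigma> \<in> simplices (Sing X) 2" "edge (Sing X) 0 (Suc 0) \<sigma> = path_edge ?c"
      "edge (Sing X) (Suc 0) 2 \<sigma> = path_edge (concat_path g ?c)" "edge (Sing X) 0 2 \<sigma> = path_edge f"
    using triangle_homotopy[OF fg] x by auto
  have "string_eq ?S ?x ?x [path_edge ?c, path_edge (concat_path g ?c)] [path_edge f]"
    using string_eq_full_sub_triangle[OF simplicial_set_Sing \<sigma>(1), of "{point_simplex x}"] c gc
      path_edge_loop[OF c] path_edge_loop[OF gc]
    by (simp add: \<sigma> vertex_Sing path_edge_simplex edge_path_path_edge loops_def)
  moreover
  have "edge_string ?S ?x [path_edge g] ?x"
    using path_edge_loop[OF g] g x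
    by (auto simp: vertex_Sing path_edge_simplex edge_path_path_edge loops_def simplices_full_sub_0
        simplicial_set_Sing point_simplex_in_Sing)
  then have "string_eq ?S ?x ?x ([path_edge g] @ [path_edge ?c]) ([path_edge g] @ [])"
    by (rule string_eq.append[OF string_eq.refl string_eq_loop_const[OF x(1)]])
  then have "string_eq ?S ?x ?x [path_edge (concat_path g ?c)] [path_edge g]"
    using string_eq.trans[OF string_eq.sym[OF string_eq_loop_concat[OF g c]], of "[path_edge g]"] by simp
  then have "string_eq ?S ?x ?x ([path_edge ?c] @ [path_edge (concat_path g ?c)]) ([] @ [path_edge g])"
    by (rule string_eq.append[OF string_eq_loop_const[OF x(1)]])
  then have "string_eq ?S ?x ?x [path_edge ?c, path_edge (concat_path g ?c)] [path_edge g]"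
    by simp
  ultimately show ?thesis
    by (rule string_eq.trans[OF string_eq.sym])
qed

lemma loop_string_single:
  assumes "x \<in> topspace X"
  shows "edge_string (full_sub (Sing X) {point_simplex x}) (point_simplex x) u (point_simplex x) \<Longrightarrow>
    \<exists>f\<in>loops X x. string_eq (full_sub (Sing X) {point_simplex x}) (point_simplex x) (point_simplex x) u [path_edge f]"
    (is "edge_string ?S ?x u ?x \<Longrightarrow> _")
proof (induction u)
  case Nil
  show ?case
    using string_eq.sym[OF string_eq_loop_const[OF assms]] loops_const[OF assms] by (rule bexI)
next
  case (Cons e u)
  then have e: "e \<in> simplices ?S (Suc 0)" "edge_path e \<in> loops X x" "path_edge (edge_path e) = e"
    by (auto simp: loops_edge_iff path_edge_edge_path)
  then have v: "vertex (Sing X) (Suc 0) (Suc 0) e = ?x" "vertex (Sing X) (Suc 0) 0 e = ?x"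
    by (auto simp: simplices_full_sub_1)
  then obtain f where f: "f \<in> loops X x" "string_eq ?S ?x ?x u [path_edge f]"
    using Cons by auto
  have "edge_string ?S ?x [e] ?x"
    using e v assms by (simp add: simplices_full_sub_0 simplicial_set_Sing point_simplex_in_Sing)
  then have "string_eq ?S ?x ?x ([e] @ u) ([e] @ [path_edge f])"
    by (rule string_eq.append[OF string_eq.refl f(2)])
  then have "string_eq ?S ?x ?x (e # u) [e, path_edge f]"
    by simp
  moreover have "string_eq ?S ?x ?x [e, path_edge f] [path_edge (concat_path (edge_path e) f)]"
    using string_eq_loop_concat[OF e(2) f(1)] by (simp add: e(3))
  ultimately have "string_eq ?S ?x ?x (e # u) [path_edge (concat_path (edge_path e) f)]"
    by (rule string_eq.trans)
  then show ?case
    using loops_concat[OF e(2) f(1)] by (rule bexI)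
qed

text \<open>Inversion in \<open>G\<close> is bijective and reverses products, so composing it with
  \<open>\<psi>\<close> restores their order.\<close>

lemma is_iso_of_bij_antihom:
  assumes G: "group G" and bij: "bij_betw \<psi> (carrier G) (carrier H)"
    and anti: "\<And>a b. a \<in> carrier G \<Longrightarrow> b \<in> carrier G \<Longrightarrow> \<psi> (a \<otimes>\<^bsub>G\<^esub> b) = \<psi> b \<otimes>\<^bsub>H\<^esub> \<psi> a"
  shows "H \<cong> G"
proof -
  interpret group G by (rule G)
  let ?f = "\<lambda>a. \<psi> (inv\<^bsub>G\<^esub> a)"
  have "bij_betw (\<lambda>a. inv\<^bsub>G\<^esub> a) (carrier G) (carrier G)"
    by (rule bij_betw_byWitness[where f' = "\<lambda>a. inv\<^bsub>G\<^esub> a"]) auto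
  then have "bij_betw ?f (carrier G) (carrier H)"
    using bij bij_betw_trans[of "\<lambda>a. inv\<^bsub>G\<^esub> a" "carrier G" "carrier G" \<psi> "carrier H"] by (simp add: comp_def)
  moreover have "?f \<in> hom G H"
    using bij by (auto simp: hom_def inv_mult_group anti bij_betw_def)
  ultimately have "G \<cong> H"
    by (auto simp: is_iso_def iso_def)
  then show ?thesis
    by (rule iso_sym)
qed

text \<open>Common form of the two endomorphism computations, with \<open>I\<close> standing for
  \<open>InM\<close> or \<open>InN\<close>. The string with \<open>f\<close> before \<open>g\<close>
  is the composite of the class of \<open>g\<close> after that of \<open>f\<close>, so the class map
  is an antihomomorphism.\<close>

lemma End_homotopy_category_iso:
  fixes I :: "((nat \<Rightarrow> real) \<Rightarrow> 'a) \<Rightarrow> 'b"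
  assumes x: "x \<in> topspace X"
    and edge: "\<And>f. f \<in> loops X x \<Longrightarrow> edge_string S V [I (path_edge f)] V"
    and surj: "\<And>u. edge_string S V u V \<Longrightarrow> \<exists>f\<in>loops X x. string_eq S V V u [I (path_edge f)]"
    and iff: "\<And>f g. f \<in> loops X x \<Longrightarrow> g \<in> loops X x \<Longrightarrow>
      string_eq S V V [I (path_edge f)] [I (path_edge g)] \<longleftrightarrow> path_homotopic X f g"
    and concat: "\<And>f g. f \<in> loops X x \<Longrightarrow> g \<in> loops X x \<Longrightarrow>
      string_eq S V V [I (path_edge f), I (path_edge g)] [I (path_edge (concat_path f g))]"
  shows "End (homotopy_category S) V \<cong> fundamental_group X x"
proof -
  let ?G = "fundamental_group X x" and ?E = "End (homotopy_category S) V"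
  let ?k = "\<lambda>f. string_class S V V [I (path_edge f)]"
  \<comment> \<open>A representative loop is chosen; \<open>k_eq\<close> shows that the choice does
    not affect the string class, and also gives injectivity.\<close>
  define \<psi> where "\<psi> A = ?k (SOME f. f \<in> loops X x \<and> loop_class X x f = A)" for A
  have k_eq: "?k f = ?k g \<longleftrightarrow> loop_class X x f = loop_class X x g" if "f \<in> loops X x" "g \<in> loops X x" for f g
    using string_class_eq_iff[OF edge[OF that(1)] edge[OF that(2)]] iff[OF that] loop_class_eq_iff[OF that] by simp
  have \<psi>: "\<psi> (loop_class X x f) = ?k f" if "f \<in> loops X x" for f
    using someI[of "\<lambda>g. g \<in> loops X x \<and> loop_class X x g = loop_class X x f" f] that k_eq[OF _ that]
    by (simp add: \<psi>_def)
  have carrier: "carrier ?E = ?k ` loops X x"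
  proof -
    have "carrier ?E = string_class S V V ` {u. edge_string S V u V}"
      by (simp add: End_def homotopy_category_def)
    also have "\<dots> = ?k ` loops X x"
    proof (intro equalityI subsetI)
      fix c assume "c \<in> string_class S V V ` {u. edge_string S V u V}"
      then obtain u where u: "edge_string S V u V" "c = string_class S V V u"
        by auto
      obtain f where f: "f \<in> loops X x" "string_eq S V V u [I (path_edge f)]"
        using surj[OF u(1)] by auto
      then show "c \<in> ?k ` loops X x"
        using string_class_cong[OF f(2)] u(2) by simp
    next
      fix c assume "c \<in> ?k ` loops X x"
      then show "c \<in> string_class S V V ` {u. edge_string S V u V}"
        using edge by (blast intro: imageI CollectI)
    qed
    finally show ?thesis .
  qed
  show ?thesis
  proof (rule is_iso_of_bij_antihom)
    show "group ?G"
      using x by (rule group_fundamental_group)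
    show "bij_betw \<psi> (carrier ?G) (carrier ?E)"
      unfolding bij_betw_def carrier carrier_fundamental_group
      by (auto simp: \<psi> image_image inj_on_def k_eq cong: image_cong)
    fix A B assume "A \<in> carrier ?G" "B \<in> carrier ?G"
    then obtain f g where fg: "f \<in> loops X x" "A = loop_class X x f" "g \<in> loops X x" "B = loop_class X x g"
      by (auto simp: carrier_fundamental_group)
    have "mult ?E (?k g) (?k f) = string_class S V V ([I (path_edge f)] @ [I (path_edge g)])"
      unfolding End_def using Comp_homotopy_category[OF edge[OF fg(1)] edge[OF fg(3)]] by simp
    also have "\<dots> = ?k (concat_path f g)"
      using string_class_cong[OF concat[OF fg(1,3)]] by simp
    finally show "\<psi> (A \<otimes>\<^bsub>?G\<^esub> B) = \<psi> B \<otimes>\<^bsub>?E\<^esub> \<psi> A"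
      using fg by (simp add: mult_fundamental_group \<psi> loops_concat)
  qed
qed

section \<open>The exit path category of two points\<close>

lemma simplex_map_path_edge: "simplex_map (Suc 0) h (path_edge f) = path_edge (h \<circ> f)"
  by (auto simp: simplex_map_def path_edge_def)

lemma edge_path_simplex_map:
  "t \<in> {0..1} \<Longrightarrow> edge_path (simplex_map (Suc 0) h e) t = h (edge_path e t)"
  by (simp add: edge_path_def simplex_map_def edge_point_in_simplex)

lemma simplices_Sing_0:
  assumes "x \<in> simplices (Sing X) 0"
  obtains y where "y \<in> topspace X" "x = point_simplex y"
proof (rule that)
  let ?z = "(\<lambda>j. if j = 0 then 1 else 0) :: nat \<Rightarrow> real"
  show "x ?z \<in> topspace X"
    using assms by (auto simp: Sing_def singular_simplex_def continuous_map_def standard_simplex_0)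
  have "x \<in> extensional {?z}"
    using assms by (simp add: Sing_def singular_simplex_def standard_simplex_0)
  then show "x = point_simplex (x ?z)"
    by (auto simp: point_simplex_def standard_simplex_0 extensional_def)
qed

lemma inj_on_simplex_map:
  assumes "inj_on h (topspace X)"
  shows "inj_on (simplex_map k h) (simplices (Sing X) k)"
proof (rule inj_onI)
  fix \<sigma> \<tau>
  assume \<sigma>: "\<sigma> \<in> simplices (Sing X) k" and \<tau>: "\<tau> \<in> simplices (Sing X) k"
    and eq: "simplex_map k h \<sigma> = simplex_map k h \<tau>"
  show "\<sigma> = \<tau>"
  proof (rule extensionalityI)
    show "\<sigma> \<in> extensional (standard_simplex k)" "\<tau> \<in> extensional (standard_simplex k)"
      using \<sigma> \<tau> by (auto simp: Sing_def singular_simplex_def)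
    fix x assume x: "x \<in> standard_simplex k"
    then have "h (\<sigma> x) = h (\<tau> x)"
      using fun_cong[OF eq, of x] by (simp add: simplex_map_def)
    moreover have "\<sigma> x \<in> topspace X" "\<tau> x \<in> topspace X"
      using \<sigma> \<tau> x by (auto simp: Sing_def singular_simplex_def continuous_map_def)
    ultimately show "\<sigma> x = \<tau> x"
      using assms by (simp add: inj_on_def)
  qed
qed

lemma act_Sing_initial_vertex:
  assumes "\<gamma> \<in> simplices (Sing X) (Suc 0)"
  shows "act (Sing X) (Suc 0) 0 id \<gamma> = point_simplex (edge_path \<gamma> 0)"
proof -
  have "act (Sing X) (Suc 0) 0 id \<gamma> = act (Sing X) (Suc 0) 0 (\<lambda>_. 0) \<gamma>"
    by (rule act_cong[OF simplicial_set_Sing _ assms]) (auto simp: ordmap_def mono_on_def)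
  then show ?thesis
    using vertex_Sing(1)[OF assms] by (simp add: vertex_def)
qed

text \<open>The membership condition for exit simplices speaks of the operator of \<open>id\<close>
  on an initial segment. Operators that agree on \<open>{..m}\<close> act alike, which turns these
  initial faces into the first vertex and the edge 01.\<close>

lemma act_Sing_initial_edge:
  assumes "\<sigma> \<in> simplices (Sing X) 2"
  shows "act (Sing X) 2 0 id \<sigma> = point_simplex (edge_path (edge (Sing X) 0 (Suc 0) \<sigma>) 0)"
    and "act (Sing X) 2 (Suc 0) id \<sigma> = edge (Sing X) 0 (Suc 0) \<sigma>"
proof -
  show "act (Sing X) 2 (Suc 0) id \<sigma> = edge (Sing X) 0 (Suc 0) \<sigma>"
    unfolding edge_def One_nat_def
    by (rule act_cong[OF simplicial_set_Sing _ assms]) (auto simp: ordmap_def mono_on_def)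
  have "act (Sing X) 2 0 id \<sigma> = vertex (Sing X) 2 0 \<sigma>"
    unfolding vertex_def
    by (rule act_cong[OF simplicial_set_Sing _ assms]) (auto simp: ordmap_def mono_on_def)
  then show "act (Sing X) 2 0 id \<sigma> = point_simplex (edge_path (edge (Sing X) 0 (Suc 0) \<sigma>) 0)"
    using vertex_edge(1)[OF simplicial_set_Sing assms, of 0 "Suc 0"] vertex_Sing(1)[OF edge_simplex[OF simplicial_set_Sing assms, of 0 "Suc 0"]]
    by simp
qed

lemma exit_paths_InM:
  "edge (exit_paths M L N \<pi> \<iota>) i j (InM \<sigma>) = InM (edge (Sing M) i j \<sigma>)"
  "vertex (exit_paths M L N \<pi> \<iota>) k i (InM \<tau>) = InM (vertex (Sing M) k i \<tau>)"
  "act (exit_paths M L N \<pi> \<iota>) k m \<alpha> (InM \<tau>) = InM (act (Sing M) k m \<alpha> \<tau>)"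
  by (simp_all add: edge_def vertex_def exit_paths_def exit_sset_def)

lemma exit_paths_InN:
  "edge (exit_paths M L N \<pi> \<iota>) i j (InN \<sigma>) = InN (edge (Sing N) i j \<sigma>)"
  "vertex (exit_paths M L N \<pi> \<iota>) k i (InN \<tau>) = InN (vertex (Sing N) k i \<tau>)"
  "act (exit_paths M L N \<pi> \<iota>) k m \<alpha> (InN \<tau>) = InN (act (Sing N) k m \<alpha> \<tau>)"
  by (simp_all add: edge_def vertex_def exit_paths_def exit_sset_def)

lemma simplices_exit_paths_MN:
  "InM \<sigma> \<in> simplices (exit_paths M L N \<pi> \<iota>) k \<longleftrightarrow> \<sigma> \<in> simplices (Sing M) k"
  "InN \<tau> \<in> simplices (exit_paths M L N \<pi> \<iota>) k \<longleftrightarrow> \<tau> \<in> simplices (Sing N) k"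
  by (auto simp: exit_paths_def exit_sset_def exit_simplices_def)

lemma simplices_exit_paths_Exit:
  "Exit \<gamma> j \<in> simplices (exit_paths M L N \<pi> \<iota>) k \<longleftrightarrow>
     \<gamma> \<in> simplices (Sing N) k \<and> j \<in> {1..k} \<and>
     act (Sing N) k (j - 1) id \<gamma> \<in> simplex_map (j - 1) \<iota> ` simplices (Sing L) (j - 1)"
  by (auto simp: exit_paths_def exit_sset_def exit_simplices_def)

lemma le_Suc_0: "i \<le> Suc 0 \<longleftrightarrow> i = 0 \<or> i = Suc 0"
  by auto

text \<open>With exit index 1 only vertex 0 lies in \<open>M\<close>: such a triangle expresses an
  exit path followed by a path of \<open>N\<close>.\<close>

lemma edge_Exit_1:
  "edge (exit_paths M L N \<pi> \<iota>) 0 (Suc 0) (Exit \<sigma> (Suc 0)) = Exit (edge (Sing N) 0 (Suc 0) \<sigma>) (Suc 0)"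
  "edge (exit_paths M L N \<pi> \<iota>) (Suc 0) 2 (Exit \<sigma> (Suc 0)) = InN (edge (Sing N) (Suc 0) 2 \<sigma>)"
  "edge (exit_paths M L N \<pi> \<iota>) 0 2 (Exit \<sigma> (Suc 0)) = Exit (edge (Sing N) 0 2 \<sigma>) (Suc 0)"
proof -
  have "{i. i \<le> Suc 0 \<and> (0 < i \<longrightarrow> 1 \<le> j) \<and> 0 < i} = {Suc 0}" if "j \<ge> 1" for j :: nat
    using that by auto
  moreover have "{i. i \<le> Suc 0 \<and> Suc 0 \<le> (if i = 0 then 0 else j)} = {Suc 0}" if "j \<ge> 1" for j :: nat
    using that by auto
  ultimately show
    "edge (exit_paths M L N \<pi> \<iota>) 0 (Suc 0) (Exit \<sigma> (Suc 0)) = Exit (edge (Sing N) 0 (Suc 0) \<sigma>) (Suc 0)"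
    "edge (exit_paths M L N \<pi> \<iota>) (Suc 0) 2 (Exit \<sigma> (Suc 0)) = InN (edge (Sing N) (Suc 0) 2 \<sigma>)"
    "edge (exit_paths M L N \<pi> \<iota>) 0 2 (Exit \<sigma> (Suc 0)) = Exit (edge (Sing N) 0 2 \<sigma>) (Suc 0)"
    unfolding edge_def exit_paths_def exit_sset_def One_nat_def
    by (auto simp: le_Suc_0 cong: conj_cong)
qed

text \<open>With exit index 2 the edge 01 comes from \<open>L\<close> and is projected to
  \<open>M\<close>: such a triangle expresses a path of \<open>M\<close>, given with a lift,
  followed by an exit path.\<close>

lemma edge_Exit_2:
  "edge (exit_paths M L N \<pi> \<iota>) 0 (Suc 0) (Exit \<sigma> 2) =
     InM (simplex_map (Suc 0) \<pi> (inv_into (simplices (Sing L) (Suc 0)) (simplex_map (Suc 0) \<iota>) (edge (Sing N) 0 (Suc 0) \<sigma>)))"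
  "edge (exit_paths M L N \<pi> \<iota>) (Suc 0) 2 (Exit \<sigma> 2) = Exit (edge (Sing N) (Suc 0) 2 \<sigma>) (Suc 0)"
  "edge (exit_paths M L N \<pi> \<iota>) 0 2 (Exit \<sigma> 2) = Exit (edge (Sing N) 0 2 \<sigma>) (Suc 0)"
proof -
  have "{i. i \<le> Suc 0 \<and> 2 \<le> (if i = 0 then j else 2)} = {Suc 0}" if "j \<le> 1" for j :: nat
    using that by auto
  from this[of 0] this[of 1] show
    "edge (exit_paths M L N \<pi> \<iota>) 0 (Suc 0) (Exit \<sigma> 2) =
     InM (simplex_map (Suc 0) \<pi> (inv_into (simplices (Sing L) (Suc 0)) (simplex_map (Suc 0) \<iota>) (edge (Sing N) 0 (Suc 0) \<sigma>)))"
    "edge (exit_paths M L N \<pi> \<iota>) (Suc 0) 2 (Exit \<sigma> 2) = Exit (edge (Sing N) (Suc 0) 2 \<sigma>) (Suc 0)"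
    "edge (exit_paths M L N \<pi> \<iota>) 0 2 (Exit \<sigma> 2) = Exit (edge (Sing N) 0 2 \<sigma>) (Suc 0)"
    unfolding edge_def exit_paths_def exit_sset_def One_nat_def
    by (auto simp: le_Suc_0)
qed

locale pointed_link =
  fixes M :: "'m topology" and L :: "'l topology" and N :: "'n topology"
    and \<pi> :: "'l \<Rightarrow> 'm" and \<iota> :: "'l \<Rightarrow> 'n" and p :: 'm and q :: 'n
  assumes linked: "linked_space M L N \<pi> \<iota>"
    and p: "p \<in> topspace M" and q: "q \<in> topspace N"
    and q_fibre: "q \<in> \<iota> ` topspace (fibre L \<pi> p)"
    and fibre_connected: "path_connected_space (fibre L \<pi> p)"
begin

abbreviation E where "E \<equiv> exit_paths M L N \<pi> \<iota>"
abbreviation P where "P \<equiv> InM (point_simplex p) :: ((nat \<Rightarrow> real) \<Rightarrow> 'm, (nat \<Rightarrow> real) \<Rightarrow> 'n) ex"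
abbreviation Q where "Q \<equiv> InN (point_simplex q) :: ((nat \<Rightarrow> real) \<Rightarrow> 'm, (nat \<Rightarrow> real) \<Rightarrow> 'n) ex"
abbreviation S where "S \<equiv> full_sub E {P, Q}"
abbreviation F where "F \<equiv> fibre L \<pi> p"

text \<open>The base point of the fibre, in the form in which the final coset description names it.
  By injectivity of \<open>\<iota>\<close> it is the only point of \<open>L\<close> sent to
  \<open>q\<close>.\<close>

definition l\<^sub>0 where "l\<^sub>0 = inv_into (topspace F) \<iota> q"

lemma fibration_\<pi>: "fibration L M \<pi>"
  using linked by (simp add: linked_space_def)

lemma continuous_\<pi>: "continuous_map L M \<pi>" and continuous_\<iota>: "continuous_map L N \<iota>"
  and inj_\<iota>: "inj_on \<iota> (topspace L)"
  using linked cofibration_inj_on by (auto simp: linked_space_def fibration_def cofibration_def)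

lemma topspace_F: "topspace F = {x \<in> topspace L. \<pi> x = p}"
  by (auto simp: fibre_def)

lemma l\<^sub>0: "l\<^sub>0 \<in> topspace L" "\<pi> l\<^sub>0 = p" "\<iota> l\<^sub>0 = q"
  using inv_into_into[OF q_fibre] f_inv_into_f[OF q_fibre] by (auto simp: l\<^sub>0_def topspace_F)

lemma simplicial_E: "simplicial_set E"
  using linked by (rule simplicial_set_exit_paths)

lemma simplicial_S: "simplicial_set S"
  using simplicial_E by (rule simplicial_set_full_sub)

lemma objects_S: "simplices S 0 = {P, Q}"
  using p q by (auto simp: simplices_full_sub_0 simplicial_E simplices_exit_paths_MN point_simplex_in_Sing)

lemma inv_simplex_map:
  assumes "e \<in> simplices (Sing L) k"
  shows "inv_into (simplices (Sing L) k) (simplex_map k \<iota>) (simplex_map k \<iota> e) = e"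
  using inj_on_simplex_map[OF inj_\<iota>] assms by (rule inv_into_f_f)

text \<open>The start is recorded as a point \<open>l\<close> of \<open>L\<close>, not just of
  \<open>N\<close>, because lifts along \<open>\<pi>\<close> have to end there. It may be any point
  of the fibre over \<open>p\<close>.\<close>

definition exit_path :: "'l \<Rightarrow> (real \<Rightarrow> 'n) \<Rightarrow> bool" where
  "exit_path l g \<longleftrightarrow> l \<in> topspace L \<and> \<pi> l = p \<and> pathin N g \<and> g 0 = \<iota> l \<and> g 1 = q"

lemma Exit_edge:
  assumes \<gamma>: "\<gamma> \<in> simplices (Sing N) (Suc 0)" and l: "l \<in> topspace L" "edge_path \<gamma> 0 = \<iota> l"
  shows "Exit \<gamma> (Suc 0) \<in> simplices E (Suc 0)"
    and "vertex E (Suc 0) 0 (Exit \<gamma> (Suc 0)) = InM (point_simplex (\<pi> l))"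
    and "vertex E (Suc 0) (Suc 0) (Exit \<gamma> (Suc 0)) = InN (point_simplex (edge_path \<gamma> 1))"
proof -
  have pt: "point_simplex l \<in> simplices (Sing L) 0"
    using l by (simp add: point_simplex_in_Sing)
  have map: "simplex_map 0 h (point_simplex l) = point_simplex (h l)" for h :: "'l \<Rightarrow> 'z"
    by (auto simp: simplex_map_def point_simplex_def)
  have *: "act (Sing N) (Suc 0) 0 id \<gamma> = simplex_map 0 \<iota> (point_simplex l)"
    using act_Sing_initial_vertex[OF \<gamma>] l by (simp add: map)
  then show "Exit \<gamma> (Suc 0) \<in> simplices E (Suc 0)"
    using \<gamma> pt by (simp add: simplices_exit_paths_Exit)
  have "vertex (Sing N) (Suc 0) 0 \<gamma> = simplex_map 0 \<iota> (point_simplex l)"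
    using vertex_Sing(1)[OF \<gamma>] l by (simp add: map)
  then show "vertex E (Suc 0) 0 (Exit \<gamma> (Suc 0)) = InM (point_simplex (\<pi> l))"
    using inv_simplex_map[OF pt] by (simp add: vertex_def exit_paths_def exit_sset_def map)
  show "vertex E (Suc 0) (Suc 0) (Exit \<gamma> (Suc 0)) = InN (point_simplex (edge_path \<gamma> 1))"
    using vertex_Sing(2)[OF \<gamma>] by (simp add: vertex_def exit_paths_def exit_sset_def)
qed

text \<open>Edges of the form \<open>InM\<close> or \<open>InN\<close> keep both ends in their
  summand, and an \<open>Exit\<close> edge necessarily has index 1 and goes from \<open>P\<close> to
  \<open>Q\<close>. In particular nothing leads from \<open>Q\<close> to \<open>P\<close>.\<close>

lemma S_edge_cases:
  assumes "e \<in> simplices S (Suc 0)"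
  obtains (M) a where "e = InM a" "a \<in> simplices (Sing M) (Suc 0)" "edge_path a \<in> loops M p"
      "vertex E (Suc 0) 0 e = P" "vertex E (Suc 0) (Suc 0) e = P"
    | (N) b where "e = InN b" "b \<in> simplices (Sing N) (Suc 0)" "edge_path b \<in> loops N q"
      "vertex E (Suc 0) 0 e = Q" "vertex E (Suc 0) (Suc 0) e = Q"
    | (Exit) \<gamma> l where "e = Exit \<gamma> (Suc 0)" "\<gamma> \<in> simplices (Sing N) (Suc 0)" "exit_path l (edge_path \<gamma>)"
      "vertex E (Suc 0) 0 e = P" "vertex E (Suc 0) (Suc 0) e = Q"
proof (cases e)
  case (InM a)
  then have a: "a \<in> simplices (Sing M) (Suc 0)" and "vertex E (Suc 0) 0 e \<in> {P, Q}" "vertex E (Suc 0) (Suc 0) e \<in> {P, Q}"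
    using assms by (auto simp: simplices_full_sub_1 simplices_exit_paths_MN)
  then show ?thesis
    using that(1)[OF InM a] pathin_edge_path[OF a] by (auto simp: InM exit_paths_InM vertex_Sing loops_def)
next
  case (InN b)
  then have b: "b \<in> simplices (Sing N) (Suc 0)" and "vertex E (Suc 0) 0 e \<in> {P, Q}" "vertex E (Suc 0) (Suc 0) e \<in> {P, Q}"
    using assms by (auto simp: simplices_full_sub_1 simplices_exit_paths_MN)
  then show ?thesis
    using that(2)[OF InN b] pathin_edge_path[OF b] by (auto simp: InN exit_paths_InN vertex_Sing loops_def)
next
  case (Exit \<gamma> j)
  have V: "vertex E (Suc 0) 0 e \<in> {P, Q}" "vertex E (Suc 0) (Suc 0) e \<in> {P, Q}" and e: "e \<in> simplices E (Suc 0)"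
    using assms by (auto simp: simplices_full_sub_1)
  then have \<gamma>: "\<gamma> \<in> simplices (Sing N) (Suc 0)" and j: "j = Suc 0"
      and "act (Sing N) (Suc 0) 0 id \<gamma> \<in> simplex_map 0 \<iota> ` simplices (Sing L) 0"
    by (auto simp: Exit simplices_exit_paths_Exit)
  then obtain x where x: "x \<in> simplices (Sing L) 0" "point_simplex (edge_path \<gamma> 0) = simplex_map 0 \<iota> x"
    using act_Sing_initial_vertex[OF \<gamma>] by auto
  obtain l where l: "l \<in> topspace L" "x = point_simplex l"
    using simplices_Sing_0[OF x(1)] .
  have "simplex_map 0 \<iota> x = point_simplex (\<iota> l)"
    by (auto simp: l simplex_map_def point_simplex_def)
  then have l\<gamma>: "edge_path \<gamma> 0 = \<iota> l"
    using x by simp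
  show ?thesis
    using that(3)[of \<gamma> l] V Exit_edge[OF \<gamma> l(1) l\<gamma>] \<gamma> l pathin_edge_path[OF \<gamma>] l\<gamma>
    by (auto simp: Exit j exit_path_def)
qed

lemma InM_edge:
  assumes "f \<in> loops M p"
  shows "InM (path_edge f) \<in> simplices S (Suc 0)"
    and "vertex E (Suc 0) 0 (InM (path_edge f)) = P" "vertex E (Suc 0) (Suc 0) (InM (path_edge f)) = P"
  using assms
  by (auto simp: simplices_full_sub_1 simplices_exit_paths_MN exit_paths_InM vertex_Sing loops_def path_edge_simplex edge_path_path_edge)

lemma InN_edge:
  assumes "f \<in> loops N q"
  shows "InN (path_edge f) \<in> simplices S (Suc 0)"
    and "vertex E (Suc 0) 0 (InN (path_edge f)) = Q" "vertex E (Suc 0) (Suc 0) (InN (path_edge f)) = Q"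
  using assms
  by (auto simp: simplices_full_sub_1 simplices_exit_paths_MN exit_paths_InN vertex_Sing loops_def path_edge_simplex edge_path_path_edge)

lemma exit_path_edge:
  assumes "exit_path l g"
  shows "Exit (path_edge g) (Suc 0) \<in> simplices S (Suc 0)"
    and "vertex E (Suc 0) 0 (Exit (path_edge g) (Suc 0)) = P"
    and "vertex E (Suc 0) (Suc 0) (Exit (path_edge g) (Suc 0)) = Q"
proof -
  have g: "path_edge g \<in> simplices (Sing N) (Suc 0)" "l \<in> topspace L" "edge_path (path_edge g) 0 = \<iota> l"
    using assms by (auto simp: exit_path_def path_edge_simplex edge_path_path_edge)
  then show "Exit (path_edge g) (Suc 0) \<in> simplices S (Suc 0)" "vertex E (Suc 0) 0 (Exit (path_edge g) (Suc 0)) = P"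
      "vertex E (Suc 0) (Suc 0) (Exit (path_edge g) (Suc 0)) = Q"
    using Exit_edge[OF g] assms by (auto simp: simplices_full_sub_1 exit_path_def edge_path_path_edge)
qed

section \<open>Relations between loops and exit paths\<close>

lemma string_eq_InM:
  assumes "string_eq (full_sub (Sing M) {point_simplex p}) x y u v"
  shows "string_eq S (InM x) (InM y) (map InM u) (map InM v)"
proof -
  have "simplicial_map (full_sub (Sing M) {point_simplex p}) S (\<lambda>_. InM)"
    by (auto simp: simplicial_map_def simplices_full_sub simplices_exit_paths_MN exit_paths_InM)
  then show ?thesis
    using string_eq_simplicial_map[OF simplicial_set_full_sub[OF simplicial_set_Sing] _ simplicial_S assms] by blast
qed

lemma string_eq_InN:
  assumes "string_eq (full_sub (Sing N) {point_simplex q}) x y u v"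
  shows "string_eq S (InN x) (InN y) (map InN u) (map InN v)"
proof -
  have "simplicial_map (full_sub (Sing N) {point_simplex q}) S (\<lambda>_. InN)"
    by (auto simp: simplicial_map_def simplices_full_sub simplices_exit_paths_MN exit_paths_InN)
  then show ?thesis
    using string_eq_simplicial_map[OF simplicial_set_full_sub[OF simplicial_set_Sing] _ simplicial_S assms] by blast
qed

lemma string_eq_Exit_InN:
  assumes g: "exit_path l g" and n: "n \<in> loops N q"
  shows "string_eq S P Q [Exit (path_edge g) (Suc 0), InN (path_edge n)] [Exit (path_edge (concat_path g n)) (Suc 0)]"
proof -
  have gn: "pathin N g" "pathin N n" "g 1 = n 0"
    using assms by (auto simp: exit_path_def loops_def)
  obtain \<sigma> where \<sigma>: "\<sigma> \<in> simplices (Sing N) 2" "edge (Sing N) 0 (Suc 0) \<sigma> = path_edge g"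
      "edge (Sing N) (Suc 0) 2 \<sigma> = path_edge n" "edge (Sing N) 0 2 \<sigma> = path_edge (concat_path g n)"
    using triangle_concat[OF gn] .
  have "point_simplex (g 0) = simplex_map 0 \<iota> (point_simplex l)"
    using g by (auto simp: exit_path_def simplex_map_def point_simplex_def)
  then have "Exit \<sigma> (Suc 0) \<in> simplices E 2"
    using g \<sigma>(1) by (auto simp: simplices_exit_paths_Exit act_Sing_initial_edge(1)[OF \<sigma>(1)] \<sigma>(2) edge_path_path_edge
        exit_path_def point_simplex_in_Sing)
  then show ?thesis
    using string_eq_full_sub_triangle[OF simplicial_E, of "Exit \<sigma> (Suc 0)" "{P, Q}"] exit_path_edge[OF g] InN_edge[OF n]
    by (simp add: edge_Exit_1 \<sigma>)
qed

text \<open>A triangle of \<open>N\<close> whose edge 01 comes from \<open>L\<close> may be taken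
  with exit index 2. The edge 02 is left open so that both concatenation triangles and homotopy
  triangles can be inserted.\<close>

lemma string_eq_Exit_2:
  assumes \<sigma>: "\<sigma> \<in> simplices (Sing N) 2" and f: "pathin L f"
    and e: "edge (Sing N) 0 (Suc 0) \<sigma> = path_edge (\<iota> \<circ> f)" "edge (Sing N) (Suc 0) 2 \<sigma> = path_edge g"
    and \<pi>f: "\<pi> \<circ> f \<in> loops M p" and g: "exit_path l g"
  shows "string_eq S P Q [InM (path_edge (\<pi> \<circ> f)), Exit (path_edge g) (Suc 0)] [Exit (edge (Sing N) 0 2 \<sigma>) (Suc 0)]"
proof -
  have f': "path_edge f \<in> simplices (Sing L) (Suc 0)"
    using f by (rule path_edge_simplex)
  have *: "path_edge (\<iota> \<circ> f) = simplex_map (Suc 0) \<iota> (path_edge f)"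
    by (simp add: simplex_map_path_edge)
  have "path_edge (\<iota> \<circ> f) \<in> simplex_map (Suc 0) \<iota> ` simplices (Sing L) (Suc 0)"
    unfolding * using f' by (rule imageI)
  then have "Exit \<sigma> 2 \<in> simplices E 2"
    using \<sigma> by (simp add: simplices_exit_paths_Exit act_Sing_initial_edge(2)[OF \<sigma>] e)
  then show ?thesis
    using string_eq_full_sub_triangle[OF simplicial_E, of "Exit \<sigma> 2" "{P, Q}"] exit_path_edge[OF g] InM_edge[OF \<pi>f]
      inv_simplex_map[OF f', folded *]
    by (simp add: edge_Exit_2 e simplex_map_path_edge)
qed

lemma string_eq_InM_Exit:
  assumes f: "pathin L f" "\<pi> \<circ> f \<in> loops M p" and g: "exit_path (f 1) g"
  shows "string_eq S P Q [InM (path_edge (\<pi> \<circ> f)), Exit (path_edge g) (Suc 0)]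
           [Exit (path_edge (concat_path (\<iota> \<circ> f) g)) (Suc 0)]"
proof -
  have fg: "pathin N (\<iota> \<circ> f)" "pathin N g" "(\<iota> \<circ> f) 1 = g 0"
    using f g continuous_\<iota> by (auto simp: exit_path_def pathin_compose)
  obtain \<sigma> where "\<sigma> \<in> simplices (Sing N) 2" "edge (Sing N) 0 (Suc 0) \<sigma> = path_edge (\<iota> \<circ> f)"
      "edge (Sing N) (Suc 0) 2 \<sigma> = path_edge g" "edge (Sing N) 0 2 \<sigma> = path_edge (concat_path (\<iota> \<circ> f) g)"
    using triangle_concat[OF fg] .
  then show ?thesis
    using string_eq_Exit_2[OF _ f(1) _ _ f(2) g] by metis
qed

lemma edge_string_single:
  assumes "e \<in> simplices S (Suc 0)"
  shows "edge_string S (vertex E (Suc 0) 0 e) [e] (vertex E (Suc 0) (Suc 0) e)"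
  using assms vertex_simplex[OF simplicial_S assms, of "Suc 0"] by simp

lemma string_eq_InM_const_append:
  assumes "edge_string S P u y"
  shows "string_eq S P y (InM (path_edge (\<lambda>_. p)) # u) u"
  using string_eq.append[OF string_eq_InM[OF string_eq_loop_const[OF p]] string_eq.refl[OF assms]] by simp

lemma string_eq_append_InN_const:
  assumes "edge_string S x u Q"
  shows "string_eq S x Q (u @ [InN (path_edge (\<lambda>_. q))]) u"
  using string_eq.append[OF string_eq.refl[OF assms] string_eq_InN[OF string_eq_loop_const[OF q]]] by simp

text \<open>The edge 01 of the homotopy triangle is constant, hence the image of a constant path of
  \<open>L\<close>, so exit index 2 is possible. The constant loop in \<open>M\<close> and the
  constant path after \<open>h\<close> are then removed as degenerate.\<close>

lemma string_eq_Exit_homotopic: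
  assumes g: "exit_path l g" and gh: "path_homotopic N g h"
  shows "string_eq S P Q [Exit (path_edge g) (Suc 0)] [Exit (path_edge h) (Suc 0)]"
proof -
  have h: "exit_path l h"
    using g path_homotopicD[OF gh] by (simp add: exit_path_def)
  let ?k = "concat_path h (\<lambda>_. h 1)"
  have c: "(\<lambda>_. q) \<in> loops N q" "h 1 = q"
    using q h loops_const by (auto simp: exit_path_def)
  have k: "exit_path l ?k"
    using h q by (auto simp: exit_path_def intro!: pathin_concat)
  obtain \<sigma> where \<sigma>: "\<sigma> \<in> simplices (Sing N) 2" "edge (Sing N) 0 (Suc 0) \<sigma> = path_edge (\<lambda>_. g 0)"
      "edge (Sing N) (Suc 0) 2 \<sigma> = path_edge ?k" "edge (Sing N) 0 2 \<sigma> = path_edge g"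
    using triangle_homotopy[OF gh] .
  have l: "\<iota> \<circ> (\<lambda>_::real. l) = (\<lambda>_. g 0)" "\<pi> \<circ> (\<lambda>_::real. l) = (\<lambda>_. p)" "pathin L (\<lambda>_. l)" "(\<lambda>_. p) \<in> loops M p"
    using g p loops_const by (auto simp: exit_path_def)
  have "string_eq S P Q [InM (path_edge (\<lambda>_. p)), Exit (path_edge ?k) (Suc 0)] [Exit (path_edge g) (Suc 0)]"
    using string_eq_Exit_2[OF \<sigma>(1) l(3), of ?k l] k l \<sigma> by simp
  moreover have "string_eq S P Q [InM (path_edge (\<lambda>_. p)), Exit (path_edge ?k) (Suc 0)] [Exit (path_edge ?k) (Suc 0)]"
    using string_eq_InM_const_append edge_string_single[OF exit_path_edge(1)[OF k]] exit_path_edge[OF k] by simp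
  moreover have "string_eq S P Q [Exit (path_edge h) (Suc 0), InN (path_edge (\<lambda>_. q))] [Exit (path_edge ?k) (Suc 0)]"
    using string_eq_Exit_InN[OF h c(1)] c by simp
  moreover have "string_eq S P Q [Exit (path_edge h) (Suc 0), InN (path_edge (\<lambda>_. q))] [Exit (path_edge h) (Suc 0)]"
    using string_eq_append_InN_const[of P "[Exit (path_edge h) (Suc 0)]"]
      edge_string_single[OF exit_path_edge(1)[OF h]] exit_path_edge[OF h] by simp
  ultimately show ?thesis
    by (meson string_eq.sym string_eq.trans)
qed

section \<open>Reduction of strings to single edges\<close>

lemma edge_string_from_Q: "edge_string S Q u y \<Longrightarrow> \<exists>v. u = map InN v \<and> y = Q \<and>
    edge_string (full_sub (Sing N) {point_simplex q}) (point_simplex q) v (point_simplex q)"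
proof (induction u)
  case Nil
  then show ?case
    using q by (auto simp: simplices_full_sub_0 simplicial_set_Sing point_simplex_in_Sing)
next
  case (Cons e u)
  have e: "e \<in> simplices S (Suc 0)" "vertex E (Suc 0) 0 e = Q"
    using Cons.prems by auto
  from e(1) show ?case
  proof (cases rule: S_edge_cases)
    case (N b)
    then obtain v where v: "u = map InN v" "y = Q"
        "edge_string (full_sub (Sing N) {point_simplex q}) (point_simplex q) v (point_simplex q)"
      using Cons by auto
    then show ?thesis
      using N by (intro exI[of _ "b # v"]) (auto simp: loops_edge_iff exit_paths_InN)
  qed (use e in auto)
qed

text \<open>After an exit edge the string could never return to \<open>P\<close>, so all its edges
  are loops of \<open>M\<close>.\<close>

lemma edge_string_P_P: "edge_string S P u P \<Longrightarrow> \<exists>v. u = map InM v \<and>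
    edge_string (full_sub (Sing M) {point_simplex p}) (point_simplex p) v (point_simplex p)"
proof (induction u)
  case Nil
  then show ?case
    using p by (auto simp: simplices_full_sub_0 simplicial_set_Sing point_simplex_in_Sing)
next
  case (Cons e u)
  have e: "e \<in> simplices S (Suc 0)" "vertex E (Suc 0) 0 e = P" "edge_string S (vertex E (Suc 0) (Suc 0) e) u P"
    using Cons.prems by auto
  from e(1) show ?case
  proof (cases rule: S_edge_cases)
    case (M a)
    then obtain v where v: "u = map InM v"
        "edge_string (full_sub (Sing M) {point_simplex p}) (point_simplex p) v (point_simplex p)"
      using Cons by auto
    then show ?thesis
      using M by (intro exI[of _ "a # v"]) (auto simp: loops_edge_iff exit_paths_InM)
  qed (use e edge_string_from_Q in auto)
qed

lemma string_Q_single: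
  assumes "edge_string S Q u Q"
  shows "\<exists>f\<in>loops N q. string_eq S Q Q u [InN (path_edge f)]"
proof -
  obtain v where v: "u = map InN v" "edge_string (full_sub (Sing N) {point_simplex q}) (point_simplex q) v (point_simplex q)"
    using edge_string_from_Q[OF assms] by blast
  obtain f where f: "f \<in> loops N q"
      "string_eq (full_sub (Sing N) {point_simplex q}) (point_simplex q) (point_simplex q) v [path_edge f]"
    using loop_string_single[OF q v(2)] by blast
  show ?thesis
    using string_eq_InN[OF f(2)] f(1) v(1) by auto
qed

lemma string_P_single:
  assumes "edge_string S P u P"
  shows "\<exists>f\<in>loops M p. string_eq S P P u [InM (path_edge f)]"
proof -
  obtain v where v: "u = map InM v" "edge_string (full_sub (Sing M) {point_simplex p}) (point_simplex p) v (point_simplex p)"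
    using edge_string_P_P[OF assms] by blast
  obtain f where f: "f \<in> loops M p"
      "string_eq (full_sub (Sing M) {point_simplex p}) (point_simplex p) (point_simplex p) v [path_edge f]"
    using loop_string_single[OF p v(2)] by blast
  show ?thesis
    using string_eq_InM[OF f(2)] f(1) v(1) by auto
qed

lemma exit_path_concat:
  assumes "pathin L f" "\<pi> (f 0) = p" "exit_path (f 1) g"
  shows "exit_path (f 0) (concat_path (\<iota> \<circ> f) g)"
  using assms pathin_concat[of N "\<iota> \<circ> f" g] pathin_compose[OF _ continuous_\<iota>] path_start_in_topspace[of L f]
  by (auto simp: exit_path_def)

lemma edge_string_Exit: "exit_path l g \<Longrightarrow> edge_string S P [Exit (path_edge g) (Suc 0)] Q"
  using exit_path_edge[of l g] edge_string_single[of "Exit (path_edge g) (Suc 0)"] by simp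

text \<open>Induction from the front of the string. A leading loop of \<open>M\<close> is lifted so
  as to end where the exit path obtained for the rest begins; the new start is an uncontrolled point
  of the fibre, hence the existential \<open>l\<close>. After a leading exit edge, the rest is a
  loop of \<open>N\<close>.\<close>

lemma string_P_Q_single:
  "edge_string S P u Q \<Longrightarrow> \<exists>l g. exit_path l g \<and> string_eq S P Q u [Exit (path_edge g) (Suc 0)]"
proof (induction u)
  case (Cons e u)
  have e: "e \<in> simplices S (Suc 0)" "vertex E (Suc 0) 0 e = P" "edge_string S (vertex E (Suc 0) (Suc 0) e) u Q"
    using Cons.prems by auto
  note single = edge_string_single[OF e(1)]
  from e(1) show ?case
  proof (cases rule: S_edge_cases)
    case (M a)
    then obtain l g where g: "exit_path l g" "string_eq S P Q u [Exit (path_edge g) (Suc 0)]"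
      using Cons e by auto
    obtain f where f: "pathin L f" "f 1 = l" "\<And>t. t \<in> {0..1} \<Longrightarrow> \<pi> (f t) = edge_path a t"
      using fibration_lift_path[OF fibration_\<pi> pathin_edge_path[OF M(2)], of l] g(1) M(3)
      by (auto simp: exit_path_def loops_def)
    have a: "path_edge (\<pi> \<circ> f) = a"
      using path_edge_eqI[of "\<pi> \<circ> f" "edge_path a"] f(3) path_edge_edge_path[OF M(2)] by simp
    have \<pi>f: "\<pi> \<circ> f \<in> loops M p"
      using f(3)[of 0] f(3)[of 1] M(3) pathin_compose[OF f(1) continuous_\<pi>] by (auto simp: loops_def)
    have g': "exit_path (f 1) g"
      using g(1) f(2) by simp
    have "string_eq S P Q (e # u) [e, Exit (path_edge g) (Suc 0)]"
      using string_eq.append[OF string_eq.refl[OF single[unfolded M(4,5)]] g(2)] by simp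
    moreover have "string_eq S P Q [e, Exit (path_edge g) (Suc 0)] [Exit (path_edge (concat_path (\<iota> \<circ> f) g)) (Suc 0)]"
      using string_eq_InM_Exit[OF f(1) \<pi>f g'] by (simp add: a M(1))
    ultimately have "string_eq S P Q (e # u) [Exit (path_edge (concat_path (\<iota> \<circ> f) g)) (Suc 0)]"
      by (rule string_eq.trans)
    moreover have "exit_path (f 0) (concat_path (\<iota> \<circ> f) g)"
      using \<pi>f g' by (intro exit_path_concat f(1)) (auto simp: loops_def)
    ultimately show ?thesis
      by blast
  next
    case (Exit \<gamma> l)
    then obtain f where f: "f \<in> loops N q" "string_eq S Q Q u [InN (path_edge f)]"
      using e string_Q_single by auto
    have "string_eq S P Q (e # u) [e, InN (path_edge f)]"
      using string_eq.append[OF string_eq.refl[OF single[unfolded Exit(4,5)]] f(2)] by simp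
    moreover have "string_eq S P Q [e, InN (path_edge f)] [Exit (path_edge (concat_path (edge_path \<gamma>) f)) (Suc 0)]"
      using string_eq_Exit_InN[OF Exit(3) f(1)] by (simp add: Exit(1) path_edge_edge_path[OF Exit(2)])
    ultimately have "string_eq S P Q (e # u) [Exit (path_edge (concat_path (edge_path \<gamma>) f)) (Suc 0)]"
      by (rule string_eq.trans)
    moreover have "exit_path l (concat_path (edge_path \<gamma>) f)"
      using Exit(3) f(1) by (auto simp: exit_path_def loops_def pathin_concat)
    ultimately show ?thesis
      by blast
  qed (use e in auto)
qed simp

text \<open>A path inside the fibre projects to the constant path at \<open>p\<close>, which
  represents the identity. This single fact serves both to move the start of an exit path and to
  identify loops in the same coset.\<close>

lemma string_eq_Exit_fibre:
  assumes f: "pathin F f" and g: "exit_path (f 1) g"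
  shows "string_eq S P Q [Exit (path_edge g) (Suc 0)] [Exit (path_edge (concat_path (\<iota> \<circ> f) g)) (Suc 0)]"
proof -
  have f': "pathin L f" "\<And>t. t \<in> {0..1} \<Longrightarrow> \<pi> (f t) = p"
    using f by (auto simp: fibre_def pathin_subtopology)
  then have \<pi>f: "\<pi> \<circ> f \<in> loops M p"
    using pathin_compose[OF _ continuous_\<pi>] by (simp add: loops_def)
  have "path_edge (\<pi> \<circ> f) = path_edge (\<lambda>_. p)"
    using f'(2) by (intro path_edge_eqI) simp
  then have "string_eq S P Q [InM (path_edge (\<lambda>_. p)), Exit (path_edge g) (Suc 0)]
      [Exit (path_edge (concat_path (\<iota> \<circ> f) g)) (Suc 0)]"
    using string_eq_InM_Exit[OF f'(1) \<pi>f g] by simp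
  then show ?thesis
    by (rule string_eq.trans[OF string_eq.sym[OF string_eq_InM_const_append[OF edge_string_Exit[OF g]]]])
qed

lemma exit_path_l\<^sub>0: "exit_path l\<^sub>0 g \<longleftrightarrow> g \<in> loops N q"
  using l\<^sub>0 by (auto simp: exit_path_def loops_def)

lemma string_P_Q_loop:
  assumes "edge_string S P u Q"
  shows "\<exists>g\<in>loops N q. string_eq S P Q u [Exit (path_edge g) (Suc 0)]"
proof -
  obtain l g where g: "exit_path l g" "string_eq S P Q u [Exit (path_edge g) (Suc 0)]"
    using string_P_Q_single[OF assms] by blast
  have "l\<^sub>0 \<in> topspace F" "l \<in> topspace F"
    using l\<^sub>0 g(1) by (auto simp: topspace_F exit_path_def)
  then obtain f where f: "pathin F f" "f 0 = l\<^sub>0" "f 1 = l"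
    using fibre_connected unfolding path_connected_space_def by blast
  then have g': "exit_path (f 1) g" "pathin L f"
    using g(1) by (auto simp: fibre_def pathin_subtopology)
  have "concat_path (\<iota> \<circ> f) g \<in> loops N q"
    using exit_path_concat[OF g'(2) _ g'(1)] f(2) l\<^sub>0 exit_path_l\<^sub>0 by simp
  then show ?thesis
    using string_eq.trans[OF g(2) string_eq_Exit_fibre[OF f(1) g'(1)]] by blast
qed

section \<open>An invariant of strings: the action on the fundamental groups\<close>

abbreviation GM where "GM \<equiv> fundamental_group M p"
abbreviation GN where "GN \<equiv> fundamental_group N q"

text \<open>The edges act as relations on \<open>\<pi>\<^sub>1(M) \<squnion> \<pi>\<^sub>1(N)\<close>, whose summands are marked by \<open>InM\<close> and \<open>InN\<close>:
  \<open>step e s\<close> is the set of states that \<open>e\<close> relates to \<open>s\<close>.\<close>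

definition exit_value :: "(real \<Rightarrow> 'n) \<Rightarrow> (real \<Rightarrow> 'm) set \<Rightarrow> (real \<Rightarrow> 'n) set set" where
  "exit_value g A = {loop_class N q (concat_path (\<iota> \<circ> f) g) | f.
     pathin L f \<and> f 0 = l\<^sub>0 \<and> \<iota> (f 1) = g 0 \<and> loop_class M p (\<pi> \<circ> f) = A}"

fun step where
  "step (InM a) (InM A) = {InM (A \<otimes>\<^bsub>GM\<^esub> loop_class M p (edge_path a))}"
| "step (InN b) (InN B) = {InN (B \<otimes>\<^bsub>GN\<^esub> loop_class N q (edge_path b))}"
| "step (Exit c j) (InM A) = InN ` exit_value (edge_path c) A"
| "step _ _ = {}"

definition run where
  "run u X = fold (\<lambda>e X. \<Union>s\<in>X. step e s) u X"

text \<open>The states admissible at a vertex. No 0-simplex has the form \<open>Exit\<close>, so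
  that case receives a default.\<close>

fun states where
  "states (InM _) = InM ` carrier GM"
| "states (InN _) = InN ` carrier GN"
| "states _ = {}"

lemma run_simps [simp]: "run [] X = X" "run (e # u) X = run u (\<Union>s\<in>X. step e s)"
  by (simp_all add: run_def)

lemma run_append: "run (u @ v) X = run v (run u X)"
  by (simp add: run_def)

sublocale GM: group GM
  using p by (rule group_fundamental_group)

sublocale GN: group GN
  using q by (rule group_fundamental_group)

lemma loop_class_in_GM: "f \<in> loops M p \<Longrightarrow> loop_class M p f \<in> carrier GM"
  and loop_class_in_GN: "g \<in> loops N q \<Longrightarrow> loop_class N q g \<in> carrier GN"
  by (simp_all add: loop_class_in_carrier)

text \<open>An edge of \<open>N\<close> does not carry the point \<open>l\<close>, so
  \<open>exit_value\<close> can only require equality after \<open>\<iota>\<close>; injectivity of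
  \<open>\<iota>\<close> recovers \<open>f 1 = l\<close>.\<close>

lemma lift_simps:
  assumes "exit_path l g" "pathin L f" "f 0 = l\<^sub>0" "\<iota> (f 1) = g 0"
  shows "f 1 = l" "\<pi> \<circ> f \<in> loops M p" "concat_path (\<iota> \<circ> f) g \<in> loops N q"
proof -
  have "f 1 \<in> topspace L"
    using assms(2) by (rule path_finish_in_topspace)
  then show fl: "f 1 = l"
    using assms(1,4) inj_\<iota> by (auto simp: exit_path_def inj_on_def)
  show "\<pi> \<circ> f \<in> loops M p"
    using fl assms(1,3) l\<^sub>0 pathin_compose[OF assms(2) continuous_\<pi>] by (auto simp: loops_def exit_path_def)
  show "concat_path (\<iota> \<circ> f) g \<in> loops N q"
    using exit_path_concat[of f g] fl assms l\<^sub>0 exit_path_l\<^sub>0 by simp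
qed

lemma exit_value_subset:
  assumes "exit_path l g"
  shows "exit_value g A \<subseteq> carrier GN"
  using lift_simps(3)[OF assms] by (auto simp: exit_value_def intro!: loop_class_in_GN)

lemma step_states:
  assumes "e \<in> simplices S (Suc 0)" "s \<in> states (vertex E (Suc 0) 0 e)"
  shows "step e s \<subseteq> states (vertex E (Suc 0) (Suc 0) e)"
  using assms(1)
proof (cases rule: S_edge_cases)
  case (M a)
  then show ?thesis
    using assms(2) loop_class_in_GM[OF M(3)] by auto
next
  case (N b)
  then show ?thesis
    using assms(2) loop_class_in_GN[OF N(3)] by auto
next
  case (Exit \<gamma> l)
  then show ?thesis
    using assms(2) by (auto intro!: imageI subsetD[OF exit_value_subset[OF Exit(3)]])
qed

lemma run_states:
  "edge_string S x u y \<Longrightarrow> X \<subseteq> states x \<Longrightarrow> run u X \<subseteq> states y"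
proof (induction u arbitrary: x X)
  case (Cons e u)
  then have X: "(\<Union>s\<in>X. step e s) \<subseteq> states (vertex E (Suc 0) (Suc 0) e)"
    using step_states by fastforce
  show ?case
    using Cons.IH[OF _ X] Cons.prems(1) by simp
qed auto

text \<open>\<open>g\<close> and \<open>h\<close> start at the same point and so admit the same
  paths \<open>f\<close>; for each of them associativity of concatenation gives the equality. This
  is the invariance under triangles of exit index 1.\<close>

lemma exit_value_concat:
  assumes g: "exit_path l g" and n: "n \<in> loops N q" and h: "path_homotopic N (concat_path g n) h"
  shows "(\<lambda>B. B \<otimes>\<^bsub>GN\<^esub> loop_class N q n) ` exit_value g A = exit_value h A"
proof -
  have *: "loop_class N q (concat_path (\<iota> \<circ> f) g) \<otimes>\<^bsub>GN\<^esub> loop_class N q n = loop_class N q (concat_path (\<iota> \<circ> f) h)"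
    if f: "pathin L f" "f 0 = l\<^sub>0" "\<iota> (f 1) = g 0" for f
  proof -
    have pt: "pathin N (\<iota> \<circ> f)" "pathin N g" "pathin N n" "(\<iota> \<circ> f) 1 = g 0" "g 1 = n 0"
      using f g n pathin_compose[OF f(1) continuous_\<iota>] by (auto simp: exit_path_def loops_def)
    note fg = lift_simps(3)[OF g f]
    have "path_homotopic N (concat_path (concat_path (\<iota> \<circ> f) g) n) (concat_path (\<iota> \<circ> f) (concat_path g n))"
      using pt by (rule path_homotopic_assoc)
    also have "path_homotopic N \<dots> (concat_path (\<iota> \<circ> f) h)"
      using pt h by (intro path_homotopic_concat path_homotopic_refl) auto
    finally show ?thesis
      using loop_class_cong[OF loops_concat[OF fg n]] mult_fundamental_group[OF fg n] by simp
  qed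
  have "h 0 = g 0"
    using path_homotopicD(3)[OF h] by simp
  then have "exit_value h A = (\<lambda>f. loop_class N q (concat_path (\<iota> \<circ> f) h)) `
      {f. pathin L f \<and> f 0 = l\<^sub>0 \<and> \<iota> (f 1) = g 0 \<and> loop_class M p (\<pi> \<circ> f) = A}"
    by (auto simp: exit_value_def)
  moreover have "exit_value g A = (\<lambda>f. loop_class N q (concat_path (\<iota> \<circ> f) g)) `
      {f. pathin L f \<and> f 0 = l\<^sub>0 \<and> \<iota> (f 1) = g 0 \<and> loop_class M p (\<pi> \<circ> f) = A}"
    by (auto simp: exit_value_def)
  ultimately show ?thesis
    using * by (simp add: image_image cong: image_cong_simp)
qed

text \<open>Appending \<open>k\<close> turns a path admissible for \<open>h\<close> into one
  admissible for \<open>g\<close>, and appending the reverse of \<open>k\<close> goes back. Both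
  changes preserve the resulting class in \<open>N\<close>. This is the invariance under triangles
  of exit index 2.\<close>

lemma exit_value_lift:
  assumes g: "exit_path l g" and k: "pathin L k" "\<pi> (k 0) = p" "k 1 = l"
    and h: "path_homotopic N (concat_path (\<iota> \<circ> k) g) h" and A: "A \<in> carrier GM"
  shows "exit_value g (A \<otimes>\<^bsub>GM\<^esub> loop_class M p (\<pi> \<circ> k)) = exit_value h A"
proof (intro equalityI subsetI)
  have \<pi>k: "\<pi> \<circ> k \<in> loops M p"
    using k g pathin_compose[OF k(1) continuous_\<pi>] by (auto simp: loops_def exit_path_def)
  have h0: "exit_path (k 0) h"
    using exit_path_concat[of k g] k g path_homotopicD[OF h] by (simp add: exit_path_def)
  have \<iota>k: "pathin N (\<iota> \<circ> k)" "pathin N g" "(\<iota> \<circ> k) 1 = g 0"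
    using k g pathin_compose[OF k(1) continuous_\<iota>] by (auto simp: exit_path_def)
  {
    fix B assume "B \<in> exit_value h A"
    then obtain f where f: "pathin L f" "f 0 = l\<^sub>0" "\<iota> (f 1) = h 0" "loop_class M p (\<pi> \<circ> f) = A"
        and B: "B = loop_class N q (concat_path (\<iota> \<circ> f) h)"
      by (auto simp: exit_value_def)
    note fl = lift_simps[OF h0 f(1-3)]
    let ?f = "concat_path f k"
    have ff: "pathin L ?f" "?f 0 = l\<^sub>0" "\<iota> (?f 1) = g 0"
      using f k g fl by (auto simp: pathin_concat exit_path_def)
    have "loop_class M p (\<pi> \<circ> ?f) = A \<otimes>\<^bsub>GM\<^esub> loop_class M p (\<pi> \<circ> k)"
      using mult_fundamental_group[OF fl(2) \<pi>k] f(4) by (simp add: comp_concat_path)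
    moreover have "loop_class N q (concat_path (\<iota> \<circ> ?f) g) = B"
    proof -
      have \<iota>f: "pathin N (\<iota> \<circ> f)" "(\<iota> \<circ> f) 1 = (\<iota> \<circ> k) 0"
        using f fl pathin_compose[OF f(1) continuous_\<iota>] by auto
      have "path_homotopic N (concat_path (\<iota> \<circ> ?f) g) (concat_path (\<iota> \<circ> f) (concat_path (\<iota> \<circ> k) g))"
        unfolding comp_concat_path using \<iota>f \<iota>k by (intro path_homotopic_assoc)
      also have "path_homotopic N \<dots> (concat_path (\<iota> \<circ> f) h)"
        using \<iota>f h by (intro path_homotopic_concat path_homotopic_refl) auto
      finally show ?thesis
        unfolding B by (rule loop_class_cong[OF lift_simps(3)[OF g ff]])
    qed
    ultimately show "B \<in> exit_value g (A \<otimes>\<^bsub>GM\<^esub> loop_class M p (\<pi> \<circ> k))"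
      using ff unfolding exit_value_def by blast
  }
  {
    fix B assume "B \<in> exit_value g (A \<otimes>\<^bsub>GM\<^esub> loop_class M p (\<pi> \<circ> k))"
    then obtain f where f: "pathin L f" "f 0 = l\<^sub>0" "\<iota> (f 1) = g 0"
        "loop_class M p (\<pi> \<circ> f) = A \<otimes>\<^bsub>GM\<^esub> loop_class M p (\<pi> \<circ> k)"
        and B: "B = loop_class N q (concat_path (\<iota> \<circ> f) g)"
      by (auto simp: exit_value_def)
    note fl = lift_simps[OF g f(1-3)]
    let ?r = "reverse_path k"
    let ?f = "concat_path f ?r"
    have r: "pathin L ?r" "?r 0 = f 1" "?r 1 = k 0"
      using k fl pathin_reverse by auto
    have ff: "pathin L ?f" "?f 0 = l\<^sub>0" "\<iota> (?f 1) = h 0"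
      using f r h0 by (auto simp: pathin_concat exit_path_def)
    have \<pi>r: "\<pi> \<circ> ?r \<in> loops M p"
      using loops_reverse[OF \<pi>k] by (simp add: comp_reverse_path)
    have kr: "loop_class M p (\<pi> \<circ> k) \<otimes>\<^bsub>GM\<^esub> loop_class M p (\<pi> \<circ> ?r) = \<one>\<^bsub>GM\<^esub>"
    proof -
      have "path_homotopic M (concat_path (\<pi> \<circ> k) (\<pi> \<circ> ?r)) (\<lambda>_. p)"
        using path_homotopic_concat_reverse[of M "\<pi> \<circ> k"] \<pi>k by (simp add: comp_reverse_path loops_def)
      then show ?thesis
        using loop_class_cong[OF loops_concat[OF \<pi>k \<pi>r]] mult_fundamental_group[OF \<pi>k \<pi>r]
        by (simp add: one_fundamental_group)
    qed
    have "loop_class M p (\<pi> \<circ> ?f) = (A \<otimes>\<^bsub>GM\<^esub> loop_class M p (\<pi> \<circ> k)) \<otimes>\<^bsub>GM\<^esub> loop_class M p (\<pi> \<circ> ?r)"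
      using mult_fundamental_group[OF fl(2) \<pi>r] f(4) by (simp add: comp_concat_path)
    also have "\<dots> = A"
      using A loop_class_in_GM[OF \<pi>k] loop_class_in_GM[OF \<pi>r] by (simp add: GM.m_assoc kr)
    finally have "loop_class M p (\<pi> \<circ> ?f) = A" .
    moreover have "loop_class N q (concat_path (\<iota> \<circ> ?f) h) = B"
    proof -
      let ?a = "\<iota> \<circ> f" and ?b = "\<iota> \<circ> ?r" and ?c = "\<iota> \<circ> k"
      have pt: "pathin N ?a" "pathin N ?b" "?a 1 = ?b 0" "?b 1 = ?c 0"
        using f r pathin_compose[OF _ continuous_\<iota>] by auto
      have bc: "path_homotopic N (concat_path ?b ?c) (\<lambda>_. g 0)"
        using path_homotopic_reverse_concat[OF \<iota>k(1)] \<iota>k(3) by (simp add: comp_reverse_path)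
      have "path_homotopic N (concat_path (\<iota> \<circ> ?f) h) (concat_path ?a (concat_path ?b h))"
        unfolding comp_concat_path using pt h0 path_homotopicD[OF h]
        by (intro path_homotopic_assoc) (auto simp: exit_path_def)
      also have "path_homotopic N \<dots> (concat_path ?a (concat_path ?b (concat_path ?c g)))"
        using pt path_homotopic_sym[OF h] path_homotopicD[OF h]
        by (intro path_homotopic_concat path_homotopic_refl) auto
      also have "path_homotopic N \<dots> (concat_path ?a (concat_path (concat_path ?b ?c) g))"
        using pt \<iota>k by (intro path_homotopic_concat path_homotopic_refl path_homotopic_sym[OF path_homotopic_assoc]) auto
      also have "path_homotopic N \<dots> (concat_path ?a (concat_path (\<lambda>_. g 0) g))"
        using pt \<iota>k bc by (intro path_homotopic_concat path_homotopic_refl) auto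
      also have "path_homotopic N \<dots> (concat_path ?a g)"
        using pt \<iota>k f by (intro path_homotopic_concat path_homotopic_refl path_homotopic_concat_const_left) auto
      finally show ?thesis
        unfolding B by (rule loop_class_cong[OF lift_simps(3)[OF h0 ff]])
    qed
    ultimately show "B \<in> exit_value h A"
      using ff unfolding exit_value_def by blast
  }
qed

text \<open>For triangles in \<open>M\<close> or \<open>N\<close> this is associativity in the group
  together with \<open>path_homotopic_triangle\<close>; the exit indices 1 and 2 are
  \<open>exit_value_concat\<close> and \<open>exit_value_lift\<close>.\<close>

lemma step_triangle:
  assumes \<sigma>: "\<sigma> \<in> simplices S 2" and s: "s \<in> states (vertex E 2 0 \<sigma>)"
  shows "(\<Union>t\<in>step (edge E 0 (Suc 0) \<sigma>) s. step (edge E (Suc 0) 2 \<sigma>) t) = step (edge E 0 2 \<sigma>) s"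
proof -
  have edges: "edge E 0 (Suc 0) \<sigma> \<in> simplices S (Suc 0)" "edge E (Suc 0) 2 \<sigma> \<in> simplices S (Suc 0)" "edge E 0 2 \<sigma> \<in> simplices S (Suc 0)"
    using edge_simplex[OF simplicial_S \<sigma>] by simp_all
  have \<sigma>E: "\<sigma> \<in> simplices E 2" and V: "vertex E 2 0 \<sigma> = vertex E (Suc 0) 0 (edge E 0 (Suc 0) \<sigma>)"
    using \<sigma> vertex_edge(1)[OF simplicial_S \<sigma>, of 0 "Suc 0"] by (simp_all add: simplices_full_sub)
  show ?thesis
  proof (cases \<sigma>)
    case (InM \<tau>)
    then have \<tau>: "\<tau> \<in> simplices (Sing M) 2"
      using \<sigma>E by (simp add: simplices_exit_paths_MN)
    have loops: "edge_path (edge (Sing M) 0 (Suc 0) \<tau>) \<in> loops M p" "edge_path (edge (Sing M) (Suc 0) 2 \<tau>) \<in> loops M p"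
      using edges by (auto simp: InM exit_paths_InM elim: S_edge_cases)
    obtain A where A: "s = InM A" "A \<in> carrier GM"
      using s by (auto simp: InM exit_paths_InM)
    show ?thesis
      using A loops loop_class_in_GM[OF loops(1)] loop_class_in_GM[OF loops(2)]
        loop_class_cong[OF loops_concat[OF loops] path_homotopic_triangle[OF \<tau>]]
      by (simp add: InM exit_paths_InM GM.m_assoc mult_fundamental_group)
  next
    case (InN \<tau>)
    then have \<tau>: "\<tau> \<in> simplices (Sing N) 2"
      using \<sigma>E by (simp add: simplices_exit_paths_MN)
    have loops: "edge_path (edge (Sing N) 0 (Suc 0) \<tau>) \<in> loops N q" "edge_path (edge (Sing N) (Suc 0) 2 \<tau>) \<in> loops N q"
      using edges by (auto simp: InN exit_paths_InN elim: S_edge_cases)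
    obtain A where A: "s = InN A" "A \<in> carrier GN"
      using s by (auto simp: InN exit_paths_InN)
    show ?thesis
      using A loops loop_class_in_GN[OF loops(1)] loop_class_in_GN[OF loops(2)]
        loop_class_cong[OF loops_concat[OF loops] path_homotopic_triangle[OF \<tau>]]
      by (simp add: InN exit_paths_InN GN.m_assoc mult_fundamental_group)
  next
    case (Exit \<tau> j)
    then have \<tau>: "\<tau> \<in> simplices (Sing N) 2" and j: "j = Suc 0 \<or> j = 2"
        and L: "act (Sing N) 2 (j - 1) id \<tau> \<in> simplex_map (j - 1) \<iota> ` simplices (Sing L) (j - 1)"
      using \<sigma>E by (auto simp: simplices_exit_paths_Exit)
    note htpy = path_homotopic_triangle[OF \<tau>]
    from j show ?thesis
    proof
      assume j: "j = Suc 0"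
      have "edge E 0 (Suc 0) \<sigma> = Exit (edge (Sing N) 0 (Suc 0) \<tau>) (Suc 0)"
        by (simp add: Exit j edge_Exit_1)
      with edges(1) obtain l where g: "exit_path l (edge_path (edge (Sing N) 0 (Suc 0) \<tau>))" "vertex E (Suc 0) 0 (edge E 0 (Suc 0) \<sigma>) = P"
        by (auto elim: S_edge_cases)
      have "edge_path (edge (Sing N) (Suc 0) 2 \<tau>) \<in> loops N q"
        using edges(2) by (auto simp: Exit j edge_Exit_1 elim: S_edge_cases)
      note eq = exit_value_concat[OF g(1) this htpy]
      obtain A where A: "s = InM A" "A \<in> carrier GM"
        using s g(2) by (auto simp: V)
      show ?thesis
        unfolding A Exit j edge_Exit_1 step.simps eq[symmetric] by auto
    next
      assume j: "j = 2"
      then obtain e where e: "e \<in> simplices (Sing L) (Suc 0)" "edge (Sing N) 0 (Suc 0) \<tau> = simplex_map (Suc 0) \<iota> e"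
        using L by (auto simp: act_Sing_initial_edge(2)[OF \<tau>])
      let ?k = "edge_path e" and ?g = "edge_path (edge (Sing N) (Suc 0) 2 \<tau>)"
      have k: "pathin L ?k"
        using e(1) by (rule pathin_edge_path)
      have "edge E (Suc 0) 2 \<sigma> = Exit (edge (Sing N) (Suc 0) 2 \<tau>) (Suc 0)"
        by (simp add: Exit j edge_Exit_2)
      with edges(2) obtain l where g: "exit_path l ?g"
        by (auto elim: S_edge_cases)
      have M: "edge E 0 (Suc 0) \<sigma> = InM (simplex_map (Suc 0) \<pi> e)"
        by (simp add: Exit j edge_Exit_2 e(2) inv_simplex_map[OF e(1)])
      have \<pi>: "edge_path (simplex_map (Suc 0) \<pi> e) \<in> loops M p" and V0: "vertex E (Suc 0) 0 (edge E 0 (Suc 0) \<sigma>) = P"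
        using edges(1) by (auto simp: M elim: S_edge_cases)
      \<comment> \<open>The two paths agree on the unit interval but need not be equal as total
        functions.\<close>
      have ht\<pi>: "path_homotopic M (edge_path (simplex_map (Suc 0) \<pi> e)) (\<pi> \<circ> ?k)"
        using \<pi> by (intro path_homotopic_eq) (auto simp: edge_path_simplex_map loops_def)
      have "path_homotopic N (\<iota> \<circ> ?k) (edge_path (edge (Sing N) 0 (Suc 0) \<tau>))"
        using pathin_compose[OF k continuous_\<iota>] by (intro path_homotopic_eq) (auto simp: e(2) edge_path_simplex_map)
      moreover have ends: "edge_path (edge (Sing N) 0 (Suc 0) \<tau>) 1 = ?g 0"
        by (simp add: edge_path_edge_Sing)
      ultimately have "path_homotopic N (concat_path (\<iota> \<circ> ?k) ?g) (edge_path (edge (Sing N) 0 2 \<tau>))"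
        using g path_homotopic_trans[OF path_homotopic_concat htpy] path_homotopicD(4) path_homotopic_refl
        by (metis exit_path_def)
      moreover have "?k 1 = l"
        using ends g path_finish_in_topspace[OF k] inj_\<iota> by (auto simp: e(2) edge_path_simplex_map exit_path_def inj_on_def)
      moreover have "\<pi> (?k 0) = p"
        using \<pi> by (simp add: edge_path_simplex_map loops_def)
      moreover obtain A where A: "s = InM A" "A \<in> carrier GM"
        using s V0 by (auto simp: V)
      ultimately have "exit_value ?g (A \<otimes>\<^bsub>GM\<^esub> loop_class M p (\<pi> \<circ> ?k)) = exit_value (edge_path (edge (Sing N) 0 2 \<tau>)) A"
        using exit_value_lift[OF g k] by blast
      then show ?thesis
        using loop_class_cong[OF \<pi> ht\<pi>] unfolding M by (simp add: A Exit j edge_Exit_2)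
    qed
  qed
qed

text \<open>The states are confined to the group carriers, where the unit and associativity laws
  hold; \<open>run_states\<close> keeps them there across a concatenation of strings.\<close>

lemma run_string_eq:
  "string_eq S x y u v \<Longrightarrow> X \<subseteq> states x \<Longrightarrow> run u X = run v X"
proof (induction arbitrary: X rule: string_eq.induct)
  case (append x y u u' z v v')
  have "run u X \<subseteq> states y"
    using append.hyps(1) append.prems string_eq_edge_string[OF simplicial_S] run_states by blast
  then show ?case
    using append by (simp add: run_append)
next
  case (degenerate x)
  have "step (act E 0 (Suc 0) (\<lambda>_. 0) x) s = {s}" if "s \<in> states x" for s
  proof -
    from degenerate consider "x = P" | "x = Q"
      by (auto simp: objects_S)
    then show ?thesis
    proof cases
      case 1
      have "loop_class M p (edge_path (path_edge (\<lambda>_. p))) = \<one>\<^bsub>GM\<^esub>"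
        using loop_class_cong[OF loops_const[OF p] path_homotopic_edge_path] p by (simp add: one_fundamental_group)
      then show ?thesis
        using that by (auto simp: 1 exit_paths_InM degenerate_Sing)
    next
      case 2
      have "loop_class N q (edge_path (path_edge (\<lambda>_. q))) = \<one>\<^bsub>GN\<^esub>"
        using loop_class_cong[OF loops_const[OF q] path_homotopic_edge_path] q by (simp add: one_fundamental_group)
      then show ?thesis
        using that by (auto simp: 2 exit_paths_InN degenerate_Sing)
    qed
  qed
  then show ?case
    using degenerate.prems by auto
next
  case (triangle \<sigma>)
  have "(\<Union>t\<in>(\<Union>s\<in>X. step (edge E 0 (Suc 0) \<sigma>) s). step (edge E (Suc 0) 2 \<sigma>) t)
      = (\<Union>s\<in>X. \<Union>t\<in>step (edge E 0 (Suc 0) \<sigma>) s. step (edge E (Suc 0) 2 \<sigma>) t)"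
    by blast
  also have "\<dots> = (\<Union>s\<in>X. step (edge E 0 2 \<sigma>) s)"
    using step_triangle[OF triangle.hyps] triangle.prems by (intro SUP_cong) auto
  finally show ?case
    by simp
qed auto

section \<open>The endomorphism groups\<close>

lemma loop_class_edge_path:
  assumes "f \<in> loops X x"
  shows "loop_class X x (edge_path (path_edge f)) = loop_class X x f"
  using loop_class_cong[OF assms path_homotopic_edge_path] assms by (simp add: loops_def)

lemma string_eq_InM_iff:
  assumes "f \<in> loops M p" "g \<in> loops M p"
  shows "string_eq S P P [InM (path_edge f)] [InM (path_edge g)] \<longleftrightarrow> path_homotopic M f g"
proof
  assume "string_eq S P P [InM (path_edge f)] [InM (path_edge g)]"
  \<comment> \<open>From the unit, right multiplication returns the loop class itself, so the action
    is faithful on classes.\<close>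
  then have "run [InM (path_edge f)] {InM \<one>\<^bsub>GM\<^esub>} = run [InM (path_edge g)] {InM \<one>\<^bsub>GM\<^esub>}"
    by (rule run_string_eq) simp
  then have "loop_class M p f = loop_class M p g"
    using loop_class_in_GM[OF assms(1)] loop_class_in_GM[OF assms(2)]
    by (simp add: loop_class_edge_path[OF assms(1)] loop_class_edge_path[OF assms(2)])
  then show "path_homotopic M f g"
    using assms loop_class_eq_iff by metis
next
  assume "path_homotopic M f g"
  then show "string_eq S P P [InM (path_edge f)] [InM (path_edge g)]"
    using string_eq_InM[OF string_eq_loop_homotopic[OF assms(1)]] by simp
qed

lemma string_eq_InN_iff:
  assumes "f \<in> loops N q" "g \<in> loops N q"
  shows "string_eq S Q Q [InN (path_edge f)] [InN (path_edge g)] \<longleftrightarrow> path_homotopic N f g"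
proof
  assume "string_eq S Q Q [InN (path_edge f)] [InN (path_edge g)]"
  then have "run [InN (path_edge f)] {InN \<one>\<^bsub>GN\<^esub>} = run [InN (path_edge g)] {InN \<one>\<^bsub>GN\<^esub>}"
    by (rule run_string_eq) simp
  then have "loop_class N q f = loop_class N q g"
    using loop_class_in_GN[OF assms(1)] loop_class_in_GN[OF assms(2)]
    by (simp add: loop_class_edge_path[OF assms(1)] loop_class_edge_path[OF assms(2)])
  then show "path_homotopic N f g"
    using assms loop_class_eq_iff by metis
next
  assume "path_homotopic N f g"
  then show "string_eq S Q Q [InN (path_edge f)] [InN (path_edge g)]"
    using string_eq_InN[OF string_eq_loop_homotopic[OF assms(1)]] by simp
qed

lemma End_P: "End (homotopy_category S) P \<cong> GM"
proof (rule End_homotopy_category_iso[OF p, where I = InM])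
  show "edge_string S P [InM (path_edge f)] P" if "f \<in> loops M p" for f
    using edge_string_single[OF InM_edge(1)[OF that]] by (simp add: InM_edge[OF that])
  show "string_eq S P P [InM (path_edge f), InM (path_edge g)] [InM (path_edge (concat_path f g))]"
    if "f \<in> loops M p" "g \<in> loops M p" for f g
    using string_eq_InM[OF string_eq_loop_concat[OF that]] by simp
qed (simp_all add: string_P_single string_eq_InM_iff)

lemma End_Q: "End (homotopy_category S) Q \<cong> GN"
proof (rule End_homotopy_category_iso[OF q, where I = InN])
  show "edge_string S Q [InN (path_edge f)] Q" if "f \<in> loops N q" for f
    using edge_string_single[OF InN_edge(1)[OF that]] by (simp add: InN_edge[OF that])
  show "string_eq S Q Q [InN (path_edge f), InN (path_edge g)] [InN (path_edge (concat_path f g))]"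
    if "f \<in> loops N q" "g \<in> loops N q" for f g
    using string_eq_InN[OF string_eq_loop_concat[OF that]] by simp
qed (simp_all add: string_Q_single string_eq_InN_iff)

section \<open>Morphisms from p to q as cosets\<close>

definition H where "H = fundamental_group_map N q \<iota> ` carrier (fundamental_group F l\<^sub>0)"

lemma H_eq: "H = (\<lambda>f. loop_class N q (\<iota> \<circ> f)) ` loops F l\<^sub>0"
proof -
  have "continuous_map F N \<iota>"
    using continuous_\<iota> unfolding fibre_def by (rule continuous_map_from_subtopology)
  then show ?thesis
    using fundamental_group_map_loop_class[of F N \<iota> _ l\<^sub>0] l\<^sub>0
    by (auto simp: H_def carrier_fundamental_group image_image)
qed

lemma fibre_loop:
  assumes "f \<in> loops F l\<^sub>0"
  shows "f \<in> loops L l\<^sub>0" "\<iota> \<circ> f \<in> loops N q" "loop_class M p (\<pi> \<circ> f) = \<one>\<^bsub>GM\<^esub>"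
proof -
  have f: "pathin L f" "\<And>t. t \<in> {0..1} \<Longrightarrow> \<pi> (f t) = p" "f 0 = l\<^sub>0" "f 1 = l\<^sub>0"
    using assms by (auto simp: loops_def fibre_def pathin_subtopology)
  then show fL: "f \<in> loops L l\<^sub>0"
    by (simp add: loops_def)
  show "\<iota> \<circ> f \<in> loops N q"
    using loops_comp[OF fL continuous_\<iota>] l\<^sub>0 by simp
  have "path_homotopic M (\<lambda>_. p) (\<pi> \<circ> f)"
    using f p by (intro path_homotopic_eq) auto
  then show "loop_class M p (\<pi> \<circ> f) = \<one>\<^bsub>GM\<^esub>"
    using loop_class_cong[OF loops_const[OF p]] by (simp add: one_fundamental_group)
qed

lemma exit_value_one:
  assumes g: "g \<in> loops N q"
  shows "exit_value g \<one>\<^bsub>GM\<^esub> = H #>\<^bsub>GN\<^esub> loop_class N q g"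
proof (intro equalityI subsetI)
  fix B assume "B \<in> exit_value g \<one>\<^bsub>GM\<^esub>"
  then obtain f where f: "pathin L f" "f 0 = l\<^sub>0" "\<iota> (f 1) = g 0" "loop_class M p (\<pi> \<circ> f) = \<one>\<^bsub>GM\<^esub>"
      and B: "B = loop_class N q (concat_path (\<iota> \<circ> f) g)"
    by (auto simp: exit_value_def)
  have fl: "f 1 = l\<^sub>0" "\<pi> \<circ> f \<in> loops M p" "concat_path (\<iota> \<circ> f) g \<in> loops N q"
    using lift_simps[of l\<^sub>0 g f] f(1-3) g exit_path_l\<^sub>0 by auto
  have "path_homotopic M (\<pi> \<circ> f) (\<lambda>_. p)"
    using f(4) loop_class_eq_iff[OF fl(2) loops_const[OF p]] by (simp add: one_fundamental_group)
  moreover have "f \<in> loops L l\<^sub>0"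
    using f fl by (simp add: loops_def)
  ultimately obtain k where k: "k \<in> loops F l\<^sub>0" "path_homotopic L f k"
    using fibre_loop_of_null_homotopic[OF fibration_\<pi>] by metis
  have "path_homotopic N (concat_path (\<iota> \<circ> f) g) (concat_path (\<iota> \<circ> k) g)"
    using k g f(3) path_homotopic_compose[OF k(2) continuous_\<iota>]
    by (intro path_homotopic_concat path_homotopic_refl) (auto simp: loops_def)
  then have "B = loop_class N q (\<iota> \<circ> k) \<otimes>\<^bsub>GN\<^esub> loop_class N q g"
    using loop_class_cong[OF fl(3)] B mult_fundamental_group[OF fibre_loop(2)[OF k(1)] g] by simp
  then show "B \<in> H #>\<^bsub>GN\<^esub> loop_class N q g"
    using k(1) by (auto simp: r_coset_def H_eq)
next
  fix B assume "B \<in> H #>\<^bsub>GN\<^esub> loop_class N q g"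
  then obtain f where f: "f \<in> loops F l\<^sub>0" "B = loop_class N q (\<iota> \<circ> f) \<otimes>\<^bsub>GN\<^esub> loop_class N q g"
    by (auto simp: r_coset_def H_eq)
  note fl = fibre_loop[OF f(1)]
  have "B = loop_class N q (concat_path (\<iota> \<circ> f) g)"
    using f(2) mult_fundamental_group[OF fl(2) g] by simp
  moreover have "pathin L f" "f 0 = l\<^sub>0" "\<iota> (f 1) = g 0"
    using fl(1) g l\<^sub>0 by (auto simp: loops_def)
  ultimately show "B \<in> exit_value g \<one>\<^bsub>GM\<^esub>"
    using fl(3) unfolding exit_value_def by blast
qed

lemma run_Exit:
  assumes g: "g \<in> loops N q"
  shows "run [Exit (path_edge g) (Suc 0)] {InM \<one>\<^bsub>GM\<^esub>} = InN ` (H #>\<^bsub>GN\<^esub> loop_class N q g)"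
proof -
  have "edge_path (path_edge g) \<in> loops N q"
    using loops_path_homotopic[OF g path_homotopic_edge_path] g by (simp add: loops_def)
  then show ?thesis
    by (simp add: exit_value_one loop_class_edge_path[OF g])
qed

text \<open>In one direction the coset is read off by letting the strings act on the unit of
  \<open>GM\<close>. In the other, equal cosets make \<open>g\<close> homotopic to \<open>h\<close>
  preceded by the image of a loop of the fibre, and \<open>string_eq_Exit_fibre\<close> removes that
  loop.\<close>

lemma string_eq_Exit_iff:
  assumes g: "g \<in> loops N q" and h: "h \<in> loops N q"
  shows "string_eq S P Q [Exit (path_edge g) (Suc 0)] [Exit (path_edge h) (Suc 0)] \<longleftrightarrow>
     H #>\<^bsub>GN\<^esub> loop_class N q g = H #>\<^bsub>GN\<^esub> loop_class N q h"
proof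
  assume "string_eq S P Q [Exit (path_edge g) (Suc 0)] [Exit (path_edge h) (Suc 0)]"
  then have "run [Exit (path_edge g) (Suc 0)] {InM \<one>\<^bsub>GM\<^esub>} = run [Exit (path_edge h) (Suc 0)] {InM \<one>\<^bsub>GM\<^esub>}"
    by (rule run_string_eq) simp
  then show "H #>\<^bsub>GN\<^esub> loop_class N q g = H #>\<^bsub>GN\<^esub> loop_class N q h"
    unfolding run_Exit[OF g] run_Exit[OF h] by (simp add: inj_image_eq_iff inj_def)
next
  assume eq: "H #>\<^bsub>GN\<^esub> loop_class N q g = H #>\<^bsub>GN\<^esub> loop_class N q h"
  \<comment> \<open>The constant loop shows that the unit lies in \<open>H\<close>, so the class of
    \<open>g\<close> lies in its own coset and hence in that of \<open>h\<close>.\<close>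
  have "(\<lambda>_. l\<^sub>0) \<in> loops F l\<^sub>0"
    using l\<^sub>0 by (intro loops_const) (simp add: topspace_F)
  moreover have "loop_class N q (\<iota> \<circ> (\<lambda>_. l\<^sub>0)) = \<one>\<^bsub>GN\<^esub>"
    using l\<^sub>0 by (simp add: one_fundamental_group comp_def)
  ultimately have "\<one>\<^bsub>GN\<^esub> \<in> H"
    unfolding H_eq by (metis image_eqI)
  then have "loop_class N q g \<in> H #>\<^bsub>GN\<^esub> loop_class N q g"
    using loop_class_in_GN[OF g] by (force simp: r_coset_def)
  then obtain f where f: "f \<in> loops F l\<^sub>0" "loop_class N q g = loop_class N q (\<iota> \<circ> f) \<otimes>\<^bsub>GN\<^esub> loop_class N q h"
    unfolding eq by (auto simp: r_coset_def H_eq)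
  note fl = fibre_loop[OF f(1)]
  have "loop_class N q g = loop_class N q (concat_path (\<iota> \<circ> f) h)"
    using f(2) mult_fundamental_group[OF fl(2) h] by simp
  then have "path_homotopic N g (concat_path (\<iota> \<circ> f) h)"
    using loop_class_eq_iff[OF g loops_concat[OF fl(2) h]] by simp
  then have 1: "string_eq S P Q [Exit (path_edge g) (Suc 0)] [Exit (path_edge (concat_path (\<iota> \<circ> f) h)) (Suc 0)]"
    using g exit_path_l\<^sub>0 string_eq_Exit_homotopic by blast
  have "pathin F f" "exit_path (f 1) h"
    using f(1) h exit_path_l\<^sub>0 by (auto simp: loops_def)
  then have "string_eq S P Q [Exit (path_edge h) (Suc 0)] [Exit (path_edge (concat_path (\<iota> \<circ> f) h)) (Suc 0)]"
    by (rule string_eq_Exit_fibre)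
  then show "string_eq S P Q [Exit (path_edge g) (Suc 0)] [Exit (path_edge h) (Suc 0)]"
    using string_eq.trans[OF 1 string_eq.sym] by simp
qed

lemma Hom_P_Q: "\<exists>\<phi>. bij_betw \<phi> (Hom (homotopy_category S) P Q) (rcosets\<^bsub>GN\<^esub> H)"
proof -
  let ?k = "\<lambda>g. string_class S P Q [Exit (path_edge g) (Suc 0)]"
  let ?c = "\<lambda>g. H #>\<^bsub>GN\<^esub> loop_class N q g"
  have edge: "edge_string S P [Exit (path_edge g) (Suc 0)] Q" if "g \<in> loops N q" for g
    using that unfolding exit_path_l\<^sub>0[symmetric] by (rule edge_string_Exit)
  have Hom: "Hom (homotopy_category S) P Q = ?k ` loops N q"
  proof (intro equalityI subsetI)
    fix c assume "c \<in> Hom (homotopy_category S) P Q"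
    then obtain u where u: "edge_string S P u Q" "c = string_class S P Q u"
      by (auto simp: homotopy_category_def)
    obtain g where g: "g \<in> loops N q" "string_eq S P Q u [Exit (path_edge g) (Suc 0)]"
      using string_P_Q_loop[OF u(1)] by auto
    then show "c \<in> ?k ` loops N q"
      using u(2) string_class_cong[OF g(2)] by simp
  next
    fix c assume "c \<in> ?k ` loops N q"
    then show "c \<in> Hom (homotopy_category S) P Q"
      using edge by (auto simp: homotopy_category_def simp del: edge_string.simps)
  qed
  have R: "rcosets\<^bsub>GN\<^esub> H = ?c ` loops N q"
    by (auto simp: RCOSETS_def carrier_fundamental_group)
  have iff: "?k g = ?k h \<longleftrightarrow> ?c g = ?c h" if "g \<in> loops N q" "h \<in> loops N q" for g h
    using string_class_eq_iff[OF edge[OF that(1)] edge[OF that(2)]] string_eq_Exit_iff[OF that] by simp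
  \<comment> \<open>By \<open>iff\<close>, the coset does not depend on the chosen loop, and
    distinct morphisms have distinct cosets.\<close>
  define \<phi> where "\<phi> c = ?c (SOME g. g \<in> loops N q \<and> ?k g = c)" for c
  have \<phi>: "\<phi> (?k g) = ?c g" if "g \<in> loops N q" for g
  proof -
    have "(SOME h. h \<in> loops N q \<and> ?k h = ?k g) \<in> loops N q \<and> ?k (SOME h. h \<in> loops N q \<and> ?k h = ?k g) = ?k g"
      using that by (intro someI[of "\<lambda>h. h \<in> loops N q \<and> ?k h = ?k g" g]) simp
    then show ?thesis
      unfolding \<phi>_def using iff[OF _ that] by blast
  qed
  have "bij_betw \<phi> (Hom (homotopy_category S) P Q) (rcosets\<^bsub>GN\<^esub> H)"
    unfolding bij_betw_def Hom R by (auto simp: \<phi> image_image inj_on_def iff cong: image_cong)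
  then show ?thesis
    by blast
qed

end

theorem lemma3p22:
  fixes M :: "'m topology" and L :: "'l topology" and N :: "'n topology"
    and \<pi> :: "'l \<Rightarrow> 'm" and \<iota> :: "'l \<Rightarrow> 'n" and p :: 'm and q :: 'n
  assumes "linked_space M L N \<pi> \<iota>"
    and "p \<in> topspace M" and "q \<in> topspace N"
    and "q \<in> \<iota> ` topspace (fibre L \<pi> p)"
    and "path_connected_space (fibre L \<pi> p)"
  shows "let P = InM (point_simplex p);
             Q = InN (point_simplex q);
             C = Pi1 M L N \<pi> \<iota> {P, Q};
             F = fibre L \<pi> p;
             H = fundamental_group_map N q \<iota> `
                   carrier (fundamental_group F (inv_into (topspace F) \<iota> q))
         in is_category C \<and> Obj C = {P, Q} \<and>
            End C P \<cong> fundamental_group M p \<and>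
            End C Q \<cong> fundamental_group N q \<and>
            (\<exists>\<phi>. bij_betw \<phi> (Hom C P Q) (rcosets\<^bsub>fundamental_group N q\<^esub> H))"
proof -
  interpret pointed_link M L N \<pi> \<iota> p q
    using assms by unfold_locales
  have "Obj (homotopy_category S) = {P, Q}"
    using objects_S by (simp add: homotopy_category_def)
  then show ?thesis
    using is_category_homotopy_category[OF simplicial_S] End_P End_Q Hom_P_Q
    unfolding Let_def Pi1_def H_def l\<^sub>0_def by blast
qed

end
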